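(* Let $K \subset \mathbb{R}^2$ be a centrally symmetric convex body. Let $X, X'$ be independent uniformly distributed random points in $K$ and $Y, Y'$ independent uniformly distributed random points on $\partial K$. Then for every real $n \ge 1$, $$\mathbb{E}|YY'|^n \ge \mathbb{E}|XX'|^n.$$
   Context: A convex body is a convex compact set with non-empty interior. "Uniform in $K$" is with respect to Lebesgue measure; "uniform on $\partial K$" is with respect to arc length. $|AB|$ denotes the Euclidean distance between points $A$ and $B$. *)

theory Defs
  imports "HOL-Probability.Probability"
begin

definition convex_body :: "(real^2) set \<Rightarrow> bool" where
  "convex_body K \<longleftrightarrow> convex K \<and> compact K \<and> interior K \<noteq> {}"

text \<open>The centre of symmetry need not be the origin.\<close>

definition centrally_symmetric :: "(real^2) set \<Rightarrow> bool" where
  "centrally_symmetric K \<longleftrightarrow> (\<exists>c. \<forall>x\<in>K. 2 *\<^sub>R c - x \<in> K)"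

text \<open>Length of the restriction of \<open>g\<close> to the interval from \<open>a\<close> to \<open>b\<close>, where \<open>a \<le> b\<close>:
  the supremum of the lengths of the inscribed polygonal lines with vertices
  \<open>g (t 0), \<dots>, g (t m)\<close>, over all partitions \<open>a = t 0 \<le> \<dots> \<le> t m = b\<close>.\<close>

definition curve_length :: "(real \<Rightarrow> real^2) \<Rightarrow> real \<Rightarrow> real \<Rightarrow> ennreal" where
  "curve_length g a b =
     (SUP (m, t) \<in> {(m :: nat, t :: nat \<Rightarrow> real). mono_on {..m} t \<and> t 0 = a \<and> t m = b}.
        ennreal (\<Sum>i<m. dist (g (t i)) (g (t (Suc i)))))"

text \<open>\<open>g\<close>, restricted to \<open>{0..L}\<close>, parametrizes the simple closed curve \<open>C\<close> by arc length.
  Continuity of \<open>g\<close> on \<open>{0..L}\<close> follows from the last conjunct.\<close>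

definition arc_length_parametrization ::
    "(real \<Rightarrow> real^2) \<Rightarrow> real \<Rightarrow> (real^2) set \<Rightarrow> bool" where
  "arc_length_parametrization g L C \<longleftrightarrow>
     0 < L \<and> g ` {0..L} = C \<and> inj_on g {0..<L} \<and> g L = g 0 \<and>
     (\<forall>s t. 0 \<le> s \<and> s \<le> t \<and> t \<le> L \<longrightarrow> curve_length g s t = ennreal (t - s))"

text \<open>The arc length measure of \<open>C\<close> is the image of Lebesgue measure on \<open>{0..L}\<close> under an
  arc length parametrization. It does not depend on the choice of that parametrization: two of
  them differ by a rotation or reflection of the parameter circle. Every boundary of a planar
  convex body has one.\<close>

definition uniform_wrt_arc_length :: "(real^2) measure \<Rightarrow> (real^2) set \<Rightarrow> bool" where
  "uniform_wrt_arc_length P C \<longleftrightarrow>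
     (\<exists>g L. arc_length_parametrization g L C \<and>
        P = uniform_measure (distr (restrict_space lborel {0..L}) borel g) C)"

end

theory Submission
  imports Defs
begin

text \<open>
  For a unit vector \<open>u\<close> let \<open>x p\<close> be the inner product of \<open>u\<close> with \<open>p - c\<close>, where \<open>c\<close> is the
  centre of \<open>K\<close>. Since \<open>|p - q|\<^sup>n\<close> is a constant multiple of the average of \<open>|x p - x q|\<^sup>n\<close> over all
  directions \<open>u\<close>, it suffices to compare the one-dimensional projections. These are symmetric, and
  \<open>|s - t|\<^sup>n + |s + t|\<^sup>n\<close> is nondecreasing in \<open>|s|\<close> and in \<open>|t|\<close> because \<open>n \<ge> 1\<close>. So everything follows
  if \<open>|x Y|\<close> stochastically dominates \<open>|x X|\<close>: every strip \<open>|x| \<le> \<tau>\<close> contains a smaller proportion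
  of the boundary than of the area.

  Let \<open>w\<close> be the length of the chord \<open>x = \<tau>\<close> and \<open>a\<close> the largest absolute slope of the supporting lines
  at its two ends, \<open>\<phi> = sqrt (1 + a\<^sup>2)\<close>. The two arcs in the strip are graphs of \<open>a\<close>-Lipschitz functions
  and have length at most \<open>2 \<tau> \<phi>\<close> each, while the area in the strip is at least \<open>2 \<tau> w\<close>. The cap \<open>x > \<tau>\<close>
  lies between two parallel lines of slope \<open>\<plusminus>a\<close> at distance \<open>w / \<phi>\<close>; together with its mirror image
  in the midpoint of the chord it fits into a rectangle of that height, whose other side is the
  length of the boundary arc of the cap. Hence twice the area of a cap is at most \<open>w / \<phi>\<close> times the
  length of its arc, and the two estimates combine to the dominance.
\<close>

subsection \<open>Lipschitz maps on the line\<close>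

text \<open>The constant \<open>\<phi>\<close> is a factor in the arc bound and a divisor in the cap
  bound, so it cancels. With L the whole length, C the length of both cap arcs, A_in and A_out the
  areas inside and outside the strip, the bounds L <= 4 \<tau> \<phi> + C, 2 \<phi> A_out <= w C and
  2 \<tau> w <= A_in give L A_out <= 2 \<tau> w C + C A_out <= C (A_in + A_out). The cancellation
  needs the same slope in all bounds, hence the steeper of the two; by a reflection of the frame it
  may be taken at the lower end of the right-hand chord. The obstacle is arc length, given only as a
  supremum over inscribed polygons along some parametrization. Lengths are therefore compared with
  intervals of the line: a 1-Lipschitz function that covers an interval bounds a length from below,
  an injective one with Lipschitz inverse bounds it from above. The symmetry of the law of
  \<open>Y\<close> is not immediate either, since reflection yields a different parametrization; it
  rests on the independence of arc length measure from the parametrization, which has to be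
  proved.\<close>

lemma connected_real_borel:
  fixes C :: "real set"
  shows "connected C \<Longrightarrow> C \<in> sets borel"
  by (simp add: is_interval_connected_1[symmetric] real_interval_borel_measurable)

lemma connected_emeasure_ge:
  fixes C :: "real set"
  assumes "connected C" "x \<in> C" "y \<in> C"
  shows "ennreal \<bar>x - y\<bar> \<le> emeasure lborel C"
proof -
  have "{min x y..max x y} \<subseteq> C"
    using assms connected_contains_Icc[of C "min x y" "max x y"] by (auto simp: min_def max_def)
  then have "emeasure lborel {min x y..max x y} \<le> emeasure lborel C"
    using assms(1) by (intro emeasure_mono) (auto intro: connected_real_borel)
  then show ?thesis by (auto simp: min_def max_def abs_real_def split: if_splits)
qed

text \<open>Both images are intervals, whose measure is their diameter. Two maps are allowed so that
  one statement covers a contracting map (\<open>h\<close> the identity) and an expanding one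
  (\<open>f\<close> the identity).\<close>

lemma connected_Lipschitz_emeasure_le:
  fixes f :: "'a::topological_space \<Rightarrow> real" and h :: "'a \<Rightarrow> real"
  assumes "connected (f ` C)" "connected (h ` C)" "k > 0"
    and lip: "\<And>x y. x \<in> C \<Longrightarrow> y \<in> C \<Longrightarrow> \<bar>f x - f y\<bar> \<le> k * \<bar>h x - h y\<bar>"
  shows "emeasure lborel (f ` C) \<le> ennreal k * emeasure lborel (h ` C)"
proof (cases "emeasure lborel (h ` C) = \<infinity> \<or> C = {}")
  case True
  then show ?thesis using \<open>k > 0\<close> by (auto simp: ennreal_mult_top)
next
  case False
  then obtain m where m: "emeasure lborel (h ` C) = ennreal m" "m \<ge> 0"
    by (cases "emeasure lborel (h ` C)") auto
  have d: "\<bar>f x - f y\<bar> \<le> k * m" if "x \<in> C" "y \<in> C" for x y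
  proof -
    have "ennreal \<bar>h x - h y\<bar> \<le> ennreal m"
      using connected_emeasure_ge[of "h ` C" "h x" "h y"] assms(2) that m by auto
    then have "\<bar>h x - h y\<bar> \<le> m" using m by simp
    then show ?thesis
      by (smt (verit) lip[OF that] assms(3) mult_left_mono)
  qed
  obtain c where c: "c \<in> C" using False by auto
  have bd: "bdd_above (f ` C)" "bdd_below (f ` C)"
    using d[OF _ c] by (auto intro!: bdd_aboveI[of _ "f c + k * m"] bdd_belowI[of _ "f c - k * m"] simp: abs_le_iff algebra_simps)
  have "f ` C \<subseteq> {Inf (f ` C)..Sup (f ` C)}"
    using bd by (auto intro: cINF_lower cSUP_upper)
  then have "emeasure lborel (f ` C) \<le> emeasure lborel {Inf (f ` C)..Sup (f ` C)}"
    by (intro emeasure_mono) auto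
  also have "\<dots> = ennreal (Sup (f ` C) - Inf (f ` C))"
    using bd c by (subst emeasure_lborel_Icc) (auto intro: cInf_le_cSup)
  also have "Sup (f ` C) - Inf (f ` C) \<le> k * m"
  proof -
    have "Sup (f ` C) \<le> Inf (f ` C) + k * m"
    proof (rule cSup_least)
      fix z assume "z \<in> f ` C"
      then obtain x where x: "x \<in> C" "z = f x" by auto
      have "f x - k * m \<le> Inf (f ` C)"
        by (rule cInf_greatest) (use c d[OF x(1)] in \<open>auto simp: abs_le_iff algebra_simps\<close>)
      then show "z \<le> Inf (f ` C) + k * m" using x by simp
    qed (use c in auto)
    then show ?thesis by simp
  qed
  finally show ?thesis using m \<open>k > 0\<close> by (simp add: ennreal_mult ennreal_leI)
qed

lemma countable_components_open_real:
  fixes U :: "real set"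
  assumes "open U"
  shows "countable (components U)"
  using assms by (intro countable_disjoint_open_subsets)
    (use pairwise_disjoint_components[of U] in \<open>auto intro: open_components simp: pairwise_def disjnt_def\<close>)

lemma emeasure_open_components:
  fixes U :: "real set"
  assumes "open U"
  shows "emeasure lborel U = (\<integral>\<^sup>+C. emeasure lborel C \<partial>count_space (components U))"
proof -
  have "emeasure lborel (\<Union>C\<in>components U. C) = (\<integral>\<^sup>+C. emeasure lborel C \<partial>count_space (components U))"
  proof (rule emeasure_UN_countable)
    show "disjoint_family_on (\<lambda>C. C) (components U)"
      using pairwise_disjoint_components[of U] by (auto simp: disjoint_family_on_def pairwise_def disjnt_def)
  qed (use assms in \<open>auto intro: countable_components_open_real borel_open open_components\<close>)
  then show ?thesis by (simp add: Union_components)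
qed

lemma emeasure_UN_countable_le:
  assumes "countable I" "\<And>i. i \<in> I \<Longrightarrow> A i \<in> sets M"
  shows "emeasure M (\<Union>i\<in>I. A i) \<le> (\<integral>\<^sup>+i. emeasure M (A i) \<partial>count_space I)"
proof -
  have "emeasure M (\<Union>i\<in>I. A i) = (\<integral>\<^sup>+x. indicator (\<Union>i\<in>I. A i) x \<partial>M)"
    using assms by (subst nn_integral_indicator) auto
  also have "\<dots> \<le> (\<integral>\<^sup>+x. \<integral>\<^sup>+i. indicator (A i) x \<partial>count_space I \<partial>M)"
  proof (rule nn_integral_mono)
    fix x
    show "indicator (\<Union>i\<in>I. A i) x \<le> (\<integral>\<^sup>+i. indicator (A i) x \<partial>count_space I)"
    proof (cases "x \<in> (\<Union>i\<in>I. A i)")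
      case True
      then obtain i where i: "i \<in> I" "x \<in> A i" by auto
      have "1 = (indicator (A i) x::ennreal)" using i by simp
      also have "\<dots> \<le> (\<integral>\<^sup>+i. indicator (A i) x \<partial>count_space I)"
        by (rule nn_integral_ge_point) fact
      finally show ?thesis by (simp add: indicator_def)
    qed simp
  qed
  also have "\<dots> = (\<integral>\<^sup>+i. \<integral>\<^sup>+x. indicator (A i) x \<partial>M \<partial>count_space I)"
    using assms by (intro nn_integral_count_space_nn_integral) auto
  also have "\<dots> = (\<integral>\<^sup>+i. emeasure M (A i) \<partial>count_space I)"
    using assms by (intro nn_integral_cong) auto
  finally show ?thesis .
qed

text \<open>The image of a Borel set need not be Borel, so \<open>S\<close> is enlarged to an open
  set of almost the same measure; its components are intervals, and \<open>\<psi>\<close> does not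
  lengthen them.\<close>

lemma one_Lipschitz_covers_interval:
  fixes \<psi> :: "real \<Rightarrow> real"
  assumes S: "S \<in> sets borel" and lip: "\<And>s t. \<bar>\<psi> s - \<psi> t\<bar> \<le> \<bar>s - t\<bar>"
    and cover: "{a<..<b} \<subseteq> \<psi> ` S"
  shows "ennreal (b - a) \<le> emeasure lborel S"
proof (cases "a \<le> b")
  case True
  have cont: "continuous_on A \<psi>" for A
    using lip by (auto simp: continuous_on_iff dist_real_def intro: le_less_trans)
  have "emeasure lborel {a<..<b} \<le> emeasure lborel S"
  proof (rule ennreal_le_epsilon)
    fix e :: real assume "e > 0"
    obtain U where U: "open U" "S \<subseteq> U" "emeasure lborel (U - S) < e"
      using outer_regular_lborel[OF S \<open>e > 0\<close>] .
    have conn: "connected C" "connected (\<psi> ` C)" if "C \<in> components U" for C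
      using that cont by (auto intro: in_components_connected connected_continuous_image)
    have [measurable]: "\<psi> ` C \<in> sets borel" if "C \<in> components U" for C
      using conn(2)[OF that] by (auto intro: connected_real_borel)
    have "emeasure lborel {a<..<b} \<le> emeasure lborel (\<Union>C\<in>components U. \<psi> ` C)"
    proof (rule emeasure_mono)
      have "\<psi> ` S \<subseteq> \<psi> ` \<Union>(components U)" using U by (auto simp: Union_components)
      then show "{a<..<b} \<subseteq> (\<Union>C\<in>components U. \<psi> ` C)" using cover image_Union[of \<psi> "components U"] by simp
    qed (auto intro!: sets.countable_UN' countable_components_open_real U)
    also have "\<dots> \<le> (\<integral>\<^sup>+C. emeasure lborel (\<psi> ` C) \<partial>count_space (components U))"
      by (intro emeasure_UN_countable_le countable_components_open_real U) simp
    also have "\<dots> \<le> (\<integral>\<^sup>+C. emeasure lborel C \<partial>count_space (components U))"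
      using connected_Lipschitz_emeasure_le[of \<psi> _ "\<lambda>x. x" 1] conn lip
      by (intro nn_integral_mono) auto
    also have "\<dots> = emeasure lborel U" using emeasure_open_components[OF U(1)] by simp
    also have "\<dots> = emeasure lborel (S \<union> (U - S))" using U by (intro arg_cong[where f="emeasure lborel"]) auto
    also have "\<dots> \<le> emeasure lborel S + emeasure lborel (U - S)"
      using S U by (intro emeasure_subadditive) auto
    also have "\<dots> \<le> emeasure lborel S + e" using U(3) by (intro add_mono) auto
    finally show "emeasure lborel {a<..<b} \<le> emeasure lborel S + e" .
  qed
  then show ?thesis using True by simp
qed (simp add: ennreal_neg)

text \<open>Each component of \<open>U\<close> is at most \<open>k\<close> times as long as its
  image, and injectivity makes the images of different components disjoint, so their lengths add up
  to at most \<open>b - a\<close>. Expansion is asked only for segments inside \<open>U\<close>,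
  because the length of a curve controls only connected pieces.\<close>

lemma emeasure_open_le_injective_image:
  fixes j :: "real \<Rightarrow> real"
  assumes U: "open U" and cont: "continuous_on U j" and inj: "inj_on j U" and "k > 0"
    and exp: "\<And>s t. {s..t} \<subseteq> U \<Longrightarrow> s \<le> t \<Longrightarrow> t - s \<le> k * \<bar>j s - j t\<bar>"
    and sub: "j ` U \<subseteq> {a..b}" and "a \<le> b"
  shows "emeasure lborel U \<le> ennreal (k * (b - a))"
proof -
  have conn: "connected C" "connected (j ` C)" if "C \<in> components U" for C
    using that connected_continuous_image[OF continuous_on_subset[OF cont in_components_subset[OF that]]]
    by (auto intro: in_components_connected)
  have [measurable]: "j ` C \<in> sets borel" if "C \<in> components U" for C
    using conn(2)[OF that] by (auto intro: connected_real_borel)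
  have le: "emeasure lborel C \<le> ennreal k * emeasure lborel (j ` C)" if C: "C \<in> components U" for C
  proof -
    have "\<bar>x - y\<bar> \<le> k * \<bar>j x - j y\<bar>" if xy: "x \<in> C" "y \<in> C" for x y
    proof -
      have "min x y \<in> C" "max x y \<in> C" using xy by (auto simp: min_def max_def)
      then have "{min x y..max x y} \<subseteq> U"
        using connected_contains_Icc[OF conn(1)[OF C]] in_components_subset[OF C] by blast
      then show ?thesis using exp[of "min x y" "max x y"] by (auto simp: min_def max_def abs_real_def split: if_splits)
    qed
    then show ?thesis using connected_Lipschitz_emeasure_le[of "\<lambda>x. x" C j k] conn[OF C] \<open>k > 0\<close> by simp
  qed
  have "emeasure lborel U = (\<integral>\<^sup>+C. emeasure lborel C \<partial>count_space (components U))"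
    by (rule emeasure_open_components[OF U])
  also have "\<dots> \<le> (\<integral>\<^sup>+C. ennreal k * emeasure lborel (j ` C) \<partial>count_space (components U))"
    by (intro nn_integral_mono le) simp
  also have "\<dots> = ennreal k * (\<integral>\<^sup>+C. emeasure lborel (j ` C) \<partial>count_space (components U))"
    by (rule nn_integral_cmult) simp
  also have "(\<integral>\<^sup>+C. emeasure lborel (j ` C) \<partial>count_space (components U)) = emeasure lborel (\<Union>C\<in>components U. j ` C)"
  proof (rule emeasure_UN_countable[symmetric])
    show "disjoint_family_on (\<lambda>C. j ` C) (components U)"
      unfolding disjoint_family_on_def
    proof (intro ballI impI)
      fix C D assume CD: "C \<in> components U" "D \<in> components U" "C \<noteq> D"
      then have "C \<inter> D = {}"
        using pairwise_disjoint_components[of U] by (auto simp: pairwise_def disjnt_def)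
      then show "j ` C \<inter> j ` D = {}"
        using inj_on_image_Int[OF inj, of C D] CD in_components_subset by (metis image_empty)
    qed
  qed (auto intro: countable_components_open_real U)
  also have "(\<Union>C\<in>components U. j ` C) = j ` U"
    using image_Union[of j "components U"] by simp
  also have "emeasure lborel (j ` U) \<le> emeasure lborel {a..b}"
    using sub by (intro emeasure_mono) auto
  finally show ?thesis using \<open>k > 0\<close> \<open>a \<le> b\<close> by (simp add: ennreal_mult mult_left_mono)
qed

subsection \<open>Arc length measure\<close>

text \<open>Measuring the set of parameters turns questions about length into questions about
  Lebesgue measure on the line. The closing point has the two parameters \<open>0\<close> and
  \<open>L\<close>, which form a null set.\<close>

definition arc_measure :: "(real \<Rightarrow> real^2) \<Rightarrow> real \<Rightarrow> (real^2) set \<Rightarrow> ennreal" where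
  "arc_measure g L E = emeasure lborel {s \<in> {0..L}. g s \<in> E}"

lemma curve_length_ge_dist:
  assumes "s \<le> t"
  shows "ennreal (dist (g s) (g t)) \<le> curve_length g s t"
proof -
  have "(1::nat, \<lambda>i. if i = 0 then s else t) \<in> {(m :: nat, \<tau> :: nat \<Rightarrow> real). mono_on {..m} \<tau> \<and> \<tau> 0 = s \<and> \<tau> m = t}"
    using assms by (auto simp: mono_on_def)
  then show ?thesis
    unfolding curve_length_def by (rule SUP_upper2) simp
qed

lemma arc_length_parametrization_dist:
  assumes "arc_length_parametrization g L C" "s \<in> {0..L}" "t \<in> {0..L}"
  shows "dist (g s) (g t) \<le> \<bar>s - t\<bar>"
proof -
  have *: "dist (g s) (g t) \<le> t - s" if "0 \<le> s" "s \<le> t" "t \<le> L" for s t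
    using curve_length_ge_dist[OF that(2), of g] that assms(1)
    by (auto simp: arc_length_parametrization_def)
  show ?thesis using *[of s t] *[of t s] assms(2,3) by (cases "s \<le> t") (auto simp: dist_commute)
qed

lemma arc_length_parametrization_continuous:
  assumes "arc_length_parametrization g L C"
  shows "continuous_on {0..L} g"
  unfolding continuous_on_iff dist_real_def
  using arc_length_parametrization_dist[OF assms] by (metis le_less_trans)

lemma arc_length_parametrization_compact:
  assumes "arc_length_parametrization g L C"
  shows "compact C"
  using compact_continuous_image[OF arc_length_parametrization_continuous[OF assms] compact_Icc] assms
  by (simp add: arc_length_parametrization_def)

lemma arc_length_parametrization_measurable:
  assumes "arc_length_parametrization g L C"
  shows "g \<in> restrict_space lborel {0..L} \<rightarrow>\<^sub>M borel"
  using borel_measurable_continuous_on_restrict[OF arc_length_parametrization_continuous[OF assms]]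
  by (simp cong: measurable_cong_sets sets_restrict_space_cong)

lemma arc_length_parametrization_vimage_borel:
  assumes "arc_length_parametrization g L C" "E \<in> sets borel"
  shows "{s \<in> {0..L}. g s \<in> E} \<in> sets borel"
proof -
  have "g -` E \<inter> {0..L} \<in> sets (restrict_space lborel {0..L})"
    using measurable_sets[OF arc_length_parametrization_measurable[OF assms(1)] assms(2)]
    by (simp add: space_restrict_space)
  then show ?thesis
    by (auto simp: sets_restrict_space_iff Int_def conj_commute)
qed

text \<open>A 1-Lipschitz \<open>\<rho>\<close> composed with a parametrization by arc length is
  1-Lipschitz in the parameter. This is the source of the lower bounds for lengths;
  \<open>\<rho>\<close> will be an orthogonal projection or the distance to a point.\<close>

lemma arc_measure_ge:
  assumes g: "arc_length_parametrization g L C" and E: "E \<in> sets borel"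
    and lip: "\<And>p q. \<bar>\<rho> p - \<rho> q\<bar> \<le> dist p q"
    and cover: "{a<..<b} \<subseteq> \<rho> ` (E \<inter> C)"
  shows "ennreal (b - a) \<le> arc_measure g L E"
  unfolding arc_measure_def
\<comment> \<open>Clamping the parameter to \<open>{0..L}\<close> makes the map 1-Lipschitz on the
  whole line.\<close>
proof (rule one_Lipschitz_covers_interval[where \<psi> = "\<lambda>s. \<rho> (g (max 0 (min L s)))"])
  show "{s \<in> {0..L}. g s \<in> E} \<in> sets borel"
    by (rule arc_length_parametrization_vimage_borel[OF g E])
  have L: "0 < L" and im: "g ` {0..L} = C" using g by (auto simp: arc_length_parametrization_def)
  show "\<bar>\<rho> (g (max 0 (min L s))) - \<rho> (g (max 0 (min L t)))\<bar> \<le> \<bar>s - t\<bar>" for s t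
  proof -
    have "dist (g (max 0 (min L s))) (g (max 0 (min L t))) \<le> \<bar>max 0 (min L s) - max 0 (min L t)\<bar>"
      using L by (intro arc_length_parametrization_dist[OF g]) auto
    also have "\<dots> \<le> \<bar>s - t\<bar>" by (auto simp: max_def min_def abs_real_def)
    finally show ?thesis using lip order_trans by blast
  qed
  show "{a<..<b} \<subseteq> (\<lambda>s. \<rho> (g (max 0 (min L s)))) ` {s \<in> {0..L}. g s \<in> E}"
  proof
    fix z assume "z \<in> {a<..<b}"
    then obtain s where s: "s \<in> {0..L}" "g s \<in> E" "\<rho> (g s) = z" using cover im by blast
    then have "max 0 (min L s) = s" by auto
    then show "z \<in> (\<lambda>s. \<rho> (g (max 0 (min L s)))) ` {s \<in> {0..L}. g s \<in> E}"
      using s by (intro image_eqI[of _ _ s]) auto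
  qed
qed

lemma curve_length_le_monotone:
  assumes "s \<le> t" "k \<ge> 0"
    and le: "\<And>x y. s \<le> x \<Longrightarrow> x \<le> y \<Longrightarrow> y \<le> t \<Longrightarrow> dist (g x) (g y) \<le> k * (j y - j x)"
  shows "curve_length g s t \<le> ennreal (k * (j t - j s))"
  unfolding curve_length_def
proof (rule SUP_least, clarify)
  fix m :: nat and \<tau> :: "nat \<Rightarrow> real"
  assume \<tau>: "mono_on {..m} \<tau>" "s = \<tau> 0" "t = \<tau> m"
  have "(\<Sum>i<m. dist (g (\<tau> i)) (g (\<tau> (Suc i)))) \<le> (\<Sum>i<m. k * (j (\<tau> (Suc i)) - j (\<tau> i)))"
    using \<tau> by (intro sum_mono le) (auto intro!: mono_onD[OF \<tau>(1)])
  also have "\<dots> = k * (j (\<tau> m) - j (\<tau> 0))"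
    using sum_lessThan_telescope[of "\<lambda>i. j (\<tau> i)" m] by (simp add: sum_distrib_left[symmetric])
  finally show "ennreal (\<Sum>i<m. dist (g (\<tau> i)) (g (\<tau> (Suc i)))) \<le> ennreal (k * (j (\<tau> m) - j (\<tau> 0)))"
    by (rule ennreal_leI)
qed

text \<open>The expansion bound makes \<open>\<rho>\<close> injective along the curve, hence
  monotone on every parameter interval inside the set; the lengths of inscribed polygons then
  telescope to at most \<open>k\<close> times the increment of \<open>\<rho>\<close>.\<close>

lemma arc_measure_le:
  assumes g: "arc_length_parametrization g L C" and E: "open E" and "k > 0"
    and cont: "continuous_on UNIV \<rho>"
    and exp: "\<And>p q. p \<in> E \<inter> C \<Longrightarrow> q \<in> E \<inter> C \<Longrightarrow> dist p q \<le> k * \<bar>\<rho> p - \<rho> q\<bar>"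
    and sub: "\<rho> ` (E \<inter> C) \<subseteq> {a..b}" and "a \<le> b"
  shows "arc_measure g L E \<le> ennreal (k * (b - a))"
proof -
  \<comment> \<open>The end points \<open>0\<close> and \<open>L\<close> are removed so that the
    parameter set is open and \<open>g\<close> is injective on it.\<close>
  let ?U = "{s \<in> {0<..<L}. g s \<in> E}" and ?j = "\<lambda>s. \<rho> (g s)"
  have im: "g ` {0..L} = C" and inj: "inj_on g {0..<L}"
    and len: "\<And>s t. 0 \<le> s \<Longrightarrow> s \<le> t \<Longrightarrow> t \<le> L \<Longrightarrow> curve_length g s t = ennreal (t - s)"
    using g by (auto simp: arc_length_parametrization_def)
  have contg: "continuous_on {0<..<L} g"
    by (rule continuous_on_subset[OF arc_length_parametrization_continuous[OF g]]) auto
  have U: "open ?U"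
    using continuous_open_preimage[OF contg _ E] by (simp add: Int_def vimage_def)
  have contj: "continuous_on ?U ?j"
    by (rule continuous_on_compose2[OF cont continuous_on_subset[OF contg]]) auto
  have UC: "g s \<in> E \<inter> C" if "s \<in> ?U" for s using that im by auto
  have injj: "inj_on ?j ?U"
  proof (rule inj_onI)
    fix s t assume st: "s \<in> ?U" "t \<in> ?U" "?j s = ?j t"
    then have "dist (g s) (g t) \<le> 0" using exp[OF UC UC, of s t] by simp
    then show "s = t" using inj_onD[OF inj, of s t] st by auto
  qed
  have "emeasure lborel ?U \<le> ennreal (k * (b - a))"
  proof (rule emeasure_open_le_injective_image[OF U contj injj \<open>k > 0\<close>])
    show "?j ` ?U \<subseteq> {a..b}" using UC sub by blast
    fix s t assume st: "{s..t} \<subseteq> ?U" "s \<le> t"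
    have c: "curve_length g s t = ennreal (t - s)"
      using st by (intro len) auto
    have ex: "dist (g x) (g y) \<le> k * \<bar>?j x - ?j y\<bar>" if "s \<le> x" "x \<le> y" "y \<le> t" for x y
      using that by (intro exp UC subsetD[OF st(1)]) auto
    \<comment> \<open>A continuous injective function on an interval is strictly monotone. In the
      decreasing case its negative is used for telescoping.\<close>
    have "strict_mono_on {s..t} ?j \<or> strict_antimono_on {s..t} ?j"
      using injective_eq_monotone_map[of "{s..t}" ?j] contj injj st
      by (meson continuous_on_subset inj_on_subset is_interval_cc)
    then have "ennreal (t - s) \<le> ennreal (k * \<bar>?j s - ?j t\<bar>)"
    proof
      assume m: "strict_mono_on {s..t} ?j"
      have "curve_length g s t \<le> ennreal (k * (?j t - ?j s))"
      proof (rule curve_length_le_monotone[OF st(2)])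
        fix x y assume xy: "s \<le> x" "x \<le> y" "y \<le> t"
        then have "?j x \<le> ?j y" using m by (cases "x = y") (auto simp: strict_mono_on_def monotone_on_def less_imp_le)
        then show "dist (g x) (g y) \<le> k * (?j y - ?j x)" using ex[OF xy] by (simp add: abs_of_nonpos)
      qed (use \<open>k > 0\<close> in simp)
      also have "\<dots> \<le> ennreal (k * \<bar>?j s - ?j t\<bar>)"
        using \<open>k > 0\<close> by (intro ennreal_leI mult_left_mono) auto
      finally show ?thesis using c by simp
    next
      assume m: "strict_antimono_on {s..t} ?j"
      have "curve_length g s t \<le> ennreal (k * ((- ?j t) - (- ?j s)))"
      proof (rule curve_length_le_monotone[OF st(2)])
        fix x y assume xy: "s \<le> x" "x \<le> y" "y \<le> t"
        then have "?j y \<le> ?j x" using m by (cases "x = y") (auto simp: monotone_on_def less_imp_le)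
        then show "dist (g x) (g y) \<le> k * ((- ?j y) - (- ?j x))" using ex[OF xy] by (simp add: abs_of_nonneg)
      qed (use \<open>k > 0\<close> in simp)
      also have "\<dots> \<le> ennreal (k * \<bar>?j s - ?j t\<bar>)"
        using \<open>k > 0\<close> by (intro ennreal_leI mult_left_mono) auto
      finally show ?thesis using c by simp
    qed
    then show "t - s \<le> k * \<bar>?j s - ?j t\<bar>" using \<open>k > 0\<close> by simp
  qed fact
  moreover have "emeasure lborel {s \<in> {0..L}. g s \<in> E} = emeasure lborel ?U"
  proof (rule emeasure_eq_AE)
    have "AE x in lborel. x \<noteq> 0 \<and> x \<noteq> L"
      using AE_lborel_singleton[of 0] AE_lborel_singleton[of L] by eventually_elim simp
    then show "AE x in lborel. x \<in> {s \<in> {0..L}. g s \<in> E} \<longleftrightarrow> x \<in> ?U"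
      by eventually_elim auto
    show "{s \<in> {0..L}. g s \<in> E} \<in> sets lborel"
      using arc_length_parametrization_vimage_borel[OF g borel_open[OF E]] by simp
  qed (use U in auto)
  ultimately show ?thesis by (simp add: arc_measure_def)
qed

lemma arc_measure_finite_null:
  assumes g: "arc_length_parametrization g L C" and "finite F"
  shows "arc_measure g L F = 0"
proof -
  have inj: "inj_on g {0..<L}" using g by (auto simp: arc_length_parametrization_def)
  have "finite (g -` F \<inter> {0..<L})" by (rule finite_vimage_IntI[OF \<open>finite F\<close> inj])
  then have "finite (insert L (g -` F \<inter> {0..<L}))" by simp
  then have "finite {s \<in> {0..L}. g s \<in> F}"
    by (rule finite_subset[rotated]) auto
  then show ?thesis unfolding arc_measure_def
    by (intro emeasure_lborel_countable countable_finite)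
qed

lemma arc_measure_mono:
  assumes "arc_length_parametrization g L C" "E \<subseteq> F" "F \<in> sets borel"
  shows "arc_measure g L E \<le> arc_measure g L F"
  unfolding arc_measure_def
  using arc_length_parametrization_vimage_borel[OF assms(1,3)] assms(2)
  by (intro emeasure_mono) auto

lemma arc_measure_Un_disjoint:
  assumes "arc_length_parametrization g L C" "E \<in> sets borel" "F \<in> sets borel" "E \<inter> F = {}"
  shows "arc_measure g L (E \<union> F) = arc_measure g L E + arc_measure g L F"
proof -
  have "{s \<in> {0..L}. g s \<in> E \<union> F} = {s \<in> {0..L}. g s \<in> E} \<union> {s \<in> {0..L}. g s \<in> F}" by auto
  then show ?thesis unfolding arc_measure_def
    using plus_emeasure[of "{s \<in> {0..L}. g s \<in> E}" lborel "{s \<in> {0..L}. g s \<in> F}"]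
      arc_length_parametrization_vimage_borel[OF assms(1,2)] arc_length_parametrization_vimage_borel[OF assms(1,3)] assms(4)
    by (simp add: disjoint_iff)
qed

lemma arc_measure_le_length: "arc_measure g L E \<le> ennreal L"
proof -
  have "arc_measure g L E \<le> emeasure lborel {0..L}"
    unfolding arc_measure_def by (intro emeasure_mono) auto
  then show ?thesis by (cases "L \<ge> 0") (auto simp: ennreal_neg)
qed

lemma arc_measure_Un_le:
  assumes "arc_length_parametrization g L C" "E \<in> sets borel" "F \<in> sets borel"
  shows "arc_measure g L (E \<union> F) \<le> arc_measure g L E + arc_measure g L F"
proof -
  have "{s \<in> {0..L}. g s \<in> E \<union> F} = {s \<in> {0..L}. g s \<in> E} \<union> {s \<in> {0..L}. g s \<in> F}" by auto
  then show ?thesis unfolding arc_measure_def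
    using arc_length_parametrization_vimage_borel[OF assms(1,2)] arc_length_parametrization_vimage_borel[OF assms(1,3)]
    by (simp add: emeasure_subadditive)
qed

subsection \<open>Planar convex bodies with a centre of symmetry\<close>

lemma inner_real2: "(p::real^2) \<bullet> q = p$1 * q$1 + p$2 * q$2"
  by (simp add: inner_vec_def UNIV_2)

lemma orthonormal_det_real2:
  fixes u v :: "real^2"
  assumes "u \<bullet> u = 1" "v \<bullet> v = 1" "u \<bullet> v = 0"
  shows "(u$1 * v$2 - u$2 * v$1)\<^sup>2 = 1"
proof -
  have "(u$1 * v$2 - u$2 * v$1)\<^sup>2 = (u \<bullet> u) * (v \<bullet> v) - (u \<bullet> v)\<^sup>2"
    unfolding inner_real2 by algebra
  then show ?thesis using assms by simp
qed

lemma orthonormal_expand_real2: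
  fixes u v q :: "real^2"
  assumes "u \<bullet> u = 1" "v \<bullet> v = 1" "u \<bullet> v = 0"
  shows "q = (u \<bullet> q) *\<^sub>R u + (v \<bullet> q) *\<^sub>R v"
proof -
  define D where "D = u$1 * v$2 - u$2 * v$1"
  have D: "D\<^sup>2 = 1" unfolding D_def by (rule orthonormal_det_real2[OF assms])
  have e: "u$1 * u$1 + u$2 * u$2 = 1" "v$1 * v$1 + v$2 * v$2 = 1" "u$1 * v$1 + u$2 * v$2 = 0"
    using assms by (simp_all add: inner_real2)
  \<comment> \<open>Up to the sign \<open>D\<close>, \<open>v\<close> is the quarter turn of
    \<open>u\<close>.\<close>
  have v: "v$1 = - D * u$2" "v$2 = D * u$1"
    using e unfolding D_def by algebra+
  have uu: "u$1 * u$1 + u$2 * u$2 = 1" by (rule e)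
  have "D * D = 1" using D by (simp add: power2_eq_square)
  then have "q$1 = (u \<bullet> q) * u$1 + (v \<bullet> q) * v$1" "q$2 = (u \<bullet> q) * u$2 + (v \<bullet> q) * v$2"
    unfolding inner_real2 v using uu by algebra+
  then show ?thesis by (simp add: vec_eq_iff forall_2)
qed

text \<open>The set is an affine image of a box. It occurs twice: as the rectangle that encloses a
  cap with its mirror image, and as the parallelogram inscribed in the strip.\<close>

lemma measure_parallelogram:
  fixes p d1 d2 :: "real^2"
  assumes "s0 \<le> s1" "t0 \<le> t1"
  shows "{p + s *\<^sub>R d1 + t *\<^sub>R d2 | s t. s \<in> {s0..s1} \<and> t \<in> {t0..t1}} \<in> lmeasurable"
    and "measure lebesgue {p + s *\<^sub>R d1 + t *\<^sub>R d2 | s t. s \<in> {s0..s1} \<and> t \<in> {t0..t1}}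
      = \<bar>d1$1 * d2$2 - d1$2 * d2$1\<bar> * ((s1 - s0) * (t1 - t0))"
proof -
  define f :: "real^2 \<Rightarrow> real^2" where "f q = q$1 *\<^sub>R d1 + q$2 *\<^sub>R d2" for q
  have lin: "linear f" by (auto simp: f_def linear_iff algebra_simps)
  let ?B = "cbox (vector [s0,t0]) (vector [s1,t1]) :: (real^2) set"
  have eq: "{p + s *\<^sub>R d1 + t *\<^sub>R d2 | s t. s \<in> {s0..s1} \<and> t \<in> {t0..t1}} = (+) p ` f ` ?B" (is "?S = _")
  proof
    show "?S \<subseteq> (+) p ` f ` ?B"
    proof
      fix z assume "z \<in> ?S"
      then obtain s t where "z = p + s *\<^sub>R d1 + t *\<^sub>R d2" "s \<in> {s0..s1}" "t \<in> {t0..t1}" by auto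
      then show "z \<in> (+) p ` f ` ?B"
        by (intro image_eqI[of _ _ "f (vector [s,t])"] image_eqI[of _ _ "vector [s,t]"])
          (auto simp: f_def mem_box_cart forall_2 algebra_simps)
    qed
    show "(+) p ` f ` ?B \<subseteq> ?S"
      by (force simp: f_def mem_box_cart forall_2 algebra_simps)
  qed
  have "matrix f = (\<chi> i j. if j = 1 then d1$i else d2$i)"
    by (auto simp: matrix_def f_def vec_eq_iff forall_2 axis_def)
  then have det: "det (matrix f) = d1$1 * d2$2 - d1$2 * d2$1"
    by (simp add: det_2)
  have ne: "?B \<noteq> {}" using assms by (auto simp: interval_ne_empty_cart forall_2)
  have "measure lebesgue ?B = (s1 - s0) * (t1 - t0)"
    using content_cbox_cart[OF ne] by (simp add: UNIV_2)
  then have m: "measure lebesgue (f ` ?B) = \<bar>det (matrix f)\<bar> * ((s1 - s0) * (t1 - t0))"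
    by (subst measure_linear_image[OF lin]) auto
  show "?S \<in> lmeasurable"
    unfolding eq using measurable_linear_image[OF lin, of ?B] measurable_translation by auto
  show "measure lebesgue ?S = \<bar>d1$1 * d2$2 - d1$2 * d2$1\<bar> * ((s1 - s0) * (t1 - t0))"
    unfolding eq using measure_translation[of p "f ` ?B"] m det by simp
qed

lemma lborel_distr_reflect:
  fixes d :: "'a::euclidean_space"
  shows "distr lborel borel (\<lambda>x. d - x) = lborel"
  using lborel_affine[of "-1" d] by (simp add: density_1)

text \<open>\<open>tp\<close> is the upper boundary of \<open>K\<close> as a function on
  \<open>{-h..h}\<close>, in the frame with origin \<open>c\<close> and axes \<open>u\<close>,
  \<open>v\<close>. By symmetry the lower boundary is \<open>- tp (-x)\<close>, so one function
  describes the whole body. The frame is a parameter so that every estimate can be reused after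
  reversing axes.\<close>

locale centred_body =
  fixes K :: "(real^2) set" and c u v :: "real^2" and tp :: "real \<Rightarrow> real" and h :: real
  assumes conv: "convex K" and comp: "compact K" and int: "interior K \<noteq> {}"
    and uu: "u \<bullet> u = 1" and vv: "v \<bullet> v = 1" and uv: "u \<bullet> v = 0"
    and sym: "p \<in> K \<Longrightarrow> 2 *\<^sub>R c - p \<in> K"
    and pt_le: "c + x *\<^sub>R u + y *\<^sub>R v \<in> K \<Longrightarrow> \<bar>x\<bar> \<le> h \<and> y \<le> tp x"
    and pt_mem: "\<bar>x\<bar> \<le> h \<Longrightarrow> c + x *\<^sub>R u + tp x *\<^sub>R v \<in> K"
begin

section \<open>Frame coordinates, the upper boundary function and its supporting lines\<close>

definition "X p = u \<bullet> (p - c)"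
definition "Y p = v \<bullet> (p - c)"
definition "pt x y = c + x *\<^sub>R u + y *\<^sub>R v"

lemma vu: "v \<bullet> u = 0" using uv by (simp add: inner_commute)

lemma X_pt [simp]: "X (pt x y) = x" and Y_pt [simp]: "Y (pt x y) = y"
  by (simp_all add: X_def Y_def pt_def inner_add_right uu vv uv vu)

lemma pt_XY [simp]: "pt (X p) (Y p) = p"
  using orthonormal_expand_real2[OF uu vv uv, of "p - c"]
  by (simp add: pt_def X_def Y_def algebra_simps)

lemma pt_cases: obtains x y where "p = pt x y" using pt_XY by metis

lemma X_cont: "continuous_on S X" and Y_cont: "continuous_on S Y"
  unfolding X_def Y_def by (auto intro!: continuous_intros)

lemma pt_combo:
  assumes "\<alpha> + \<beta> = 1"
  shows "\<alpha> *\<^sub>R pt x y + \<beta> *\<^sub>R pt x' y' = pt (\<alpha> * x + \<beta> * x') (\<alpha> * y + \<beta> * y')"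
proof -
  have "\<alpha> *\<^sub>R c + \<beta> *\<^sub>R c = c" using assms by (metis scaleR_add_left scaleR_one)
  then show ?thesis by (simp add: pt_def algebra_simps)
qed

lemma pt_conv:
  assumes "pt x y \<in> K" "pt x' y' \<in> K" "\<alpha> \<ge> 0" "\<beta> \<ge> 0" "\<alpha> + \<beta> = 1"
  shows "pt (\<alpha> * x + \<beta> * x') (\<alpha> * y + \<beta> * y') \<in> K"
  using convexD[OF conv assms(1,2,3,4,5)] pt_combo[OF assms(5)] by simp

lemma dist_sq: "(dist p q)\<^sup>2 = (X p - X q)\<^sup>2 + (Y p - Y q)\<^sup>2"
proof -
  have e: "p - q = (X p - X q) *\<^sub>R u + (Y p - Y q) *\<^sub>R v"
    using orthonormal_expand_real2[OF uu vv uv, of "p - q"] by (simp add: X_def Y_def inner_diff_right)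
  have "(dist p q)\<^sup>2 = (p - q) \<bullet> (p - q)" by (simp add: dist_norm power2_norm_eq_inner)
  also have "\<dots> = (X p - X q)\<^sup>2 + (Y p - Y q)\<^sup>2"
    unfolding e by (simp add: inner_add_left inner_add_right uu vv uv vu power2_eq_square)
  finally show ?thesis .
qed

lemma dist_pt: "dist (pt x y) (pt x' y') = sqrt ((x - x')\<^sup>2 + (y - y')\<^sup>2)"
  using dist_sq[of "pt x y" "pt x' y'"] by (simp add: real_sqrt_unique)

lemma pt_sym: "pt x y \<in> K \<Longrightarrow> pt (-x) (-y) \<in> K"
proof -
  assume "pt x y \<in> K"
  moreover have "2 *\<^sub>R c - pt x y = pt (-x) (-y)" by (simp add: pt_def algebra_simps scaleR_2)
  ultimately show ?thesis using sym by metis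
qed

lemma mem_x: "pt x y \<in> K \<Longrightarrow> \<bar>x\<bar> \<le> h" and mem_le: "pt x y \<in> K \<Longrightarrow> y \<le> tp x"
  using pt_le by (auto simp: pt_def)

lemma mem_ge: "pt x y \<in> K \<Longrightarrow> - tp (-x) \<le> y"
  using mem_le[OF pt_sym] by fastforce

lemma top_mem: "\<bar>x\<bar> \<le> h \<Longrightarrow> pt x (tp x) \<in> K"
  using pt_mem by (simp add: pt_def)

lemma bot_mem: "\<bar>x\<bar> \<le> h \<Longrightarrow> pt x (- tp (-x)) \<in> K"
  using pt_sym[OF top_mem[of "-x"]] by simp

lemma between_mem:
  assumes "\<bar>x\<bar> \<le> h" "- tp (-x) \<le> y" "y \<le> tp x"
  shows "pt x y \<in> K"
proof (cases "- tp (-x) = tp x")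
  case True
  then have "y = tp x" using assms by simp
  then show ?thesis using top_mem assms by simp
next
  case False
  define W where "W = tp x + tp (-x)"
  have W: "W > 0" using False assms by (simp add: W_def)
  have "pt ((y + tp (-x)) / W * x + (tp x - y) / W * x) ((y + tp (-x)) / W * tp x + (tp x - y) / W * (- tp (-x))) \<in> K"
    using W assms by (intro pt_conv top_mem bot_mem) (auto simp: W_def add_divide_distrib[symmetric])
  also have "(y + tp (-x)) / W * x + (tp x - y) / W * x = x"
    using W by (simp add: W_def distrib_right[symmetric] add_divide_distrib[symmetric] add.commute)
  also have "(y + tp (-x)) / W * tp x + (tp x - y) / W * (- tp (-x)) = y * (tp x + tp (-x)) / W"
    using W by (simp add: field_simps)
  also have "\<dots> = y" using W by (simp add: W_def)
  finally show ?thesis .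
qed

lemma top_concave:
  assumes "\<bar>x\<bar> \<le> h" "\<bar>x'\<bar> \<le> h" "\<alpha> \<ge> 0" "\<beta> \<ge> 0" "\<alpha> + \<beta> = 1"
  shows "\<alpha> * tp x + \<beta> * tp x' \<le> tp (\<alpha> * x + \<beta> * x')"
  by (rule mem_le[OF pt_conv[OF top_mem top_mem]]) (use assms in auto)

text \<open>Averaging points of a ball inside \<open>K\<close> with the mirror image of its centre
  moves them next to the centre of symmetry.\<close>

lemma centre_ball: obtains r where "r > 0" "pt 0 r \<in> K" "pt r 0 \<in> K"
proof -
  obtain z r where zr: "r > 0" "ball z r \<subseteq> K" using int by (meson ex_in_conv mem_interior)
  obtain x y where z: "z = pt x y" by (rule pt_cases)
  have "pt (x + r/2) y \<in> ball z r" "pt x (y + r/2) \<in> ball z r" "z \<in> ball z r"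
    using zr(1) unfolding z by (simp_all add: dist_pt)
  then have k: "pt (x + r/2) y \<in> K" "pt x (y + r/2) \<in> K" and "pt x y \<in> K"
    using zr z by auto
  then have k': "pt (-x) (-y) \<in> K" by (intro pt_sym)
  have "pt (r/4) 0 \<in> K" "pt 0 (r/4) \<in> K"
    using pt_conv[OF k(1) k', of "1/2" "1/2"] pt_conv[OF k(2) k', of "1/2" "1/2"]
    by (simp_all add: add_divide_distrib)
  then show ?thesis using that[of "r/4"] zr by auto
qed

lemma h_pos: "h > 0"
  using centre_ball mem_x by (metis abs_ge_self less_le_trans)

text \<open>The upper boundary is positive at \<open>0\<close>, the chords at \<open>-h\<close> and
  \<open>h\<close> have nonnegative length, and concavity carries strict positivity to everything
  between.\<close>

lemma width_pos:
  assumes "\<bar>x\<bar> < h"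
  shows "0 < tp x + tp (-x)"
proof -
  obtain r where r: "r > 0" "pt 0 r \<in> K" by (rule centre_ball)
  define t where "t = \<bar>x\<bar> / h"
  have t: "0 \<le> t" "t < 1" using assms h_pos by (auto simp: t_def)
  \<comment> \<open>\<open>e\<close> is the end of \<open>{-h..h}\<close> on the side of
    \<open>x\<close>, or \<open>0\<close> if \<open>x = 0\<close>; in either case
    \<open>x = t * e\<close>.\<close>
  define e where "e = sgn x * h"
  have e: "\<bar>e\<bar> \<le> h" "\<bar>-e\<bar> \<le> h" using h_pos by (auto simp: e_def abs_mult abs_sgn_eq)
  have x: "x = t * e" using h_pos by (simp add: t_def e_def abs_mult_sgn mult.commute)
  have "tp 0 \<ge> r" by (rule mem_le) fact
  have "(1 - t) * tp 0 + t * tp e \<le> tp ((1 - t) * 0 + t * e)"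
    "(1 - t) * tp 0 + t * tp (-e) \<le> tp ((1 - t) * 0 + t * (-e))"
    using e t h_pos by (intro top_concave; simp)+
  moreover have "tp e + tp (-e) \<ge> 0" using mem_ge[OF top_mem[of e]] e by simp
  then have "t * (tp e + tp (-e)) \<ge> 0" using t by simp
  moreover have "(1 - t) * tp 0 > 0" using t r \<open>tp 0 \<ge> r\<close> by (intro mult_pos_pos) auto
  ultimately show ?thesis unfolding x by (simp add: algebra_simps)
qed

lemma frontier_eq: "frontier K = K - interior K"
  using comp by (simp add: frontier_def compact_imp_closed)

lemma supporting_normal:
  assumes "pt x y \<in> frontier K"
  obtains \<alpha> \<beta> where "\<alpha> \<noteq> 0 \<or> \<beta> \<noteq> 0" "\<And>x' y'. pt x' y' \<in> K \<Longrightarrow> \<alpha> * x' + \<beta> * y' \<le> \<alpha> * x + \<beta> * y"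
proof -
  have *: "pt x y \<in> K" "pt x y \<notin> rel_interior K" 
    using assms int by (auto simp: frontier_eq rel_interior_nonempty_interior)
  obtain a where a: "a \<noteq> 0" "\<And>q. q \<in> closure K \<Longrightarrow> a \<bullet> pt x y \<le> a \<bullet> q"
    using supporting_hyperplane_relative_frontier[OF conv _ *(2)] *(1) closure_subset by (metis subsetD)
  show ?thesis
  proof
    have "a = (u \<bullet> a) *\<^sub>R u + (v \<bullet> a) *\<^sub>R v" by (rule orthonormal_expand_real2[OF uu vv uv])
    then show "- (a \<bullet> u) \<noteq> 0 \<or> - (a \<bullet> v) \<noteq> 0" using a(1) by (auto simp: inner_commute)
    fix x' y' assume "pt x' y' \<in> K"
    then have "a \<bullet> pt x y \<le> a \<bullet> pt x' y'" using a(2) closure_subset by (metis subsetD)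
    then show "- (a \<bullet> u) * x' + - (a \<bullet> v) * y' \<le> - (a \<bullet> u) * x + - (a \<bullet> v) * y"
      by (simp add: pt_def inner_add_right algebra_simps)
  qed
qed

text \<open>A vertical supporting line would confine \<open>K\<close> to one side of the abscissa
  \<open>x\<close>, but \<open>K\<close> reaches both \<open>-h\<close> and
  \<open>h\<close>.\<close>

lemma supporting_slope:
  assumes "pt x y \<in> frontier K" "\<bar>x\<bar> < h"
  obtains \<alpha> \<beta> where "\<beta> \<noteq> 0" "\<And>x' y'. pt x' y' \<in> K \<Longrightarrow> \<alpha> * x' + \<beta> * y' \<le> \<alpha> * x + \<beta> * y"
proof -
  obtain \<alpha> \<beta> where ab: "\<alpha> \<noteq> 0 \<or> \<beta> \<noteq> 0" "\<And>x' y'. pt x' y' \<in> K \<Longrightarrow> \<alpha> * x' + \<beta> * y' \<le> \<alpha> * x + \<beta> * y"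
    using supporting_normal[OF assms(1)] by metis
  have "\<beta> \<noteq> 0"
  proof
    assume b: "\<beta> = 0"
    have "\<alpha> * h \<le> \<alpha> * x" "\<alpha> * (-h) \<le> \<alpha> * x"
      using ab(2)[OF top_mem[of h]] ab(2)[OF top_mem[of "-h"]] b h_pos by auto
    then have "\<alpha> * (h - x) \<le> 0" "0 \<le> \<alpha> * (h + x)" by (auto simp: algebra_simps)
    moreover have "h - x > 0" "h + x > 0" using assms(2) by auto
    ultimately show False using ab(1) b by (auto simp: mult_le_0_iff zero_le_mult_iff)
  qed
  then show ?thesis using that ab(2) by blast
qed

text \<open>A supporting functional at the point, evaluated at both ends of the vertical chord,
  forces the point to the end that the sign of \<open>\<beta>\<close> selects.\<close>

lemma frontier_top_or_bot:
  assumes "pt x y \<in> frontier K" "\<bar>x\<bar> < h"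
  shows "y = tp x \<or> y = - tp (-x)"
proof -
  have "pt x y \<in> K" using assms by (simp add: frontier_eq)
  then have y: "- tp (-x) \<le> y" "y \<le> tp x" using mem_le mem_ge by auto
  obtain \<alpha> \<beta> where ab: "\<beta> \<noteq> 0" "\<And>x' y'. pt x' y' \<in> K \<Longrightarrow> \<alpha> * x' + \<beta> * y' \<le> \<alpha> * x + \<beta> * y"
    using supporting_slope[OF assms] by metis
  have "\<beta> * tp x \<le> \<beta> * y" "\<beta> * (- tp (-x)) \<le> \<beta> * y"
    using ab(2)[OF top_mem[of x]] ab(2)[OF bot_mem[of x]] assms(2) by auto
  then have "\<beta> * (tp x - y) \<le> 0" "0 \<le> \<beta> * (y + tp (-x))" by (simp_all add: algebra_simps)
  then show ?thesis using y ab(1) by (auto simp: mult_le_0_iff zero_le_mult_iff)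
qed

lemma top_frontier:
  assumes "\<bar>x\<bar> \<le> h" shows "pt x (tp x) \<in> frontier K"
proof -
  have "pt x (tp x) \<notin> interior K"
  proof
    assume "pt x (tp x) \<in> interior K"
    then have "\<exists>e>0. pt x (tp x) + e *\<^sub>R v \<in> K"
      using convex_interior_iff[OF conv] by blast
    then obtain e where "e > 0" "pt x (tp x) + e *\<^sub>R v \<in> K" by blast
    then show False using mem_le[of x "tp x + e"] by (simp add: pt_def algebra_simps)
  qed
  then show ?thesis using top_mem[OF assms] by (simp add: frontier_eq)
qed

text \<open>The positive length of the chord fixes the sign \<open>\<beta> > 0\<close> of the
  supporting functional; dividing by \<open>\<beta>\<close> gives a supporting line from
  above.\<close>

lemma supergradient:
  assumes "\<bar>\<tau>\<bar> < h"
  obtains a where "\<And>x. \<bar>x\<bar> \<le> h \<Longrightarrow> tp x \<le> tp \<tau> + a * (x - \<tau>)"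
proof -
  obtain \<alpha> \<beta> where ab: "\<beta> \<noteq> 0" "\<And>x' y'. pt x' y' \<in> K \<Longrightarrow> \<alpha> * x' + \<beta> * y' \<le> \<alpha> * \<tau> + \<beta> * tp \<tau>"
    using supporting_slope[OF top_frontier] assms by (metis less_imp_le)
  have "\<beta> * (- tp (-\<tau>)) \<le> \<beta> * tp \<tau>" using ab(2)[OF bot_mem[of \<tau>]] assms by auto
  then have "0 \<le> \<beta> * (tp \<tau> + tp (-\<tau>))" by (simp add: algebra_simps)
  then have b: "\<beta> > 0" using width_pos[OF assms] ab(1) by (simp add: zero_le_mult_iff)
  show ?thesis
  proof
    fix x assume "\<bar>x\<bar> \<le> h"
    then have "\<alpha> * x + \<beta> * tp x \<le> \<alpha> * \<tau> + \<beta> * tp \<tau>" by (intro ab(2) top_mem)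
    then show "tp x \<le> tp \<tau> + (- \<alpha> / \<beta>) * (x - \<tau>)" using b by (simp add: field_simps)
  qed
qed

lemma K_borel [measurable]: "K \<in> sets borel"
  using comp by (simp add: borel_closed compact_imp_closed)

lemma X_borel [measurable]: "X \<in> borel_measurable borel" and Y_borel [measurable]: "Y \<in> borel_measurable borel"
  by (auto intro: borel_measurable_continuous_onI X_cont Y_cont)

lemma pt_scale: "pt x y + e *\<^sub>R (d1 *\<^sub>R u + d2 *\<^sub>R v) = pt (x + e * d1) (y + e * d2)"
  by (simp add: pt_def algebra_simps)

lemma not_interiorI:
  assumes "\<And>e. e > 0 \<Longrightarrow> pt (x + e * d1) (y + e * d2) \<notin> K"
  shows "pt x y \<notin> interior K"
proof
  assume "pt x y \<in> interior K"
  then have "\<exists>e>0. pt x y + e *\<^sub>R (d1 *\<^sub>R u + d2 *\<^sub>R v) \<in> K"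
    using convex_interior_iff[OF conv] by blast
  then show False using assms by (auto simp: pt_scale)
qed

text \<open>Difference quotients of a concave function decrease: inside the strip they lie between
  the slopes \<open>b\<close> at \<open>\<tau>\<close> and \<open>a\<close> at
  \<open>-\<tau>\<close>, hence in \<open>{-a..a}\<close>.\<close>

lemma top_Lipschitz:
  assumes \<tau>: "0 < \<tau>" "\<tau> < h"
    and a: "\<And>x. \<bar>x\<bar> \<le> h \<Longrightarrow> tp x \<le> tp (-\<tau>) + a * (x + \<tau>)"
    and b: "\<And>x. \<bar>x\<bar> \<le> h \<Longrightarrow> tp x \<le> tp \<tau> + b * (x - \<tau>)"
    and ab: "\<bar>b\<bar> \<le> a"
    and x: "-\<tau> < x1" "x1 \<le> x2" "x2 < \<tau>"
  shows "\<bar>tp x2 - tp x1\<bar> \<le> a * (x2 - x1)"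
proof -
  have up: "tp x2 - tp x1 \<le> a * (x2 - x1)"
  proof -
    \<comment> \<open>The weight of \<open>-\<tau>\<close> when \<open>x1\<close> is written as a
      convex combination of \<open>-\<tau>\<close> and \<open>x2\<close>. The other direction writes
      \<open>x2\<close> in terms of \<open>\<tau>\<close> and \<open>x1\<close>.\<close>
    define t where "t = (x2 - x1) / (x2 + \<tau>)"
    have d: "x2 + \<tau> > 0" using x by simp
    have t: "0 \<le> t" "t \<le> 1" using x d by (auto simp: t_def)
    have td: "t * (x2 + \<tau>) = x2 - x1" using d by (simp add: t_def)
    have "t * tp (-\<tau>) + (1 - t) * tp x2 \<le> tp (t * (-\<tau>) + (1 - t) * x2)"
      using \<tau> x t by (intro top_concave) auto
    also have "t * (-\<tau>) + (1 - t) * x2 = x1" using td by (simp add: algebra_simps)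
    finally have "tp x2 - tp x1 \<le> t * (tp x2 - tp (-\<tau>))" by (simp add: algebra_simps)
    also have "\<dots> \<le> t * (a * (x2 + \<tau>))"
    proof (rule mult_left_mono)
      have "\<bar>x2\<bar> \<le> h" using \<tau> x by linarith
      then show "tp x2 - tp (-\<tau>) \<le> a * (x2 + \<tau>)" using a[of x2] by simp
    qed (rule t)
    also have "\<dots> = a * (x2 - x1)" unfolding td[symmetric] by simp
    finally show ?thesis .
  qed
  have dn: "tp x1 - tp x2 \<le> a * (x2 - x1)"
  proof -
    define t where "t = (x2 - x1) / (\<tau> - x1)"
    have d: "\<tau> - x1 > 0" using x by simp
    have t: "0 \<le> t" "t \<le> 1" using x d by (auto simp: t_def)
    have td: "t * (\<tau> - x1) = x2 - x1" using d by (simp add: t_def)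
    have "t * tp \<tau> + (1 - t) * tp x1 \<le> tp (t * \<tau> + (1 - t) * x1)"
      using \<tau> x t by (intro top_concave) auto
    also have "t * \<tau> + (1 - t) * x1 = x2" using td by (simp add: algebra_simps)
    finally have "tp x1 - tp x2 \<le> t * (tp x1 - tp \<tau>)" by (simp add: algebra_simps)
    also have "\<dots> \<le> t * (b * (x1 - \<tau>))"
    proof (rule mult_left_mono)
      have "\<bar>x1\<bar> \<le> h" using \<tau> x by linarith
      then show "tp x1 - tp \<tau> \<le> b * (x1 - \<tau>)" using b[of x1] by simp
    qed (rule t)
    also have "b * (x1 - \<tau>) \<le> a * (\<tau> - x1)"
      using mult_right_mono[of "-b" a "\<tau> - x1"] ab d by (simp add: algebra_simps abs_le_iff)
    then have "t * (b * (x1 - \<tau>)) \<le> t * (a * (\<tau> - x1))" using t(1) by (rule mult_left_mono)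
    also have "\<dots> = a * (x2 - x1)" unfolding td[symmetric] by simp
    finally show ?thesis .
  qed
  show ?thesis using up dn by simp
qed

text \<open>Slope of the line through \<open>c\<close> and the midpoints of the two chords at
  \<open>-\<tau>\<close> and \<open>\<tau>\<close>. Within the strip this midline separates the two
  arcs.\<close>

definition "mid \<tau> = (tp \<tau> - tp (-\<tau>)) / (2 * \<tau>)"

text \<open>The left side is the secant of the concave function \<open>tp\<close> over the strip:
  parallel to the midline, half a chord above it.\<close>

lemma top_above_mid:
  assumes \<tau>: "0 < \<tau>" "\<tau> < h" and x: "\<bar>x\<bar> \<le> \<tau>"
  shows "mid \<tau> * x + (tp \<tau> + tp (-\<tau>)) / 2 \<le> tp x"
proof -
  define t where "t = (\<tau> - x) / (2 * \<tau>)"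
  have t: "0 \<le> t" "t \<le> 1" using \<tau> x by (auto simp: t_def)
  have "t * tp (-\<tau>) + (1 - t) * tp \<tau> \<le> tp (t * (-\<tau>) + (1 - t) * \<tau>)"
    using \<tau> x t by (intro top_concave) auto
  also have "t * (-\<tau>) + (1 - t) * \<tau> = x" using \<tau> by (simp add: t_def field_simps)
  also have "t * tp (-\<tau>) + (1 - t) * tp \<tau> = mid \<tau> * x + (tp \<tau> + tp (-\<tau>)) / 2"
    using \<tau> by (simp add: t_def mid_def field_simps)
  finally show ?thesis .
qed

lemma frontier_upper:
  assumes \<tau>: "0 < \<tau>" "\<tau> < h" and p: "pt x y \<in> frontier K" "\<bar>x\<bar> < \<tau>"
  shows "(y > mid \<tau> * x \<and> y = tp x) \<or> (y < mid \<tau> * x \<and> y = - tp (-x))"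
proof -
  have w: "tp \<tau> + tp (-\<tau>) > 0" using width_pos[of \<tau>] \<tau> by simp
  have "mid \<tau> * x < tp x"
    using top_above_mid[OF \<tau>, of x] p w half_gt_zero[OF w] by linarith
  moreover have "- tp (-x) < mid \<tau> * x"
  proof -
    have "- (mid \<tau> * x) + (tp \<tau> + tp (-\<tau>)) / 2 \<le> tp (-x)"
      using top_above_mid[OF \<tau>, of "-x"] p by simp
    then show ?thesis using half_gt_zero[OF w] by linarith
  qed
  moreover have "y = tp x \<or> y = - tp (-x)" using frontier_top_or_bot[OF p(1)] p \<tau> by auto
  ultimately show ?thesis by auto
qed

text \<open>On the arc the projection \<open>X\<close> is injective with a
  \<open>sqrt (1 + a\<^sup>2)\<close>-Lipschitz inverse. Cutting along the midline describes the arc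
  by an open set, as the upper bound for lengths requires.\<close>

lemma upper_arc_le:
  assumes g: "arc_length_parametrization g L (frontier K)"
    and \<tau>: "0 < \<tau>" "\<tau> < h"
    and a: "\<And>x. \<bar>x\<bar> \<le> h \<Longrightarrow> tp x \<le> tp (-\<tau>) + a * (x + \<tau>)"
    and b: "\<And>x. \<bar>x\<bar> \<le> h \<Longrightarrow> tp x \<le> tp \<tau> + b * (x - \<tau>)"
    and ab: "\<bar>b\<bar> \<le> a"
  shows "arc_measure g L {p. \<bar>X p\<bar> < \<tau> \<and> Y p > mid \<tau> * X p} \<le> ennreal (sqrt (1 + a\<^sup>2) * (\<tau> - (-\<tau>)))"
proof (rule arc_measure_le[OF g, where \<rho> = X])
  have "open ({p. \<bar>X p\<bar> < \<tau>} \<inter> {p. mid \<tau> * X p < Y p})"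
    by (intro open_Int open_Collect_less continuous_intros X_cont Y_cont)
  then show "open {p. \<bar>X p\<bar> < \<tau> \<and> mid \<tau> * X p < Y p}" by (simp add: Int_def)
  show "sqrt (1 + a\<^sup>2) > 0" by (simp add: add_pos_nonneg)
  fix p q
  have main: "dist p q \<le> sqrt (1 + a\<^sup>2) * \<bar>X p - X q\<bar>"
    if le: "X p \<le> X q" and pq: "p \<in> {p. \<bar>X p\<bar> < \<tau> \<and> mid \<tau> * X p < Y p} \<inter> frontier K"
      "q \<in> {p. \<bar>X p\<bar> < \<tau> \<and> mid \<tau> * X p < Y p} \<inter> frontier K" for p q
  proof -
    have y: "Y p = tp (X p)" "Y q = tp (X q)"
      using frontier_upper[OF \<tau>, of "X p" "Y p"] frontier_upper[OF \<tau>, of "X q" "Y q"] pq by auto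
    have "\<bar>tp (X q) - tp (X p)\<bar> \<le> a * (X q - X p)"
      using pq le by (intro top_Lipschitz[OF \<tau> a b ab]) auto
    then have "(Y p - Y q)\<^sup>2 \<le> (a * (X q - X p))\<^sup>2"
      unfolding y by (metis abs_ge_zero abs_minus_commute power2_abs power_mono)
    then have "(dist p q)\<^sup>2 \<le> (1 + a\<^sup>2) * (X p - X q)\<^sup>2"
      unfolding dist_sq by (simp add: algebra_simps power2_eq_square)
    then have "sqrt ((dist p q)\<^sup>2) \<le> sqrt ((1 + a\<^sup>2) * (X p - X q)\<^sup>2)" by (rule real_sqrt_le_mono)
    then show ?thesis by (simp add: real_sqrt_mult)
  qed
  show "dist p q \<le> sqrt (1 + a\<^sup>2) * \<bar>X p - X q\<bar>"
    if "p \<in> {p. \<bar>X p\<bar> < \<tau> \<and> mid \<tau> * X p < Y p} \<inter> frontier K"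
      "q \<in> {p. \<bar>X p\<bar> < \<tau> \<and> mid \<tau> * X p < Y p} \<inter> frontier K"
    using main[of p q] main[of q p] that by (cases "X p \<le> X q") (auto simp: dist_commute abs_minus_commute)
qed (use \<tau> in \<open>auto intro: X_cont\<close>)

end

text \<open>By symmetry, \<open>lower_support\<close> yields the line of slope \<open>a\<close> that
  supports \<open>K\<close> from below at the lower end of the chord \<open>X = \<tau>\<close>. The
  parallel line through the upper end has to lie above \<open>K\<close> only to the right of the
  chord; any supporting slope of at most \<open>a\<close> at the upper end guarantees this.\<close>

locale strip_frame = centred_body +
  fixes \<tau> a :: real
  assumes \<tau>: "0 < \<tau>" "\<tau> < h"
    and a_nonneg: "0 \<le> a"
    and lower_support: "\<And>x. \<bar>x\<bar> \<le> h \<Longrightarrow> tp x \<le> tp (-\<tau>) + a * (x + \<tau>)"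
    and upper_support: "\<And>x. \<bar>x\<bar> \<le> h \<Longrightarrow> \<tau> \<le> x \<Longrightarrow> tp x \<le> tp \<tau> + a * (x - \<tau>)"
begin

section \<open>Tilted coordinates of a cap, the length of its arc and its area\<close>

definition "w = tp \<tau> + tp (-\<tau>)"
text \<open>Up to the factor \<open>\<phi>\<close>, \<open>\<xi>\<close> and \<open>\<eta>\<close> are the coordinates along and across the supporting line
  of slope \<open>a\<close> at the lower end of the chord \<open>X = \<tau>\<close>, which has length \<open>w\<close>.\<close>

definition "\<xi> p = (X p - \<tau>) + a * (Y p + tp (-\<tau>))"
definition "\<eta> p = (Y p + tp (-\<tau>)) - a * (X p - \<tau>)"

abbreviation "\<phi> \<equiv> sqrt (1 + a\<^sup>2)"

lemma w_pos: "w > 0" using width_pos[of \<tau>] \<tau> by (simp add: w_def)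

lemma \<phi>_pos: "\<phi> > 0" by (simp add: add_pos_nonneg)

lemma \<phi>_sq: "\<phi> * \<phi> = 1 + a\<^sup>2" by (simp add: add_nonneg_nonneg)

lemma \<xi>_\<eta>: "\<xi> p - a * \<eta> p = (1 + a\<^sup>2) * (X p - \<tau>)"
  by (simp add: \<xi>_def \<eta>_def algebra_simps power2_eq_square)

lemma right_iff: "\<tau> < X p \<longleftrightarrow> a * \<eta> p < \<xi> p" "\<tau> \<le> X p \<longleftrightarrow> a * \<eta> p \<le> \<xi> p"
proof -
  have "1 + a\<^sup>2 > 0" by (simp add: add_pos_nonneg)
  then have "0 < (1 + a\<^sup>2) * (X p - \<tau>) \<longleftrightarrow> \<tau> < X p" "0 \<le> (1 + a\<^sup>2) * (X p - \<tau>) \<longleftrightarrow> \<tau> \<le> X p"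
    by (auto simp: zero_less_mult_iff zero_le_mult_iff)
  then show "\<tau> < X p \<longleftrightarrow> a * \<eta> p < \<xi> p" "\<tau> \<le> X p \<longleftrightarrow> a * \<eta> p \<le> \<xi> p"
    unfolding \<xi>_\<eta>[of p, symmetric] by auto
qed

lemma \<xi>_cont: "continuous_on S \<xi>" and \<eta>_cont: "continuous_on S \<eta>"
  unfolding \<xi>_def \<eta>_def by (auto intro!: continuous_intros X_cont Y_cont)

text \<open>Up to a constant, \<open>\<xi> / \<phi>\<close> is the inner product with the unit
  vector of slope \<open>a\<close>; the estimate is Cauchy-Schwarz.\<close>

lemma \<xi>_Lipschitz: "\<bar>\<xi> p / \<phi> - \<xi> q / \<phi>\<bar> \<le> dist p q"
proof -
  let ?dx = "X p - X q" and ?dy = "Y p - Y q"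
  have "(?dx + a * ?dy)\<^sup>2 \<le> (1 + a\<^sup>2) * (?dx\<^sup>2 + ?dy\<^sup>2)"
    using zero_le_power2[of "a * ?dx - ?dy"] by (simp add: power2_eq_square algebra_simps)
  then have "sqrt ((?dx + a * ?dy)\<^sup>2) \<le> sqrt ((1 + a\<^sup>2) * (dist p q)\<^sup>2)"
    unfolding dist_sq by (rule real_sqrt_le_mono)
  then have "\<bar>?dx + a * ?dy\<bar> \<le> \<phi> * dist p q" by (simp add: real_sqrt_mult)
  then have "\<bar>?dx + a * ?dy\<bar> / \<phi> \<le> dist p q" using \<phi>_pos by (simp add: divide_le_eq mult.commute)
  moreover have "\<xi> p / \<phi> - \<xi> q / \<phi> = (?dx + a * ?dy) / \<phi>"
    by (simp add: \<xi>_def diff_divide_distrib[symmetric] algebra_simps)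
  ultimately show ?thesis using \<phi>_pos by (simp add: abs_divide)
qed

lemma \<eta>_nonneg: "p \<in> K \<Longrightarrow> 0 \<le> \<eta> p"
proof -
  assume "p \<in> K"
  then have p: "pt (X p) (Y p) \<in> K" by simp
  have "- tp (- X p) \<le> Y p" by (rule mem_ge[OF p])
  moreover have "tp (- X p) \<le> tp (-\<tau>) + a * (- X p + \<tau>)"
    using mem_x[OF p] by (intro lower_support) auto
  ultimately show ?thesis by (simp add: \<eta>_def algebra_simps)
qed

lemma \<eta>_le_w: "p \<in> K \<Longrightarrow> \<tau> \<le> X p \<Longrightarrow> \<eta> p \<le> w"
proof -
  assume "p \<in> K" and x: "\<tau> \<le> X p"
  then have p: "pt (X p) (Y p) \<in> K" by simp
  have "Y p \<le> tp (X p)" by (rule mem_le[OF p])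
  moreover have "tp (X p) \<le> tp \<tau> + a * (X p - \<tau>)"
    using mem_x[OF p] x by (intro upper_support) auto
  ultimately show ?thesis by (simp add: \<eta>_def w_def algebra_simps)
qed

definition "corner_bot = pt \<tau> (- tp (-\<tau>))"
definition "corner_top = pt \<tau> (tp \<tau>)"

lemma corner_mem: "corner_bot \<in> K" "corner_top \<in> K"
  using \<tau> bot_mem[of \<tau>] top_mem[of \<tau>] by (auto simp: corner_bot_def corner_top_def)

lemma corner_coords [simp]: "\<xi> corner_bot = 0" "\<eta> corner_bot = 0" "\<xi> corner_top = a * w" "\<eta> corner_top = w"
  by (simp_all add: \<xi>_def \<eta>_def corner_bot_def corner_top_def w_def)

lemma combo_coords:
  assumes "\<alpha> + \<beta> = 1"
  shows "\<xi> (\<alpha> *\<^sub>R p + \<beta> *\<^sub>R q) = \<alpha> * \<xi> p + \<beta> * \<xi> q" "\<eta> (\<alpha> *\<^sub>R p + \<beta> *\<^sub>R q) = \<alpha> * \<eta> p + \<beta> * \<eta> q"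
proof -
  have e: "\<alpha> *\<^sub>R p + \<beta> *\<^sub>R q = pt (\<alpha> * X p + \<beta> * X q) (\<alpha> * Y p + \<beta> * Y q)"
    using pt_combo[OF assms, of "X p" "Y p" "X q" "Y q"] by simp
  have \<beta>: "\<beta> = 1 - \<alpha>" using assms by simp
  show "\<xi> (\<alpha> *\<^sub>R p + \<beta> *\<^sub>R q) = \<alpha> * \<xi> p + \<beta> * \<xi> q" "\<eta> (\<alpha> *\<^sub>R p + \<beta> *\<^sub>R q) = \<alpha> * \<eta> p + \<beta> * \<eta> q"
    unfolding e unfolding \<xi>_def \<eta>_def \<beta> by (simp_all add: algebra_simps)
qed

text \<open>Descending from \<open>z\<close> towards the lower supporting line at constant
  \<open>\<xi>\<close> ends on the boundary, namely at a minimum of \<open>\<eta>\<close> on a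
  compact slice of \<open>K\<close>.\<close>

lemma frontier_below:
  assumes "z \<in> K"
  obtains q where "q \<in> frontier K" "\<xi> q = \<xi> z" "\<eta> q \<le> \<eta> z"
proof -
  let ?S = "K \<inter> {q. \<xi> q = \<xi> z}"
  have "compact ?S" by (intro compact_Int_closed comp closed_Collect_eq \<xi>_cont continuous_intros)
  then obtain q where q: "q \<in> ?S" "\<And>p. p \<in> ?S \<Longrightarrow> \<eta> q \<le> \<eta> p"
    using continuous_attains_inf[of ?S \<eta>] assms \<eta>_cont by blast
  have "pt (X q) (Y q) \<notin> interior K"
  \<comment> \<open>The direction \<open>(a, -1)\<close> keeps \<open>\<xi>\<close> fixed and lowers
    \<open>\<eta>\<close>.\<close>
  proof (rule not_interiorI[where ?d1.0 = a and ?d2.0 = "-1"])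
    fix e :: real assume "e > 0"
    let ?p = "pt (X q + e * a) (Y q + e * (-1))"
    have "\<xi> ?p = \<xi> q" "\<eta> ?p = \<eta> q - e * (1 + a\<^sup>2)"
      by (simp_all add: \<xi>_def \<eta>_def algebra_simps power2_eq_square)
    moreover have "e * (1 + a\<^sup>2) > 0" using \<open>e > 0\<close> by (simp add: add_pos_nonneg)
    ultimately show "?p \<notin> K" using q(1) q(2)[of ?p] by auto
  qed
  then have "q \<in> frontier K" using q(1) by (simp add: frontier_eq)
  then show ?thesis using that q assms by auto
qed

text \<open>Ascending at constant \<open>\<xi>\<close> moves to the left if \<open>a > 0\<close>, so
  the walk could leave the cap through the chord before it meets the boundary arc. This is excluded
  once \<open>\<xi>\<close> exceeds \<open>a * w\<close>, its value at the upper end of the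
  chord.\<close>

lemma frontier_above:
  assumes "z \<in> K" "a * w < \<xi> z" "\<tau> \<le> X z"
  obtains q where "q \<in> frontier K" "\<xi> q = \<xi> z" "\<eta> z \<le> \<eta> q" "\<tau> < X q"
proof -
  let ?S = "K \<inter> ({q. \<xi> q = \<xi> z} \<inter> {q. \<tau> \<le> X q})"
  have "compact ?S" by (intro compact_Int_closed comp closed_Int closed_Collect_eq closed_Collect_le \<xi>_cont X_cont continuous_intros)
  then obtain q where q: "q \<in> ?S" "\<And>p. p \<in> ?S \<Longrightarrow> \<eta> p \<le> \<eta> q"
    using continuous_attains_sup[of ?S \<eta>] assms \<eta>_cont by blast
  have "a * \<eta> q \<le> a * w" using \<eta>_le_w[of q] q(1) a_nonneg by (intro mult_left_mono) auto
  then have Xq: "\<tau> < X q" using q(1) assms(2) by (simp add: right_iff(1))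
  have "q \<notin> interior K"
  proof
    assume "q \<in> interior K"
    moreover have "open {q. \<tau> < X q}" by (intro open_Collect_less X_cont continuous_intros)
    \<comment> \<open>Intersecting with the open half-plane keeps a small step in the direction
      \<open>(-a, 1)\<close> to the right of the chord, where \<open>q\<close> is maximal.\<close>
    ultimately have "q \<in> interior (K \<inter> {q. \<tau> < X q})" using Xq by (simp add: interior_open)
    moreover have "convex (K \<inter> {q. \<tau> < X q})"
    proof -
      have "{q. \<tau> < X q} = {q. u \<bullet> q > \<tau> + u \<bullet> c}" by (auto simp: X_def inner_diff_right)
      then show ?thesis using conv convex_halfspace_gt by (metis convex_Int)
    qed
    ultimately have "\<exists>e>0. q + e *\<^sub>R ((-a) *\<^sub>R u + 1 *\<^sub>R v) \<in> K \<inter> {q. \<tau> < X q}"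
      using convex_interior_iff by blast
    then obtain e where e: "e > 0" "pt (X q) (Y q) + e *\<^sub>R ((-a) *\<^sub>R u + 1 *\<^sub>R v) \<in> K \<inter> {q. \<tau> < X q}"
      by auto
    let ?p = "pt (X q + e * (-a)) (Y q + e * 1)"
    have p: "?p \<in> K \<inter> {q. \<tau> < X q}" using e(2) unfolding pt_scale .
    have "\<xi> ?p = \<xi> q" "\<eta> ?p = \<eta> q + e * (1 + a\<^sup>2)"
      by (simp_all add: \<xi>_def \<eta>_def algebra_simps power2_eq_square)
    moreover have "e * (1 + a\<^sup>2) > 0" using \<open>e > 0\<close> by (simp add: add_pos_nonneg)
    ultimately show False using q(1) q(2)[of ?p] p by auto
  qed
  then have "q \<in> frontier K" using q(1) by (simp add: frontier_eq)
  then show ?thesis using that q assms Xq by auto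
qed

text \<open>The part of the boundary arc above the line through \<open>p\<close> and the midpoint of the chord projects
  onto an interval of length \<open>(\<xi> p - a * w) / \<phi>\<close>, the part below it onto one of length \<open>\<xi> p / \<phi>\<close>.\<close>

lemma cap_length_ge:
  assumes g: "arc_length_parametrization g L (frontier K)" and p: "p \<in> K" "\<tau> < X p"
  shows "ennreal ((2 * \<xi> p - a * w) / \<phi>) \<le> arc_measure g L {q. \<tau> < X q}"
proof (cases "2 * \<xi> p \<le> a * w")
  case True
  then have "(2 * \<xi> p - a * w) / \<phi> \<le> 0" using \<phi>_pos by (simp add: divide_nonpos_pos)
  then show ?thesis by (simp add: ennreal_neg)
next
  case False
  let ?x = "\<xi> p" and ?y = "\<eta> p"
  have y: "0 \<le> ?y" "?y \<le> w" "a * ?y < ?x" using \<eta>_nonneg \<eta>_le_w p right_iff by auto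
  have x: "?x > 0" "2 * ?x > a * w"
    using False mult_nonneg_nonneg[OF a_nonneg less_imp_le[OF w_pos]] by auto
  \<comment> \<open>The affine function that vanishes at \<open>p\<close> and at the midpoint of the
    chord, where \<open>\<xi> = a * w / 2\<close> and \<open>\<eta> = w / 2\<close>. Its sign keeps
    the two parts of the arc apart, so that their lengths may be added.\<close>
  define \<Lambda> where "\<Lambda> q = (\<eta> q - ?y) * (?x - a * w / 2) - (\<xi> q - ?x) * (?y - w / 2)" for q
  have \<Lambda>_cont: "continuous_on S \<Lambda>" for S unfolding \<Lambda>_def by (intro continuous_intros \<xi>_cont \<eta>_cont)
  let ?E1 = "{q. \<tau> < X q} \<inter> {q. 0 < \<Lambda> q}" and ?E2 = "{q. \<tau> < X q} \<inter> {q. \<Lambda> q < 0}"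
  have E[measurable]: "?E1 \<in> sets borel" "?E2 \<in> sets borel"
    by (intro borel_open open_Int open_Collect_less X_cont \<Lambda>_cont continuous_intros)+
  have 2: "ennreal (?x / \<phi> - 0 / \<phi>) \<le> arc_measure g L ?E2"
  proof (rule arc_measure_ge[OF g E(2), where \<rho> = "\<lambda>q. \<xi> q / \<phi>"])
    show "{0 / \<phi><..<?x / \<phi>} \<subseteq> (\<lambda>q. \<xi> q / \<phi>) ` (?E2 \<inter> frontier K)"
    proof
      fix s assume "s \<in> {0 / \<phi><..<?x / \<phi>}"
      then have s: "0 < s * \<phi>" "s * \<phi> < ?x" using \<phi>_pos by (auto simp: pos_less_divide_eq)
      define t where "t = s * \<phi> / ?x"
      have t: "0 < t" "t < 1" "t * ?x = s * \<phi>" using s x by (auto simp: t_def)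
      \<comment> \<open>Along the segment from the lower end of the chord to \<open>p\<close> the
        value \<open>\<xi> z\<close> sweeps everything between \<open>0\<close> and
        \<open>\<xi> p\<close>; the boundary point is found below \<open>z\<close>.\<close>
      define z where "z = (1 - t) *\<^sub>R corner_bot + t *\<^sub>R p"
      have "z \<in> K" unfolding z_def using t corner_mem p by (intro convexD[OF conv]) auto
      moreover have z: "\<xi> z = t * ?x" "\<eta> z = t * ?y" unfolding z_def by (simp_all add: combo_coords)
      ultimately obtain q where q: "q \<in> frontier K" "\<xi> q = t * ?x" "\<eta> q \<le> t * ?y"
        using frontier_below by metis
      have "a * \<eta> q \<le> a * (t * ?y)" using q a_nonneg by (intro mult_left_mono)
      also have "\<dots> = t * (a * ?y)" by simp
      also have "\<dots> < t * ?x" using y t by (intro mult_strict_left_mono)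
      finally have "\<tau> < X q" using q by (simp add: right_iff)
      moreover have "\<Lambda> q < 0"
      proof -
        have "\<Lambda> q \<le> (t * ?y - ?y) * (?x - a * w / 2) - (t * ?x - ?x) * (?y - w / 2)"
          unfolding \<Lambda>_def q(2) using q(3) x by (intro diff_right_mono mult_right_mono) auto
        \<comment> \<open>This is the value of \<open>\<Lambda>\<close> at \<open>z\<close>; its
          last factor is positive because \<open>p\<close> lies to the right of the chord.\<close>
        also have "\<dots> = - ((1 - t) * (w / 2) * (?x - a * ?y))" by (simp add: field_simps)
        also have "\<dots> < 0" using t w_pos y by simp
        finally show ?thesis .
      qed
      ultimately show "s \<in> (\<lambda>q. \<xi> q / \<phi>) ` (?E2 \<inter> frontier K)"
        using q t \<phi>_pos by (intro image_eqI[of _ _ q]) auto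
    qed
  qed (rule \<xi>_Lipschitz)
  have 1: "ennreal (?x / \<phi> - a * w / \<phi>) \<le> arc_measure g L ?E1"
  proof (rule arc_measure_ge[OF g E(1), where \<rho> = "\<lambda>q. \<xi> q / \<phi>"])
    show "{a * w / \<phi><..<?x / \<phi>} \<subseteq> (\<lambda>q. \<xi> q / \<phi>) ` (?E1 \<inter> frontier K)"
    proof
      fix s assume "s \<in> {a * w / \<phi><..<?x / \<phi>}"
      then have s: "a * w < s * \<phi>" "s * \<phi> < ?x" using \<phi>_pos by (auto simp: pos_less_divide_eq pos_divide_less_eq)
      \<comment> \<open>Solves \<open>\<xi> z = s * \<phi>\<close> on the segment from the upper end
        of the chord to \<open>p\<close>; here the boundary point is found above
        \<open>z\<close>.\<close>
      define t where "t = (s * \<phi> - a * w) / (?x - a * w)"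
      have t: "0 < t" "t < 1" "t * (?x - a * w) = s * \<phi> - a * w" using s by (auto simp: t_def)
      define z where "z = (1 - t) *\<^sub>R corner_top + t *\<^sub>R p"
      have zK: "z \<in> K" unfolding z_def using t corner_mem p by (intro convexD[OF conv]) auto
      have z': "\<xi> z = (1 - t) * (a * w) + t * ?x" and z: "\<eta> z = (1 - t) * w + t * ?y"
        unfolding z_def by (simp_all add: combo_coords)
      have z'': "\<xi> z = s * \<phi>" using t(3) unfolding z' by (simp add: algebra_simps)
      note z = z'' z
      have "(1 - t) * w + t * ?y \<le> (1 - t) * w + t * w" using t y by (intro add_left_mono mult_left_mono) auto
      then have "\<eta> z \<le> w" unfolding z by (simp add: algebra_simps)
      then have "a * \<eta> z \<le> a * w" using a_nonneg by (intro mult_left_mono)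
      then have "\<tau> \<le> X z" using s z by (simp add: right_iff)
      then obtain q where q: "q \<in> frontier K" "\<xi> q = s * \<phi>" "(1 - t) * w + t * ?y \<le> \<eta> q" "\<tau> < X q"
        using frontier_above[OF zK] s z by metis
      have "\<Lambda> q > 0"
      proof -
        have xs: "?x - s * \<phi> = (1 - t) * (?x - a * w)" using t(3) by (simp add: algebra_simps)
        have "0 < (1 - t) * (w / 2) * (?x - a * ?y)" using t w_pos y by simp
        also have "\<dots> = ((1 - t) * w + t * ?y - ?y) * (?x - a * w / 2) + ((1 - t) * (?x - a * w)) * (?y - w / 2)"
          by (simp add: field_simps)
        also have "\<dots> = ((1 - t) * w + t * ?y - ?y) * (?x - a * w / 2) - (s * \<phi> - ?x) * (?y - w / 2)"
          unfolding xs[symmetric] by (simp add: algebra_simps)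
        also have "\<dots> \<le> \<Lambda> q"
          unfolding \<Lambda>_def q(2) using q(3) x by (intro diff_right_mono mult_right_mono) auto
        finally show ?thesis .
      qed
      then show "s \<in> (\<lambda>q. \<xi> q / \<phi>) ` (?E1 \<inter> frontier K)"
        using q \<phi>_pos by (intro image_eqI[of _ _ q]) auto
    qed
  qed (rule \<xi>_Lipschitz)
  have "ennreal ((2 * ?x - a * w) / \<phi>) = ennreal (?x / \<phi> + (?x / \<phi> - a * w / \<phi>))"
    by (simp add: add_divide_distrib diff_divide_distrib)
  \<comment> \<open>If \<open>\<xi> p < a * w\<close>, the interval for the upper part is empty and
    its negative length is dropped.\<close>
  also have "\<dots> \<le> ennreal (?x / \<phi>) + ennreal (?x / \<phi> - a * w / \<phi>)"
  proof (cases "0 \<le> ?x / \<phi> - a * w / \<phi>")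
    case True
    then show ?thesis using x \<phi>_pos by (subst ennreal_plus) auto
  next
    case False
    then have "ennreal (?x / \<phi> + (?x / \<phi> - a * w / \<phi>)) \<le> ennreal (?x / \<phi>)" by (intro ennreal_leI) simp
    then show ?thesis by (simp add: add_increasing2)
  qed
  also have "\<dots> \<le> arc_measure g L ?E2 + arc_measure g L ?E1" using 1 2 by (intro add_mono) auto
  also have "\<dots> = arc_measure g L (?E2 \<union> ?E1)"
    by (rule arc_measure_Un_disjoint[OF g E(2) E(1), symmetric]) auto
  also have "\<dots> \<le> arc_measure g L {q. \<tau> < X q}"
    by (rule arc_measure_mono[OF g]) (auto intro!: borel_open open_Collect_less X_cont continuous_on_const)
  finally show ?thesis .
qed

definition "cap = K \<inter> {p. \<tau> < X p}"

lemma cap_borel [measurable]: "cap \<in> sets borel"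
  unfolding cap_def by (intro sets.Int K_borel borel_open open_Collect_less X_cont continuous_on_const)

lemma frame_expand:
  "p = corner_bot + (\<xi> p / (1 + a\<^sup>2)) *\<^sub>R (u + a *\<^sub>R v) + (\<eta> p / (1 + a\<^sup>2)) *\<^sub>R (v - a *\<^sub>R u)"
proof -
  have N: "1 + a\<^sup>2 \<noteq> 0" using add_pos_nonneg[of 1 "a\<^sup>2"] by simp
  have "corner_bot + (\<xi> p / (1 + a\<^sup>2)) *\<^sub>R (u + a *\<^sub>R v) + (\<eta> p / (1 + a\<^sup>2)) *\<^sub>R (v - a *\<^sub>R u)
      = pt (\<tau> + (\<xi> p - a * \<eta> p) / (1 + a\<^sup>2)) (- tp (-\<tau>) + (a * \<xi> p + \<eta> p) / (1 + a\<^sup>2))"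
    by (simp add: corner_bot_def pt_def algebra_simps add_divide_distrib diff_divide_distrib)
  also have "\<xi> p - a * \<eta> p = (1 + a\<^sup>2) * (X p - \<tau>)" by (rule \<xi>_\<eta>)
  also have "a * \<xi> p + \<eta> p = (1 + a\<^sup>2) * (Y p + tp (-\<tau>))"
    by (simp add: \<xi>_def \<eta>_def algebra_simps power2_eq_square)
  finally show ?thesis using N by simp
qed

text \<open>The length bound says \<open>2 * \<xi> p \<le> a * w + \<phi> * Lc\<close> on the cap,
  where \<open>Lc\<close> is its arc length. The reflection in the midpoint of the chord maps
  \<open>\<xi>\<close> to \<open>a * w - \<xi>\<close>, so cap and mirror image together have a
  \<open>\<xi>\<close>-range of length \<open>\<phi> * Lc\<close> and an \<open>\<eta>\<close>-range
  of length \<open>w\<close>; divided by \<open>\<phi>\<close>, these are the true sides of the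
  rectangle.\<close>

lemma cap_area:
  assumes g: "arc_length_parametrization g L (frontier K)"
  shows "2 * measure lborel cap * \<phi> \<le> w * enn2real (arc_measure g L {q. \<tau> < X q})"
proof -
  define Lc where "Lc = enn2real (arc_measure g L {q. \<tau> < X q})"
  have fin: "arc_measure g L {q. \<tau> < X q} < \<top>"
    using arc_measure_le_length[of g L] by (rule le_less_trans) simp
  have "Lc \<ge> 0" by (simp add: Lc_def)
  have bound: "2 * \<xi> p \<le> \<phi> * Lc + a * w" if p: "p \<in> K" "\<tau> < X p" for p
  proof -
    have "ennreal ((2 * \<xi> p - a * w) / \<phi>) \<le> ennreal Lc"
      using cap_length_ge[OF g p] fin by (simp add: Lc_def)
    then have "(2 * \<xi> p - a * w) / \<phi> \<le> Lc" using \<open>Lc \<ge> 0\<close> by (simp add: ennreal_le_iff)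
    then show ?thesis using \<phi>_pos by (simp add: divide_le_eq algebra_simps)
  qed
  \<comment> \<open>Points of the cap converging to its upper corner, where \<open>\<xi> = a * w\<close>.\<close>
  have aw: "a * w \<le> \<phi> * Lc"
  proof (rule ccontr)
    assume "\<not> a * w \<le> \<phi> * Lc"
    define e where "e = a * w - \<phi> * Lc"
    define D where "D = \<xi> (pt h (tp h)) - a * w"
    have e: "e > 0" using \<open>\<not> _\<close> by (simp add: e_def)
    \<comment> \<open>Small enough for \<open>2 * r * \<bar>D\<bar> < e\<close>; the summand 1
      ensures \<open>r < 1\<close> even if \<open>D = 0\<close>.\<close>
    define r where "r = e / (e + 2 * \<bar>D\<bar> + 1)"
    have r: "0 < r" "r < 1" using e by (auto simp: r_def divide_simps)
    define p where "p = (1 - r) *\<^sub>R corner_top + r *\<^sub>R pt h (tp h)"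
    have pK: "p \<in> K" unfolding p_def
      using r corner_mem top_mem[of h] h_pos by (intro convexD[OF conv]) auto
    have "p = pt ((1 - r) * \<tau> + r * h) ((1 - r) * tp \<tau> + r * tp h)"
      unfolding p_def corner_top_def by (rule pt_combo) simp
    then have "X p = \<tau> + r * (h - \<tau>)" by (simp add: algebra_simps)
    then have "\<tau> < X p" using r \<tau> by simp
    moreover have "\<xi> p = (1 - r) * (a * w) + r * \<xi> (pt h (tp h))"
      unfolding p_def by (simp add: combo_coords)
    then have "\<xi> p = a * w + r * D" by (simp add: D_def algebra_simps)
    ultimately have "e \<le> 2 * r * (- D)" using bound[OF pK] by (simp add: e_def algebra_simps)
    also have "\<dots> \<le> 2 * r * \<bar>D\<bar>" using r by (intro mult_left_mono) auto
    also have "\<dots> < e"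
    proof -
      have "2 * e * \<bar>D\<bar> < e * (e + 2 * \<bar>D\<bar> + 1)" using e by (simp add: algebra_simps add_pos_pos)
      then show ?thesis using e by (simp add: r_def divide_less_eq)
    qed
    finally show False by simp
  qed
  define N where "N = 1 + a\<^sup>2"
  have N: "N > 0" "\<phi> * \<phi> = N" using \<phi>_sq by (auto simp: N_def add_pos_nonneg)
  \<comment> \<open>The range of \<open>\<xi>\<close> is centred at \<open>a * w / 2\<close>, so the
    reflection preserves it. The division by \<open>N\<close> is due to the direction vectors, which
    have length \<open>\<phi>\<close>.\<close>
  define s0 s1 where "s0 = (a * w - \<phi> * Lc) / 2 / N" and "s1 = (a * w + \<phi> * Lc) / 2 / N"
  define R where "R = {corner_bot + s *\<^sub>R (u + a *\<^sub>R v) + t *\<^sub>R (v - a *\<^sub>R u) | s t. s \<in> {s0..s1} \<and> t \<in> {0..w / N}}"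
  have s01: "s0 \<le> s1" unfolding s0_def s1_def
    using N \<phi>_pos \<open>Lc \<ge> 0\<close> by (intro divide_right_mono) auto
  have w0: "0 \<le> w / N" using w_pos N by simp
  have R: "R \<in> lmeasurable" unfolding R_def by (rule measure_parallelogram[OF s01 w0])
  have mR: "measure lebesgue R = w * Lc / \<phi>"
  proof -
    let ?d1 = "u + a *\<^sub>R v" and ?d2 = "v - a *\<^sub>R u"
    have "?d1$1 * ?d2$2 - ?d1$2 * ?d2$1 = N * (u$1 * v$2 - u$2 * v$1)"
      by (simp add: N_def algebra_simps power2_eq_square)
    moreover have "\<bar>u$1 * v$2 - u$2 * v$1\<bar> = 1"
      using orthonormal_det_real2[OF uu vv uv] by (metis abs_1 abs_minus_cancel power2_eq_1_iff)
    ultimately have "measure lebesgue R = N * ((s1 - s0) * (w / N - 0))"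
      unfolding R_def measure_parallelogram(2)[OF s01 w0] using N by (simp add: abs_mult)
    also have "\<dots> = \<phi> * Lc * w / N"
      using N by (simp add: s0_def s1_def field_simps)
    also have "\<dots> = \<phi> * (w * Lc) / (\<phi> * \<phi>)" unfolding N(2) by (simp add: mult.commute mult.left_commute)
    also have "\<dots> = w * Lc / \<phi>" using \<phi>_pos by (intro mult_divide_mult_cancel_left) simp
    finally show ?thesis .
  qed
  have inR: "p \<in> R" if "a * w - \<phi> * Lc \<le> 2 * \<xi> p" "2 * \<xi> p \<le> a * w + \<phi> * Lc" "0 \<le> \<eta> p" "\<eta> p \<le> w" for p
  proof -
    have "(a * w - \<phi> * Lc) / 2 \<le> \<xi> p" "\<xi> p \<le> (a * w + \<phi> * Lc) / 2" using that by simp_all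
    then have "\<xi> p / N \<in> {s0..s1}"
      unfolding s0_def s1_def atLeastAtMost_iff using less_imp_le[OF N(1)] by (intro conjI divide_right_mono)
    moreover have "\<eta> p / N \<in> {0..w / N}"
      unfolding atLeastAtMost_iff using that less_imp_le[OF N(1)] by (intro conjI divide_right_mono divide_nonneg_nonneg)
    ultimately have "\<xi> p / N \<in> {s0..s1}" "\<eta> p / N \<in> {0..w / N}" by blast+
    then show ?thesis unfolding R_def using frame_expand[of p] unfolding N_def[symmetric] by blast
  qed
  have cap_coords: "a * w - \<phi> * Lc \<le> 2 * \<xi> p" "2 * \<xi> p \<le> a * w + \<phi> * Lc" "0 \<le> \<eta> p" "\<eta> p \<le> w"
    if "p \<in> cap" for p
  proof -
    have p: "p \<in> K" "\<tau> < X p" using that by (auto simp: cap_def)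
    show "0 \<le> \<eta> p" "\<eta> p \<le> w" using \<eta>_nonneg \<eta>_le_w p by auto
    then have "0 \<le> \<xi> p" using right_iff(1)[of p] p a_nonneg mult_nonneg_nonneg[of a "\<eta> p"] by linarith
    \<comment> \<open>This end of the range is dictated by the mirror image; by \<open>aw\<close> it
      is at most \<open>0\<close>, so the cap respects it too.\<close>
    then show "a * w - \<phi> * Lc \<le> 2 * \<xi> p" using aw by linarith
    show "2 * \<xi> p \<le> a * w + \<phi> * Lc" using bound[OF p] by simp
  qed
  \<comment> \<open>The reflection in the midpoint of the chord \<open>X = \<tau>\<close>.\<close>
  define r where "r q = (corner_bot + corner_top) - q" for q
  have r_coords: "\<xi> (r q) = a * w - \<xi> q" "\<eta> (r q) = w - \<eta> q" "X (r q) = 2 * \<tau> - X q" for q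
  proof -
    have e: "r q = pt (\<tau> + \<tau> - X q) (tp \<tau> - tp (-\<tau>) - Y q)"
    proof -
      have "r q = corner_bot + corner_top - pt (X q) (Y q)" by (simp add: r_def)
      then show ?thesis by (simp add: corner_bot_def corner_top_def pt_def vec_eq_iff algebra_simps)
    qed
    show "\<xi> (r q) = a * w - \<xi> q" "\<eta> (r q) = w - \<eta> q" "X (r q) = 2 * \<tau> - X q"
      unfolding e by (simp_all add: \<xi>_def \<eta>_def w_def algebra_simps)
  qed
  have r_meas[measurable]: "r \<in> borel_measurable borel" unfolding r_def[abs_def] by measurable
  let ?cap' = "r -` cap"
  have cap'_borel: "?cap' \<in> sets borel" using measurable_sets[OF r_meas cap_borel] by simp
  have "emeasure lborel ?cap' = emeasure (distr lborel borel r) cap"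
    by (subst emeasure_distr) auto
  also have "distr lborel borel r = lborel" unfolding r_def[abs_def] by (rule lborel_distr_reflect)
  finally have cap'_emeasure: "emeasure lborel ?cap' = emeasure lborel cap" .
  have sub: "cap \<union> ?cap' \<subseteq> R"
  proof
    fix p assume "p \<in> cap \<union> ?cap'"
    then show "p \<in> R"
    proof
      assume "p \<in> ?cap'"
      then have "r p \<in> cap" by simp
      from cap_coords[OF this] show ?thesis unfolding r_coords by (intro inR) auto
    qed (intro inR cap_coords)
  qed
  have fm: "cap \<in> fmeasurable lborel" "?cap' \<in> fmeasurable lborel"
  proof -
    have "emeasure lborel cap \<le> emeasure lborel K" by (rule emeasure_mono) (auto simp: cap_def)
    then have "emeasure lborel cap < \<infinity>" using emeasure_compact_finite[OF comp] by (auto intro: le_less_trans)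
    then show "cap \<in> fmeasurable lborel" "?cap' \<in> fmeasurable lborel"
      using cap'_emeasure cap'_borel by (auto intro!: fmeasurableI)
  qed
  have "2 * measure lborel cap = measure lborel cap + measure lborel ?cap'"
    using cap'_emeasure by (simp add: measure_def)
  also have "\<dots> = measure lborel (cap \<union> ?cap')"
  proof (rule measure_Union[symmetric])
    \<comment> \<open>The cap lies strictly to the right of the chord, its mirror image strictly to
      the left.\<close>
    show "cap \<inter> ?cap' = {}" using r_coords(3) by (auto simp: cap_def)
  qed (use fm cap'_borel in \<open>auto simp: fmeasurable_def\<close>)
  also have "\<dots> = measure lebesgue (cap \<union> ?cap')"
    using cap'_borel by (subst measure_completion) auto
  also have "\<dots> \<le> measure lebesgue R"
    using sub R cap'_borel by (intro measure_mono_fmeasurable) auto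
  finally have "2 * measure lborel cap * \<phi> \<le> w * Lc / \<phi> * \<phi>"
    unfolding mR using \<phi>_pos by (intro mult_right_mono) auto
  then show ?thesis using \<phi>_pos by (simp add: Lc_def)
qed

end

section \<open>Area of the strip, changes of frame and comparison of the proportions\<close>

context centred_body
begin

text \<open>The chords at \<open>-\<tau>\<close> and \<open>\<tau>\<close> are parallel and equally
  long, so their convex hull is a parallelogram inside \<open>K\<close>: a sheared rectangle with
  sides \<open>2 * \<tau>\<close> and \<open>w\<close>.\<close>

lemma inner_area:
  assumes \<tau>: "0 < \<tau>" "\<tau> < h"
  shows "2 * \<tau> * (tp \<tau> + tp (-\<tau>)) \<le> measure lborel (K \<inter> {p. \<bar>X p\<bar> \<le> \<tau>})"
proof -
  define w where "w = tp \<tau> + tp (-\<tau>)"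
  have w: "w > 0" using width_pos[of \<tau>] \<tau> by (simp add: w_def)
  let ?d = "u + mid \<tau> *\<^sub>R v"
  define R where "R = {c + s *\<^sub>R ?d + t *\<^sub>R v | s t. s \<in> {-\<tau>..\<tau>} \<and> t \<in> {-w/2..w/2}}"
  have st: "-\<tau> \<le> \<tau>" "-w/2 \<le> w/2" using \<tau> w by auto
  have sub: "R \<subseteq> K \<inter> {p. \<bar>X p\<bar> \<le> \<tau>}"
  proof
    fix p assume "p \<in> R"
    then obtain s t where p: "p = c + s *\<^sub>R ?d + t *\<^sub>R v" "s \<in> {-\<tau>..\<tau>}" "t \<in> {-w/2..w/2}"
      by (auto simp: R_def)
    have e: "p = pt s (mid \<tau> * s + t)" by (simp add: p(1) pt_def algebra_simps)
    have s: "\<bar>s\<bar> \<le> \<tau>" "\<bar>-s\<bar> \<le> \<tau>" using p by auto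
    have "mid \<tau> * s + w / 2 \<le> tp s" "- (mid \<tau> * s) + w / 2 \<le> tp (-s)"
      using top_above_mid[OF \<tau> s(1)] top_above_mid[OF \<tau> s(2)] by (auto simp: w_def)
    then have "pt s (mid \<tau> * s + t) \<in> K"
      using s \<tau> p(3) by (intro between_mem) auto
    then show "p \<in> K \<inter> {p. \<bar>X p\<bar> \<le> \<tau>}" using e s by simp
  qed
  have "?d$1 * v$2 - ?d$2 * v$1 = u$1 * v$2 - u$2 * v$1" by (simp add: algebra_simps)
  moreover have "\<bar>u$1 * v$2 - u$2 * v$1\<bar> = 1"
    using orthonormal_det_real2[OF uu vv uv] by (metis abs_1 abs_minus_cancel power2_eq_1_iff)
  ultimately have "2 * \<tau> * w = measure lebesgue R"
    unfolding R_def measure_parallelogram(2)[OF st] by simp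
  also have "\<dots> \<le> measure lebesgue (K \<inter> {p. \<bar>X p\<bar> \<le> \<tau>})"
  proof (rule measure_mono_fmeasurable[OF sub])
    show "R \<in> sets lebesgue" using measure_parallelogram(1)[OF st, of c ?d v] by (auto simp: R_def)
    have "compact (K \<inter> {p. \<bar>X p\<bar> \<le> \<tau>})"
      by (intro compact_Int_closed comp closed_Collect_le continuous_intros X_cont)
    then show "K \<inter> {p. \<bar>X p\<bar> \<le> \<tau>} \<in> lmeasurable" by (rule lmeasurable_compact)
  qed
  also have "\<dots> = measure lborel (K \<inter> {p. \<bar>X p\<bar> \<le> \<tau>})"
    by (rule measure_completion) measurable
  finally show ?thesis by (simp add: w_def)
qed

text \<open>Reversing both axes is the half turn about \<open>c\<close>. It keeps the boundary
  function and makes the lower arc and the left cap into the upper arc and the right cap.\<close>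

lemma neg_body: "centred_body K c (-u) (-v) tp h"
proof
  fix x y
  show "c + x *\<^sub>R - u + y *\<^sub>R - v \<in> K \<Longrightarrow> \<bar>x\<bar> \<le> h \<and> y \<le> tp x"
  proof -
    assume "c + x *\<^sub>R - u + y *\<^sub>R - v \<in> K"
    then have "pt (-x) (-y) \<in> K" by (simp add: pt_def)
    from pt_sym[OF this] show ?thesis using mem_x mem_le by auto
  qed
  show "\<bar>x\<bar> \<le> h \<Longrightarrow> c + x *\<^sub>R - u + tp x *\<^sub>R - v \<in> K"
    using pt_sym[OF top_mem[of x]] by (simp add: pt_def)
qed (use conv comp int uu vv uv sym in auto)

text \<open>Reversing only \<open>v\<close> turns a supporting slope \<open>b\<close> at
  \<open>\<tau>\<close> into the slope \<open>-b\<close> at \<open>-\<tau>\<close>, which brings the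
  steeper slope to the place where \<open>strip_frame\<close> expects it.\<close>

lemma flip_body: "centred_body K c u (-v) (\<lambda>x. tp (-x)) h"
proof
  fix x y
  show "c + x *\<^sub>R u + y *\<^sub>R - v \<in> K \<Longrightarrow> \<bar>x\<bar> \<le> h \<and> y \<le> tp (-x)"
  proof -
    assume "c + x *\<^sub>R u + y *\<^sub>R - v \<in> K"
    then have "pt x (-y) \<in> K" by (simp add: pt_def)
    from pt_sym[OF this] show ?thesis using mem_x mem_le by force
  qed
  show "\<bar>x\<bar> \<le> h \<Longrightarrow> c + x *\<^sub>R u + tp (-x) *\<^sub>R - v \<in> K"
    using pt_sym[OF top_mem[of "-x"]] by (simp add: pt_def)
qed (use conv comp int uu vv uv sym in auto)

text \<open>All four bounds with one common \<open>\<phi>\<close>. Up to the order of its parts, the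
  conjunction is the same in the frame with \<open>v\<close> reversed, which allows the transfer
  between the two cases.\<close>

definition "arcs_and_caps g L \<tau> \<phi> \<longleftrightarrow>
  arc_measure g L {p. \<bar>X p\<bar> < \<tau> \<and> mid \<tau> * X p < Y p} \<le> ennreal (2 * \<tau> * \<phi>) \<and>
  arc_measure g L {p. \<bar>X p\<bar> < \<tau> \<and> Y p < mid \<tau> * X p} \<le> ennreal (2 * \<tau> * \<phi>) \<and>
  2 * measure lborel (K \<inter> {p. \<tau> < X p}) * \<phi>
    \<le> (tp \<tau> + tp (-\<tau>)) * enn2real (arc_measure g L {p. \<tau> < X p}) \<and>
  2 * measure lborel (K \<inter> {p. X p < -\<tau>}) * \<phi>
    \<le> (tp \<tau> + tp (-\<tau>)) * enn2real (arc_measure g L {p. X p < -\<tau>})"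

lemma arcs_and_caps_steep_below:
  assumes g: "arc_length_parametrization g L (frontier K)"
    and \<tau>: "0 < \<tau>" "\<tau> < h"
    and a: "\<And>x. \<bar>x\<bar> \<le> h \<Longrightarrow> tp x \<le> tp (-\<tau>) + a * (x + \<tau>)"
    and b: "\<And>x. \<bar>x\<bar> \<le> h \<Longrightarrow> tp x \<le> tp \<tau> + b * (x - \<tau>)"
    and ab: "\<bar>b\<bar> \<le> a"
  shows "arcs_and_caps g L \<tau> (sqrt (1 + a\<^sup>2))"
proof -
  \<comment> \<open>To the right of the chord \<open>x - \<tau>\<close> is nonnegative, so the slope
    may be increased from \<open>b\<close> to \<open>a\<close>.\<close>
  have b': "tp x \<le> tp \<tau> + a * (x - \<tau>)" if "\<bar>x\<bar> \<le> h" "\<tau> \<le> x" for x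
  proof -
    have "b * (x - \<tau>) \<le> a * (x - \<tau>)" using ab that by (intro mult_right_mono) auto
    then show ?thesis using b[OF that(1)] by linarith
  qed
  interpret neg: centred_body K c "-u" "-v" tp h by (rule neg_body)
  interpret sf: strip_frame K c u v tp h \<tau> a
    by unfold_locales (use \<tau> a b' ab in auto)
  interpret nsf: strip_frame K c "-u" "-v" tp h \<tau> a
    by unfold_locales (use \<tau> a b' ab in auto)
  have XY: "neg.X = (\<lambda>p. - X p)" "neg.Y = (\<lambda>p. - Y p)"
    by (auto simp: X_def Y_def neg.X_def neg.Y_def)
  have s: "{p. \<bar>X p\<bar> < \<tau> \<and> mid \<tau> * - X p < - Y p} = {p. \<bar>X p\<bar> < \<tau> \<and> Y p < mid \<tau> * X p}"
    "{p. \<tau> < - X p} = {p. X p < - \<tau>}" by auto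
  show ?thesis
    using upper_arc_le[OF g \<tau> a b ab] neg.upper_arc_le[OF g \<tau> a b ab] sf.cap_area[OF g] nsf.cap_area[OF g]
    unfolding arcs_and_caps_def sf.cap_def nsf.cap_def sf.w_def nsf.w_def XY abs_minus_cancel s
    by (simp add: mult.commute mult.left_commute)
qed

lemma arcs_and_caps_exists:
  assumes g: "arc_length_parametrization g L (frontier K)"
    and \<tau>: "0 < \<tau>" "\<tau> < h"
  obtains \<phi> where "\<phi> > 0" "arcs_and_caps g L \<tau> \<phi>"
proof -
  obtain a where a: "\<And>x. \<bar>x\<bar> \<le> h \<Longrightarrow> tp x \<le> tp (-\<tau>) + a * (x + \<tau>)"
    using supergradient[of "-\<tau>"] \<tau> by auto
  obtain b where b: "\<And>x. \<bar>x\<bar> \<le> h \<Longrightarrow> tp x \<le> tp \<tau> + b * (x - \<tau>)"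
    using supergradient[of "\<tau>"] \<tau> by auto
  have "tp \<tau> \<le> tp (-\<tau>) + a * (2 * \<tau>)" "tp (-\<tau>) \<le> tp \<tau> - b * (2 * \<tau>)"
    using a[of \<tau>] b[of "-\<tau>"] \<tau> by (simp_all add: algebra_simps)
  \<comment> \<open>Supporting slopes decrease from \<open>-\<tau>\<close> to \<open>\<tau>\<close>,
    that is, \<open>b \<le> a\<close>; hence one of \<open>a\<close> and \<open>-b\<close> bounds
    both absolute values.\<close>
  then have "b * (2 * \<tau>) \<le> a * (2 * \<tau>)" by linarith
  then have "b \<le> a" using \<tau> by simp
  then consider "\<bar>b\<bar> \<le> a" | "\<bar>-a\<bar> \<le> -b" by linarith
  then show ?thesis
  proof cases
    case 1
    show ?thesis by (rule that[OF _ arcs_and_caps_steep_below[OF g \<tau> a b 1]]) (auto simp: add_pos_nonneg)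
  next
    case 2
    interpret flip: centred_body K c u "-v" "\<lambda>x. tp (-x)" h by (rule flip_body)
    have "flip.arcs_and_caps g L \<tau> (sqrt (1 + (-b)\<^sup>2))"
    proof (rule flip.arcs_and_caps_steep_below[OF g \<tau> _ _ 2])
      fix x assume "\<bar>x\<bar> \<le> h"
      then show "tp (- x) \<le> tp (- (- \<tau>)) + - b * (x + \<tau>)" "tp (- x) \<le> tp (- \<tau>) + - a * (x - \<tau>)"
        using b[of "-x"] a[of "-x"] by (auto simp: algebra_simps)
    qed
    moreover have Y: "flip.Y = (\<lambda>p. - Y p)" by (auto simp: Y_def flip.Y_def)
    moreover have mid: "flip.mid \<tau> = - mid \<tau>" by (simp add: mid_def flip.mid_def minus_divide_left)
    ultimately have "arcs_and_caps g L \<tau> (sqrt (1 + (-b)\<^sup>2))"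
      unfolding arcs_and_caps_def flip.arcs_and_caps_def Y mid
      by (simp add: add.commute)
    then show ?thesis by (intro that[of "sqrt (1 + (-b)\<^sup>2)"]) (auto simp: add_pos_nonneg)
  qed
qed

lemma length_le_sum:
  assumes g: "arc_length_parametrization g L (frontier K)"
    and \<tau>: "0 < \<tau>" "\<tau> < h"
  shows "ennreal L \<le> arc_measure g L {p. \<bar>X p\<bar> < \<tau> \<and> mid \<tau> * X p < Y p}
    + arc_measure g L {p. \<bar>X p\<bar> < \<tau> \<and> Y p < mid \<tau> * X p} + arc_measure g L {p. \<tau> < \<bar>X p\<bar>}"
proof -
  let ?U = "{p. \<bar>X p\<bar> < \<tau>} \<inter> {p. mid \<tau> * X p < Y p}" and ?D = "{p. \<bar>X p\<bar> < \<tau>} \<inter> {p. Y p < mid \<tau> * X p}"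
  let ?C = "{p. \<tau> < \<bar>X p\<bar>}"
  \<comment> \<open>The ends of the two chords are the only boundary points that the three open sets
    can miss, and a finite set has length zero.\<close>
  let ?F = "{pt \<tau> (tp \<tau>), pt \<tau> (- tp (-\<tau>)), pt (-\<tau>) (tp (-\<tau>)), pt (-\<tau>) (- tp \<tau>)}"
  have L: "0 < L" and im: "g ` {0..L} = frontier K" using g by (auto simp: arc_length_parametrization_def)
  have b: "?U \<in> sets borel" "?D \<in> sets borel" "?C \<in> sets borel" "?F \<in> sets borel"
    by (auto intro!: borel_open open_Int open_Collect_less X_cont Y_cont continuous_intros finite_imp_closed borel_closed)
  have cover: "p \<in> ?U \<union> ?D \<union> ?C \<union> ?F" if "p \<in> frontier K" for p
  proof -
    have p: "pt (X p) (Y p) \<in> frontier K" using that by simp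
    consider "\<bar>X p\<bar> < \<tau>" | "\<tau> < \<bar>X p\<bar>" | "X p = \<tau>" | "X p = -\<tau>" by linarith
    then show ?thesis
    proof cases
      case 1
      then show ?thesis using frontier_upper[OF \<tau> p] by auto
    next
      case 3
      then have "Y p = tp \<tau> \<or> Y p = - tp (-\<tau>)" using frontier_top_or_bot[OF p] \<tau> by auto
      then show ?thesis using 3 pt_XY[of p] by auto
    next
      case 4
      then have "Y p = tp (-\<tau>) \<or> Y p = - tp \<tau>" using frontier_top_or_bot[OF p] \<tau> by auto
      then show ?thesis using 4 pt_XY[of p] by auto
    qed auto
  qed
  have "ennreal L = emeasure lborel {0..L}" using L by simp
  also have "\<dots> = arc_measure g L (?U \<union> ?D \<union> ?C \<union> ?F)"
    unfolding arc_measure_def using cover im by (intro arg_cong[where f="emeasure lborel"]) blast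
  also have "\<dots> \<le> arc_measure g L ?U + arc_measure g L ?D + arc_measure g L ?C + arc_measure g L ?F"
    by (intro order_trans[OF arc_measure_Un_le[OF g]] add_mono order_refl sets.Un b)
  also have "arc_measure g L ?F = 0" by (rule arc_measure_finite_null[OF g]) simp
  finally show ?thesis by (simp add: Int_def)
qed

lemma strip_dominance:
  assumes g: "arc_length_parametrization g L (frontier K)"
    and \<tau>: "0 < \<tau>" "\<tau> < h"
  shows "L * measure lborel (K \<inter> {p. \<tau> < \<bar>X p\<bar>})
    \<le> enn2real (arc_measure g L {p. \<tau> < \<bar>X p\<bar>}) * measure lborel K"
proof -
  obtain \<phi> where \<phi>: "\<phi> > 0" and ac: "arcs_and_caps g L \<tau> \<phi>"
    by (rule arcs_and_caps_exists[OF g \<tau>])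
  define w where "w = tp \<tau> + tp (-\<tau>)"
  have w: "w > 0" using width_pos[of \<tau>] \<tau> by (simp add: w_def)
  have L: "L > 0" using g by (simp add: arc_length_parametrization_def)
  let ?R = "{p. \<tau> < X p}" and ?L = "{p. X p < - \<tau>}"
  have b: "?R \<in> sets borel" "?L \<in> sets borel"
    by (intro borel_open open_Collect_less X_cont continuous_intros)+
  have RL: "{p. \<tau> < \<bar>X p\<bar>} = ?R \<union> ?L" "?R \<inter> ?L = {}" using \<tau> by auto
  have fin: "arc_measure g L E < \<top>" for E
    using arc_measure_le_length[of g L E] by (rule le_less_trans) simp
  define c1 c2 C where "c1 = enn2real (arc_measure g L ?R)" and "c2 = enn2real (arc_measure g L ?L)"
    and "C = enn2real (arc_measure g L {p. \<tau> < \<bar>X p\<bar>})"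
  have C: "C = c1 + c2"
    unfolding C_def c1_def c2_def RL(1) arc_measure_Un_disjoint[OF g b RL(2)] using fin
    by (simp add: enn2real_plus)
  have C0: "C \<ge> 0" by (simp add: C_def)
  define Ain Aout where "Ain = measure lborel (K \<inter> {p. \<bar>X p\<bar> \<le> \<tau>})"
    and "Aout = measure lborel (K \<inter> {p. \<tau> < \<bar>X p\<bar>})"
  have fm: "K \<inter> E \<in> fmeasurable lborel" if "E \<in> sets borel" for E
    using that emeasure_compact_finite[OF comp] emeasure_mono[of "K \<inter> E" K lborel]
    by (intro fmeasurableI) (auto intro: le_less_trans)
  have bs: "{p. \<bar>X p\<bar> \<le> \<tau>} \<in> sets borel" "{p. \<tau> < \<bar>X p\<bar>} \<in> sets borel"
    by (auto intro!: borel_open borel_closed open_Collect_less closed_Collect_le X_cont continuous_intros)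
  have "measure lborel K = measure lborel ((K \<inter> {p. \<bar>X p\<bar> \<le> \<tau>}) \<union> (K \<inter> {p. \<tau> < \<bar>X p\<bar>}))"
    by (intro arg_cong[where f="measure lborel"]) auto
  also have "\<dots> = Ain + Aout" unfolding Ain_def Aout_def
    using fm[OF bs(1)] fm[OF bs(2)] by (intro measure_Union) (auto simp: fmeasurable_def)
  finally have A: "measure lborel K = Ain + Aout" .
  have "Aout = measure lborel ((K \<inter> ?R) \<union> (K \<inter> ?L))"
    unfolding Aout_def RL(1) by (intro arg_cong[where f="measure lborel"]) auto
  also have "\<dots> = measure lborel (K \<inter> ?R) + measure lborel (K \<inter> ?L)"
    using fm[OF b(1)] fm[OF b(2)] RL(2) by (intro measure_Union) (auto simp: fmeasurable_def)
  finally have Aout: "2 * Aout * \<phi> \<le> w * C"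
    using ac unfolding arcs_and_caps_def C c1_def c2_def w_def[symmetric] by (simp add: algebra_simps)
  have Ain: "2 * \<tau> * w \<le> Ain" unfolding Ain_def w_def by (rule inner_area[OF \<tau>])
  have Lle: "L \<le> 4 * \<tau> * \<phi> + C"
  proof -
    have "ennreal L \<le> ennreal (2 * \<tau> * \<phi>) + ennreal (2 * \<tau> * \<phi>) + ennreal C"
      using ac fin unfolding arcs_and_caps_def C_def
      by (intro order_trans[OF length_le_sum[OF g \<tau>]] add_mono) auto
    also have "\<dots> = ennreal (4 * \<tau> * \<phi> + C)" using \<tau> \<phi> C0 by (simp flip: ennreal_plus)
    finally show ?thesis using \<tau> \<phi> C0 by (subst (asm) ennreal_le_iff) auto
  qed
  have Aout0: "Aout \<ge> 0" by (simp add: Aout_def)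
  have "L * Aout \<le> (4 * \<tau> * \<phi> + C) * Aout" using Lle Aout0 by (rule mult_right_mono)
  also have "\<dots> = (2 * \<tau>) * (2 * Aout * \<phi>) + C * Aout" by (simp add: algebra_simps)
  also have "\<dots> \<le> (2 * \<tau>) * (w * C) + C * Aout" using Aout \<tau> by (intro add_right_mono mult_left_mono) auto
  also have "\<dots> = (2 * \<tau> * w) * C + C * Aout" by simp
  also have "\<dots> \<le> Ain * C + C * Aout" using Ain C0 by (intro add_right_mono mult_right_mono)
  also have "\<dots> = C * measure lborel K" unfolding A by (simp add: algebra_simps)
  finally show ?thesis by (simp add: C_def Aout_def)
qed

end

section \<open>Existence of a frame for every direction\<close>

lemma body_frame:
  assumes K: "convex_body K" and sym: "\<And>p. p \<in> K \<Longrightarrow> 2 *\<^sub>R c - p \<in> K"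
    and u: "u \<bullet> u = 1" and v: "v \<bullet> v = 1" and uv: "u \<bullet> v = 0"
  obtains tp h where "centred_body K c u v tp h" "\<And>p. p \<in> K \<Longrightarrow> \<bar>u \<bullet> (p - c)\<bar> \<le> h"
proof -
  have conv: "convex K" and comp: "compact K" and int: "interior K \<noteq> {}" using K by (auto simp: convex_body_def)
  have ne: "K \<noteq> {}" using int interior_subset by blast
  let ?X = "\<lambda>p. u \<bullet> (p - c)" and ?Y = "\<lambda>p. v \<bullet> (p - c)"
  have vu: "v \<bullet> u = 0" using uv by (simp add: inner_commute)
  have expand: "p = c + ?X p *\<^sub>R u + ?Y p *\<^sub>R v" for p
    using orthonormal_expand_real2[OF u v uv, of "p - c"] by (simp add: algebra_simps)
  obtain m where m: "m \<in> K" "\<And>p. p \<in> K \<Longrightarrow> ?X p \<le> ?X m"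
  proof -
    have "continuous_on K ?X" by (intro continuous_intros)
    then show ?thesis using continuous_attains_sup[OF comp ne] that by blast
  qed
  define h where "h = ?X m"
  have m': "2 *\<^sub>R c - m \<in> K" "?X (2 *\<^sub>R c - m) = - h"
    using sym[OF m(1)] by (simp_all add: h_def inner_diff_right scaleR_2 inner_add_right)
  have h: "\<bar>?X p\<bar> \<le> h" if "p \<in> K" for p
  proof -
    have "?X (2 *\<^sub>R c - p) \<le> h" using m(2)[OF sym[OF that]] by (simp add: h_def)
    then show ?thesis using m(2)[OF that] by (simp add: h_def inner_diff_right scaleR_2 inner_add_right)
  qed
  have "\<exists>y. c + x *\<^sub>R u + y *\<^sub>R v \<in> K \<and> (\<forall>y'. c + x *\<^sub>R u + y' *\<^sub>R v \<in> K \<longrightarrow> y' \<le> y)" if x: "\<bar>x\<bar> \<le> h" for x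
  proof -
    let ?S = "K \<inter> {p. ?X p = x}"
    have cS: "compact ?S" by (intro compact_Int_closed comp closed_Collect_eq continuous_intros)
    have neS: "?S \<noteq> {}"
    proof (cases "h = 0")
      case True
      then show ?thesis using x m by (auto simp: h_def)
    next
      case False
      then have hp: "h > 0" using x by simp
      \<comment> \<open>On the segment from \<open>m\<close> to its mirror image the abscissa runs
        from \<open>h\<close> to \<open>-h\<close>; this weight gives the abscissa
        \<open>x\<close>.\<close>
      define t where "t = (h + x) / (2 * h)"
      have t: "0 \<le> t" "t \<le> 1" using x hp by (auto simp: t_def)
      let ?p = "t *\<^sub>R m + (1 - t) *\<^sub>R (2 *\<^sub>R c - m)"
      have "?p \<in> K" using t m m' by (intro convexD[OF conv]) auto
      have lin: "?X (t *\<^sub>R m + (1 - t) *\<^sub>R z) = t * ?X m + (1 - t) * ?X z" for z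
        by (simp add: inner_diff_right inner_add_right algebra_simps)
      have "?X ?p = t * h + (1 - t) * (- h)" by (simp only: lin m'(2) h_def[symmetric])
      then have "?X ?p = x" using hp by (simp add: t_def field_simps)
      with \<open>?p \<in> K\<close> show ?thesis by blast
    qed
    have "continuous_on ?S ?Y" by (intro continuous_intros)
    from continuous_attains_sup[OF cS neS this]
    obtain q where q: "q \<in> ?S" "\<And>p. p \<in> ?S \<Longrightarrow> ?Y p \<le> ?Y q" by blast
    have xq: "?X q = x" using q(1) by simp
    have "c + x *\<^sub>R u + ?Y q *\<^sub>R v = q" by (rule expand[of q, unfolded xq, symmetric])
    then have "c + x *\<^sub>R u + ?Y q *\<^sub>R v \<in> K" using q(1) by (metis IntD1)
    moreover have "y' \<le> ?Y q" if "c + x *\<^sub>R u + y' *\<^sub>R v \<in> K" for y'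
      using q(2)[of "c + x *\<^sub>R u + y' *\<^sub>R v"] that by (simp add: inner_add_right u v uv vu)
    ultimately show ?thesis by blast
  qed
  then obtain tp where tp: "\<And>x. \<bar>x\<bar> \<le> h \<Longrightarrow> c + x *\<^sub>R u + tp x *\<^sub>R v \<in> K"
    "\<And>x y. \<bar>x\<bar> \<le> h \<Longrightarrow> c + x *\<^sub>R u + y *\<^sub>R v \<in> K \<Longrightarrow> y \<le> tp x"
    by metis
  have "centred_body K c u v tp h"
  proof
    fix x y assume *: "c + x *\<^sub>R u + y *\<^sub>R v \<in> K"
    have "\<bar>x\<bar> \<le> h" using h[OF *] by (simp add: inner_add_right u uv)
    then show "\<bar>x\<bar> \<le> h \<and> y \<le> tp x" using tp(2)[OF _ *] by simp
  qed (use conv comp int u v uv sym tp in auto)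
  then show ?thesis using that h by blast
qed

lemma body_strip_dominance:
  assumes K: "convex_body K" and sym: "\<And>p. p \<in> K \<Longrightarrow> 2 *\<^sub>R c - p \<in> K"
    and u: "norm u = 1" and g: "arc_length_parametrization g L (frontier K)" and "0 < \<tau>"
  shows "L * measure lborel (K \<inter> {p. \<tau> < \<bar>u \<bullet> (p - c)\<bar>})
    \<le> enn2real (arc_measure g L {p. \<tau> < \<bar>u \<bullet> (p - c)\<bar>}) * measure lborel K"
proof -
  have uu: "u \<bullet> u = 1" using u by (simp add: norm_eq_1)
  define v :: "real^2" where "v = vector [- u$2, u$1]"
  have v: "v \<bullet> v = 1" "u \<bullet> v = 0" using uu by (simp_all add: v_def inner_real2)
  obtain tp h where "centred_body K c u v tp h" and h: "\<And>p. p \<in> K \<Longrightarrow> \<bar>u \<bullet> (p - c)\<bar> \<le> h"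
    using body_frame[OF K sym uu v] by metis
  then interpret centred_body K c u v tp h by simp
  show ?thesis
  proof (cases "\<tau> < h")
    case True
    then show ?thesis using strip_dominance[OF g \<open>0 < \<tau>\<close>] by (simp add: X_def)
  next
    case False
    then have "K \<inter> {p. \<tau> < \<bar>u \<bullet> (p - c)\<bar>} = {}" using h by fastforce
    then show ?thesis by simp
  qed
qed

subsection \<open>Uniqueness and symmetry of arc length measure\<close>

text \<open>The distance to \<open>g s\<close> is 1-Lipschitz and, by the intermediate value
  theorem, takes on the arc all values up to the distance of the end points.\<close>

lemma arc_measure_arc_ge_dist:
  assumes g: "arc_length_parametrization g L C" and g': "arc_length_parametrization g' L' C"
    and s: "0 \<le> s" "s \<le> t" "t \<le> L"
  shows "ennreal (dist (g s) (g t)) \<le> arc_measure g' L' (g ` {s..t})"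
proof -
  have cont: "continuous_on {s..t} g"
    using continuous_on_subset[OF arc_length_parametrization_continuous[OF g]] s by simp
  have sub: "g ` {s..t} \<subseteq> C" using g s by (force simp: arc_length_parametrization_def)
  have "ennreal (dist (g s) (g t) - 0) \<le> arc_measure g' L' (g ` {s..t})"
  proof (rule arc_measure_ge[OF g', where \<rho> = "\<lambda>p. dist (g s) p"])
    show "g ` {s..t} \<in> sets borel"
      using compact_continuous_image[OF cont] by (simp add: borel_closed compact_imp_closed)
    show "\<bar>dist (g s) p - dist (g s) q\<bar> \<le> dist p q" for p q
      using dist_triangle[of "g s" p q] dist_triangle[of "g s" q p] by (simp add: dist_commute abs_le_iff)
    have "connected ((\<lambda>x. dist (g s) (g x)) ` {s..t})"
      by (intro connected_continuous_image continuous_intros cont) simp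
    then have "{dist (g s) (g s)..dist (g s) (g t)} \<subseteq> (\<lambda>x. dist (g s) (g x)) ` {s..t}"
      by (rule connected_contains_Icc) (use s in auto)
    then have "{0<..<dist (g s) (g t)} \<subseteq> (\<lambda>x. dist (g s) (g x)) ` {s..t}" by auto
    also have "\<dots> = dist (g s) ` (g ` {s..t} \<inter> C)" using sub by auto
    finally show "{0<..<dist (g s) (g t)} \<subseteq> dist (g s) ` (g ` {s..t} \<inter> C)" .
  qed
  then show ?thesis by simp
qed

text \<open>The bound by distances is summed over an inscribed polygon; consecutive arcs share a
  single point, which is null. The condition \<open>t < L\<close> keeps \<open>g\<close> injective
  on the parameter interval.\<close>

lemma arc_measure_arc_ge_length:
  assumes g: "arc_length_parametrization g L C" and g': "arc_length_parametrization g' L' C"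
    and s: "0 \<le> s" "s \<le> t" "t < L"
  shows "ennreal (t - s) \<le> arc_measure g' L' (g ` {s..t})"
proof -
  have inj: "inj_on g {0..<L}" using g by (simp add: arc_length_parametrization_def)
  have borel: "g ` {x..y} \<in> sets borel" if "0 \<le> x" "y \<le> L" for x y
  proof -
    have "continuous_on {x..y} g"
      using continuous_on_subset[OF arc_length_parametrization_continuous[OF g]] that by simp
    from compact_continuous_image[OF this] show ?thesis by (simp add: borel_closed compact_imp_closed)
  qed
  have "curve_length g s t \<le> arc_measure g' L' (g ` {s..t})"
    unfolding curve_length_def
  proof (rule SUP_least, clarify)
    fix m :: nat and \<tau> :: "nat \<Rightarrow> real"
    assume \<tau>: "mono_on {..m} \<tau>" "s = \<tau> 0" "t = \<tau> m"
    have "ennreal (\<Sum>i<k. dist (g (\<tau> i)) (g (\<tau> (Suc i)))) \<le> arc_measure g' L' (g ` {\<tau> 0..\<tau> k})" if "k \<le> m" for k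
      using that
    proof (induction k)
      case 0
      then show ?case by simp
    next
      case (Suc k)
      let ?A = "g ` {\<tau> 0..\<tau> k}" and ?B = "g ` {\<tau> k..\<tau> (Suc k)}" and ?p = "{g (\<tau> k)}"
      have o: "0 \<le> \<tau> 0" "\<tau> 0 \<le> \<tau> k" "\<tau> k \<le> \<tau> (Suc k)" "\<tau> (Suc k) \<le> t"
        using Suc.prems \<tau> s by (auto intro!: mono_onD[OF \<tau>(1)])
      have b: "?A \<in> sets borel" "?B - ?p \<in> sets borel" "?p \<in> sets borel"
        using o s by (auto intro!: borel sets.Diff)
      have disj: "?A \<inter> (?B - ?p) = {}"
      proof -
        have "p = g (\<tau> k)" if pA: "p \<in> ?A" and pB: "p \<in> ?B" for p
        proof -
          obtain x where x: "x \<in> {\<tau> 0..\<tau> k}" "p = g x" using pA by blast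
          obtain y where y: "y \<in> {\<tau> k..\<tau> (Suc k)}" "p = g y" using pB by blast
          have "x = y" using inj_onD[OF inj, of x y] x y o s by auto
          then have "x = \<tau> k" using x(1) y(1) by auto
          then show ?thesis using x(2) by simp
        qed
        then show ?thesis by blast
      qed
      have "arc_measure g' L' ?B \<le> arc_measure g' L' ((?B - ?p) \<union> ?p)"
        by (rule arc_measure_mono[OF g' _ sets.Un[OF b(2,3)]]) auto
      also have "\<dots> \<le> arc_measure g' L' (?B - ?p) + arc_measure g' L' ?p"
        by (rule arc_measure_Un_le[OF g' b(2,3)])
      also have "arc_measure g' L' ?p = 0" by (rule arc_measure_finite_null[OF g']) simp
      finally have B: "arc_measure g' L' ?B \<le> arc_measure g' L' (?B - ?p)" by simp
      have "ennreal (\<Sum>i<Suc k. dist (g (\<tau> i)) (g (\<tau> (Suc i))))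
          = ennreal (\<Sum>i<k. dist (g (\<tau> i)) (g (\<tau> (Suc i)))) + ennreal (dist (g (\<tau> k)) (g (\<tau> (Suc k))))"
        by (simp add: ennreal_plus sum_nonneg)
      also have "\<dots> \<le> arc_measure g' L' ?A + arc_measure g' L' (?B - ?p)"
        using o s Suc by (intro add_mono order_trans[OF arc_measure_arc_ge_dist[OF g g'] B]) auto
      also have "\<dots> = arc_measure g' L' (?A \<union> (?B - ?p))"
        by (rule arc_measure_Un_disjoint[OF g' b(1,2) disj, symmetric])
      also have "\<dots> \<le> arc_measure g' L' (g ` {\<tau> 0..\<tau> (Suc k)})"
        using o s by (intro arc_measure_mono[OF g'] borel) auto
      finally show ?case .
    qed
    from this[of m] show "ennreal (\<Sum>i<m. dist (g (\<tau> i)) (g (\<tau> (Suc i)))) \<le> arc_measure g' L' (g ` {\<tau> 0..\<tau> m})" by simp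
  qed
  then show ?thesis using g s by (simp add: arc_length_parametrization_def)
qed

lemma arc_length_le:
  assumes g: "arc_length_parametrization g L C" and g': "arc_length_parametrization g' L' C"
  shows "L \<le> L'"
proof (rule field_le_epsilon)
  fix e :: real assume e: "e > 0"
  have L: "0 < L" "0 < L'" using g g' by (auto simp: arc_length_parametrization_def)
  \<comment> \<open>The arc stops short of \<open>L\<close>, where the curve closes up, at the cost
    of \<open>e\<close>.\<close>
  let ?t = "max 0 (L - e)"
  have "ennreal (?t - 0) \<le> arc_measure g' L' (g ` {0..?t})"
    using L e by (intro arc_measure_arc_ge_length[OF g g']) auto
  then have "ennreal (?t - 0) \<le> ennreal L'"
    using arc_measure_le_length by (rule order_trans)
  then show "L \<le> L' + e" using L by (simp add: ennreal_le_iff)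
qed

text \<open>The transition map between two parametrizations pushes Lebesgue measure to a measure that
  dominates length on every interval; equal total masses then force equality.\<close>

lemma arc_measure_unique:
  assumes g: "arc_length_parametrization g L C" and g': "arc_length_parametrization g' L' C"
    and E: "E \<in> sets borel"
  shows "arc_measure g L E = arc_measure g' L' E"
proof -
  have LL: "L' = L" using arc_length_le[OF g g'] arc_length_le[OF g' g] by simp
  have L: "0 < L" and im: "g ` {0..L} = C" and im': "g' ` {0..L} = C" and inj: "inj_on g {0..<L}" and per: "g L = g 0"
    using g g' LL by (auto simp: arc_length_parametrization_def)
  have im0: "g ` {0..<L} = C"
  proof -
    have "{0..L} = insert L {0..<L}" using L by auto
    then have "C = insert (g 0) (g ` {0..<L})" using im per by (metis image_insert)
    then show ?thesis using L by (simp add: insert_absorb)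
  qed
  \<comment> \<open>The transition map between the parametrizations; on the half-open interval
    \<open>g\<close> is injective, so the closing point gets the parameter \<open>0\<close>.\<close>
  define j where "j s = inv_into {0..<L} g (g' s)" for s
  have j: "j s \<in> {0..<L}" "g (j s) = g' s" if "s \<in> {0..L}" for s
  proof -
    have "g' s \<in> g ` {0..<L}" using that im' im0 by auto
    then show "j s \<in> {0..<L}" "g (j s) = g' s" unfolding j_def by (rule inv_into_into, rule f_inv_into_f)
  qed
  have j_arc: "{s \<in> {0..L}. a \<le> j s \<and> j s \<le> b} = {s \<in> {0..L}. g' s \<in> g ` {a..b}}" if ab: "0 \<le> a" "b < L" for a b
  proof -
    have "a \<le> j s \<and> j s \<le> b \<longleftrightarrow> g' s \<in> g ` {a..b}" if s: "s \<in> {0..L}" for s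
    proof
      assume "g' s \<in> g ` {a..b}"
      then obtain x where x: "x \<in> {a..b}" "g x = g (j s)" using j(2)[OF s] by auto
      then have "x = j s" using inj_onD[OF inj x(2)] j(1)[OF s] ab by auto
      then show "a \<le> j s \<and> j s \<le> b" using x by auto
    next
      assume "a \<le> j s \<and> j s \<le> b"
      then show "g' s \<in> g ` {a..b}" using j(2)[OF s] by (metis atLeastAtMost_iff imageI)
    qed
    then show ?thesis by auto
  qed
  have arc_borel: "g ` {a..b} \<in> sets borel" if "0 \<le> a" "b < L" for a b
  proof -
    have "continuous_on {a..b} g"
      using continuous_on_subset[OF arc_length_parametrization_continuous[OF g]] that by simp
    from compact_continuous_image[OF this] show ?thesis by (simp add: borel_closed compact_imp_closed)
  qed
  let ?M = "restrict_space lborel {0..L} :: real measure"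
  \<comment> \<open>The nontrivial sublevel sets of \<open>j\<close> are preimages under
    \<open>g'\<close> of compact arcs.\<close>
  have jm: "j \<in> borel_measurable ?M"
  proof (rule borel_measurableI_le)
    fix y
    consider "y < 0" | "0 \<le> y" "y < L" | "L \<le> y" by linarith
    then have "{s \<in> {0..L}. j s \<le> y} \<in> sets borel"
    proof cases
      case 1
      then have "{s \<in> {0..L}. j s \<le> y} = {}" using j(1) by fastforce
      then show ?thesis by (simp only: sets.empty_sets)
    next
      case 2
      have "{s \<in> {0..L}. j s \<le> y} = {s \<in> {0..L}. 0 \<le> j s \<and> j s \<le> y}" using j(1) by auto
      also have "\<dots> = {s \<in> {0..L}. g' s \<in> g ` {0..y}}" using 2 by (intro j_arc) auto
      finally show ?thesis
        using arc_length_parametrization_vimage_borel[OF g' arc_borel[OF order_refl 2(2)]] LL by simp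
    next
      case 3
      then have "{s \<in> {0..L}. j s \<le> y} = {0..L}" using j(1) by fastforce
      then show ?thesis by (simp only: atLeastAtMost_borel)
    qed
    then show "{s \<in> space ?M. j s \<le> y} \<in> sets ?M"
      by (auto simp: sets_restrict_space_iff space_restrict_space)
  qed
  define \<nu> where "\<nu> = distr ?M borel j"
  define \<mu> where "\<mu> = distr ?M borel (\<lambda>s. s)"
  have idm: "(\<lambda>s. s) \<in> borel_measurable ?M" by (intro measurable_restrict_space1) simp
  have \<nu>: "emeasure \<nu> A = emeasure lborel {s \<in> {0..L}. j s \<in> A}" if "A \<in> sets borel" for A
  proof -
    have "j -` A \<inter> space ?M = {s \<in> {0..L}. j s \<in> A}" by (auto simp: space_restrict_space)
    then have "emeasure \<nu> A = emeasure ?M {s \<in> {0..L}. j s \<in> A}"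
      unfolding \<nu>_def using that jm by (subst emeasure_distr) auto
    also have "\<dots> = emeasure lborel {s \<in> {0..L}. j s \<in> A}" by (rule emeasure_restrict_space) auto
    finally show ?thesis .
  qed
  have \<mu>: "emeasure \<mu> A = emeasure lborel {s \<in> {0..L}. s \<in> A}" if "A \<in> sets borel" for A
  proof -
    have "(\<lambda>s. s) -` A \<inter> space ?M = {s \<in> {0..L}. s \<in> A}" by (auto simp: space_restrict_space)
    then have "emeasure \<mu> A = emeasure ?M {s \<in> {0..L}. s \<in> A}"
      unfolding \<mu>_def using that idm by (subst emeasure_distr) auto
    also have "\<dots> = emeasure lborel {s \<in> {0..L}. s \<in> A}" by (rule emeasure_restrict_space) auto
    finally show ?thesis .
  qed
  have total: "emeasure \<nu> UNIV = ennreal L" 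
  proof -
    have "{s \<in> {0..L}. j s \<in> UNIV} = {0..L}" by auto
    then show ?thesis using \<nu>[of UNIV] L by (simp only: emeasure_lborel_Icc) simp
  qed
  have fin: "emeasure \<nu> A < \<infinity>" for A
    using emeasure_mono[of A UNIV \<nu>] total by (auto simp: \<nu>_def intro: le_less_trans)
  have \<nu>_arc: "ennreal (b - a) \<le> emeasure \<nu> {a..b}" if "0 \<le> a" "b < L" for a b
  proof (cases "a \<le> b")
    case True
    then show ?thesis
      using arc_measure_arc_ge_length[OF g g', of a b] j_arc[of a b] that LL by (simp add: \<nu> arc_measure_def)
  qed (simp add: ennreal_neg)
  have "\<nu> = \<mu>"
  proof (rule measure_eqI_lessThan)
    show "sets \<nu> = sets borel" "sets \<mu> = sets borel" by (auto simp: \<nu>_def \<mu>_def)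
    show "emeasure \<nu> {x<..} < \<infinity>" for x by (rule fin)
    fix x
    consider "x < 0" | "0 \<le> x" "x < L" | "L \<le> x" by linarith
    then show "emeasure \<nu> {x<..} = emeasure \<mu> {x<..}"
    proof cases
      case 1
      then have "{s \<in> {0..L}. j s \<in> {x<..}} = {s \<in> {0..L}. s \<in> {x<..}}" using j(1) by fastforce
      then show ?thesis by (simp add: \<nu> \<mu>)
    next
      case 3
      then have "{s \<in> {0..L}. j s \<in> {x<..}} = {s \<in> {0..L}. s \<in> {x<..}}" using j(1) by fastforce
      then show ?thesis by (simp add: \<nu> \<mu>)
    next
      case 2
      have "{s \<in> {0..L}. s \<in> {x<..}} = {x<..L}" using 2 by auto
      then have m: "emeasure \<mu> {x<..} = ennreal (L - x)" using 2 by (simp add: \<mu>)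
      have ge: "ennreal (L - x) \<le> emeasure \<nu> {x<..}"
      proof (rule ennreal_le_epsilon)
        fix e :: real assume "e > 0"
        \<comment> \<open>Shrinking by \<open>e / 2\<close> at both ends gives a closed interval
          inside \<open>{x<..}\<close> that ends before \<open>L\<close>, as
          \<open>\<nu>_arc\<close> requires.\<close>
        have "ennreal (L - x) \<le> ennreal ((L - e / 2) - (x + e / 2)) + ennreal e"
          using \<open>e > 0\<close> by (cases "(L - e / 2) - (x + e / 2) \<ge> 0") (auto simp: ennreal_neg simp flip: ennreal_plus intro!: ennreal_leI)
        also have "ennreal ((L - e / 2) - (x + e / 2)) \<le> emeasure \<nu> {x + e / 2..L - e / 2}"
          using 2 \<open>e > 0\<close> by (intro \<nu>_arc) auto
        also have "\<dots> \<le> emeasure \<nu> {x<..}" using \<open>e > 0\<close> by (intro emeasure_mono) (auto simp: \<nu>_def)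
        finally show "ennreal (L - x) \<le> emeasure \<nu> {x<..} + ennreal e" by (simp add: add_right_mono)
      qed
      \<comment> \<open>The upper bound comes from the complement: \<open>{..x}\<close> has mass at
        least \<open>x\<close>, and the total mass is \<open>L\<close>.\<close>
      have "ennreal x + emeasure \<nu> {x<..} \<le> emeasure \<nu> {..x} + emeasure \<nu> {x<..}"
      proof (rule add_right_mono)
        have "ennreal (x - 0) \<le> emeasure \<nu> {0..x}" using 2 by (intro \<nu>_arc) auto
        also have "\<dots> \<le> emeasure \<nu> {..x}" by (intro emeasure_mono) (auto simp: \<nu>_def)
        finally show "ennreal x \<le> emeasure \<nu> {..x}" by simp
      qed
      also have "\<dots> = emeasure \<nu> ({..x} \<union> {x<..})" by (rule plus_emeasure) (auto simp: \<nu>_def)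
      also have "{..x} \<union> {x<..} = UNIV" by auto
      also have "emeasure \<nu> UNIV = ennreal x + ennreal (L - x)" using total 2 by (simp flip: ennreal_plus)
      finally have "emeasure \<nu> {x<..} \<le> ennreal (L - x)"
        by (subst (asm) ennreal_add_left_cancel_le) auto
      then show ?thesis using ge m by (intro antisym) auto
    qed
  qed
  let ?B = "{s \<in> {0..L}. g s \<in> E} \<inter> {..<L}"
  have B: "?B \<in> sets borel" using arc_length_parametrization_vimage_borel[OF g E] by auto
  have "arc_measure g' L' E = emeasure lborel {s \<in> {0..L}. j s \<in> ?B}"
    unfolding arc_measure_def LL using j by (intro arg_cong[where f="emeasure lborel"]) fastforce
  also have "\<dots> = emeasure \<mu> ?B" using \<nu>[OF B] \<open>\<nu> = \<mu>\<close> by simp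
  also have "\<dots> = emeasure lborel ?B" unfolding \<mu>[OF B] by (intro arg_cong[where f="emeasure lborel"]) auto
  also have "\<dots> = arc_measure g L E"
    unfolding arc_measure_def
  proof (rule emeasure_eq_AE)
    have "AE x in lborel. x \<noteq> L" by (rule AE_lborel_singleton)
    then show "AE x in lborel. x \<in> ?B \<longleftrightarrow> x \<in> {s \<in> {0..L}. g s \<in> E}" by eventually_elim auto
  qed (use B arc_length_parametrization_vimage_borel[OF g E] in auto)
  finally show ?thesis by simp
qed

text \<open>The reflected parametrization is another parametrization of the same curve by arc
  length, so uniqueness applies.\<close>

lemma arc_measure_reflect:
  assumes g: "arc_length_parametrization g L C" and C: "\<And>p. p \<in> C \<Longrightarrow> d - p \<in> C" and E: "E \<in> sets borel"
  shows "arc_measure g L {p. d - p \<in> E} = arc_measure g L E"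
proof -
  have "arc_length_parametrization (\<lambda>s. d - g s) L C"
    unfolding arc_length_parametrization_def
  proof (intro conjI allI impI)
    have "(\<lambda>s. d - g s) ` {0..L} = (\<lambda>p. d - p) ` C"
      using g by (auto simp: arc_length_parametrization_def)
    also have "\<dots> = C" using C by (force intro: image_eqI[where x="d - _"])
    finally show "(\<lambda>s. d - g s) ` {0..L} = C" .
    show "curve_length (\<lambda>s. d - g s) s t = ennreal (t - s)" if "0 \<le> s \<and> s \<le> t \<and> t \<le> L" for s t
      using g that unfolding arc_length_parametrization_def curve_length_def by (simp add: dist_norm norm_minus_commute)
  qed (use g in \<open>auto simp: arc_length_parametrization_def inj_on_def\<close>)
  from arc_measure_unique[OF g this E] show ?thesis by (simp add: arc_measure_def)
qed

subsection \<open>Moments of symmetric random variables\<close>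

lemma abs_powr_convex:
  fixes n :: real
  assumes "n \<ge> 1" "\<alpha> \<ge> 0" "\<beta> \<ge> 0" "\<alpha> + \<beta> = 1"
  shows "\<bar>\<alpha> * x + \<beta> * y\<bar> powr n \<le> \<alpha> * \<bar>x\<bar> powr n + \<beta> * \<bar>y\<bar> powr n"
proof -
  \<comment> \<open>For the case that one argument is \<open>0\<close>: there the claim reduces to
    \<open>\<beta> powr n \<le> \<beta>\<close> or the same for \<open>\<alpha>\<close>.\<close>
  have le_self: "t powr n \<le> t" if "0 \<le> t" "t \<le> 1" for t :: real
    using powr_mono'[of 1 n t] that assms(1) by simp
  have pos: "(\<alpha> * x + \<beta> * y) powr n \<le> \<alpha> * x powr n + \<beta> * y powr n" if xy: "x \<ge> 0" "y \<ge> 0" for x y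
  proof -
    consider "x = 0" | "y = 0" | "x > 0 \<and> y > 0" using xy by linarith
    then show ?thesis
    proof cases
      case 1
      then show ?thesis using le_self[of \<beta>] assms xy by (simp add: powr_mult mult_right_mono)
    next
      case 2
      then show ?thesis using le_self[of \<alpha>] assms xy by (simp add: powr_mult mult_right_mono)
    next
      case 3
      then show ?thesis
        using convex_onD[OF powr_convex[OF assms(1)], of \<beta> x y] assms by (simp add: eq_diff_eq[symmetric])
    qed
  qed
  have "\<bar>\<alpha> * x + \<beta> * y\<bar> \<le> \<alpha> * \<bar>x\<bar> + \<beta> * \<bar>y\<bar>"
    using abs_triangle_ineq[of "\<alpha> * x" "\<beta> * y"] assms by (simp add: abs_mult)
  then have "\<bar>\<alpha> * x + \<beta> * y\<bar> powr n \<le> (\<alpha> * \<bar>x\<bar> + \<beta> * \<bar>y\<bar>) powr n"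
    using assms(1) by (intro powr_mono2) auto
  also have "\<dots> \<le> \<alpha> * \<bar>x\<bar> powr n + \<beta> * \<bar>y\<bar> powr n" by (rule pos) auto
  finally show ?thesis .
qed

definition sym_powr :: "real \<Rightarrow> real \<Rightarrow> real \<Rightarrow> real" where
  "sym_powr n s t = \<bar>s - t\<bar> powr n + \<bar>s + t\<bar> powr n"

lemma sym_powr_nonneg: "0 \<le> sym_powr n s t"
  by (simp add: sym_powr_def)

lemma sym_powr_commute: "sym_powr n s t = sym_powr n t s"
  by (simp add: sym_powr_def abs_minus_commute add.commute)

text \<open>The function is even and convex in \<open>s\<close>, and \<open>s\<close> is a convex
  combination of \<open>s'\<close> and \<open>-s'\<close>.\<close>

lemma sym_powr_mono:
  assumes "n \<ge> 1" "\<bar>s\<bar> \<le> \<bar>s'\<bar>"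
  shows "sym_powr n s t \<le> sym_powr n s' t"
proof (cases "s' = 0")
  case False
  define \<alpha> where "\<alpha> = (s' + s) / (2 * s')"
  have \<alpha>: "0 \<le> \<alpha>" "0 \<le> 1 - \<alpha>"
    using False assms(2) by (auto simp: \<alpha>_def divide_simps abs_real_def split: if_splits)
  have s: "s = \<alpha> * s' + (1 - \<alpha>) * (- s')" using False by (simp add: \<alpha>_def field_simps)
  have 1: "s - t = \<alpha> * (s' - t) + (1 - \<alpha>) * (- s' - t)" "s + t = \<alpha> * (s' + t) + (1 - \<alpha>) * (- s' + t)"
    by (subst s, simp add: algebra_simps)+
  have a: "\<bar>- s' - t\<bar> = \<bar>s' + t\<bar>" "\<bar>- s' + t\<bar> = \<bar>s' - t\<bar>" by auto
  have "\<bar>s - t\<bar> powr n \<le> \<alpha> * \<bar>s' - t\<bar> powr n + (1 - \<alpha>) * \<bar>s' + t\<bar> powr n"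
    unfolding 1(1) a(1)[symmetric] by (rule abs_powr_convex) (use assms \<alpha> in auto)
  moreover have "\<bar>s + t\<bar> powr n \<le> \<alpha> * \<bar>s' + t\<bar> powr n + (1 - \<alpha>) * \<bar>s' - t\<bar> powr n"
    unfolding 1(2) a(2)[symmetric] by (rule abs_powr_convex) (use assms \<alpha> in auto)
  ultimately show ?thesis unfolding sym_powr_def by (simp add: algebra_simps)
qed (use assms in simp)

lemma sym_powr_continuous: "n \<ge> 1 \<Longrightarrow> continuous_on UNIV (\<lambda>s. sym_powr n s t)"
  unfolding sym_powr_def by (intro continuous_on_add continuous_on_powr' continuous_intros) auto

text \<open>By the layer cake formula it suffices to compare superlevel sets of
  \<open>\<phi>\<close>. They depend only on \<open>\<bar>s\<bar>\<close> and are upward closed in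
  it, so by continuity each is empty, the whole line or an open tail.\<close>

lemma nn_integral_mono_tails:
  fixes A B :: "real measure" and \<phi> :: "real \<Rightarrow> real"
  assumes "prob_space A" "prob_space B" and [measurable_cong]: "sets A = sets borel" "sets B = sets borel"
    and tail: "\<And>\<tau>. \<tau> > 0 \<Longrightarrow> emeasure B {s. \<tau> < \<bar>s\<bar>} \<le> emeasure A {s. \<tau> < \<bar>s\<bar>}"
    and cont: "continuous_on UNIV \<phi>" and nonneg: "\<And>s. 0 \<le> \<phi> s"
    and mono: "\<And>s s'. \<bar>s\<bar> \<le> \<bar>s'\<bar> \<Longrightarrow> \<phi> s \<le> \<phi> s'"
  shows "(\<integral>\<^sup>+s. ennreal (\<phi> s) \<partial>B) \<le> (\<integral>\<^sup>+s. ennreal (\<phi> s) \<partial>A)"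
proof -
  interpret A: prob_space A by fact
  interpret B: prob_space B by fact
  have spA: "space A = UNIV" "space B = UNIV"
    using sets_eq_imp_space_eq[of A borel] sets_eq_imp_space_eq[of B borel] assms(3,4) by auto
  have [measurable]: "\<phi> \<in> borel_measurable borel" by (rule borel_measurable_continuous_onI[OF cont])
  have layer: "(\<integral>\<^sup>+s. ennreal (\<phi> s) \<partial>M) = (\<integral>\<^sup>+t. emeasure M {s. t < \<phi> s} * indicator {0..} t \<partial>lborel)"
    if "prob_space M" and [measurable_cong]: "sets M = sets borel" for M
  proof -
    interpret M: prob_space M by fact
    interpret pair_sigma_finite M lborel ..
    have sp: "space M = UNIV" using sets_eq_imp_space_eq[OF that(2)] by simp
    have "(\<integral>\<^sup>+s. ennreal (\<phi> s) \<partial>M) = (\<integral>\<^sup>+s. \<integral>\<^sup>+t. indicator {0..<\<phi> s} t \<partial>lborel \<partial>M)"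
      using nonneg by (intro nn_integral_cong) simp
    also have "\<dots> = (\<integral>\<^sup>+s. \<integral>\<^sup>+t. indicator {s. t < \<phi> s} s * indicator {0..} t \<partial>lborel \<partial>M)"
      by (intro nn_integral_cong) (auto split: split_indicator)
    also have "\<dots> = (\<integral>\<^sup>+t. \<integral>\<^sup>+s. indicator {s. t < \<phi> s} s * indicator {0..} t \<partial>M \<partial>lborel)"
    proof (rule Fubini'[symmetric])
      have "(\<lambda>(s, t). indicator {p. snd p < \<phi> (fst p)} (s, t) * indicator {0..} t :: ennreal) \<in> borel_measurable (M \<Otimes>\<^sub>M lborel)"
        by measurable
      then show "(\<lambda>(s, t). indicator {s. t < \<phi> s} s * indicator {0..} t :: ennreal) \<in> borel_measurable (M \<Otimes>\<^sub>M lborel)"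
        by (simp add: indicator_def)
    qed
    also have "\<dots> = (\<integral>\<^sup>+t. emeasure M {s. t < \<phi> s} * indicator {0..} t \<partial>lborel)"
      by (intro nn_integral_cong) (simp add: nn_integral_multc)
    finally show ?thesis .
  qed
  have "emeasure B {s. t < \<phi> s} \<le> emeasure A {s. t < \<phi> s}" for t
  proof (cases "t < \<phi> 0")
    case True
    then have "{s. t < \<phi> s} = UNIV" using mono[of 0] by (auto intro: less_le_trans)
    then show ?thesis using A.emeasure_space_1 B.emeasure_space_1 spA by simp
  next
    case False
    show ?thesis
    proof (cases "{s. t < \<phi> s} = {}")
      case True
      then show ?thesis by simp
    next
      case ne: False
      let ?P = "{s. t < \<phi> s} \<inter> {0..}"
      have abs: "\<phi> \<bar>s\<bar> = \<phi> s" for s using mono[of s "\<bar>s\<bar>"] mono[of "\<bar>s\<bar>" s] by simp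
      have neP: "?P \<noteq> {}" using ne abs by (metis (mono_tags, lifting) Int_iff abs_ge_zero atLeast_iff empty_iff equals0I mem_Collect_eq)
      have bdd: "bdd_below ?P" by (rule bdd_belowI[of _ 0]) auto
      define \<tau> where "\<tau> = Inf ?P"
      have "\<tau> \<ge> 0" unfolding \<tau>_def by (rule cInf_greatest[OF neP]) auto
      have not: "\<not> t < \<phi> \<tau>"
      proof
        assume *: "t < \<phi> \<tau>"
        then have "\<tau> \<noteq> 0" using False by auto
        then have "\<tau> > 0" using \<open>\<tau> \<ge> 0\<close> by simp
        have "open {s. t < \<phi> s}" by (intro open_Collect_less cont continuous_intros)
        then obtain e where e: "e > 0" "\<And>s. dist s \<tau> < e \<Longrightarrow> t < \<phi> s"
          using * by (auto simp: open_dist)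
        define s where "s = \<tau> - min (e/2) \<tau>"
        have s: "s < \<tau>" "s \<ge> 0" "dist s \<tau> < e" using e(1) \<open>\<tau> > 0\<close> by (auto simp: s_def dist_real_def min_def)
        then have "s \<in> ?P" using e(2)[OF s(3)] by simp
        then have "\<tau> \<le> s" unfolding \<tau>_def by (rule cInf_lower[OF _ bdd])
        then show False using s by simp
      qed
      \<comment> \<open>\<open>\<tau>\<close> may be \<open>0\<close>, where the hypothesis on tails
        says nothing; the open tail is therefore exhausted by tails at positive levels.\<close>
      have eq: "{s. t < \<phi> s} = (\<Union>k::nat. {s. \<tau> + 1 / real (Suc k) < \<bar>s\<bar>})"
      proof (intro set_eqI iffI)
        fix s assume "s \<in> {s. t < \<phi> s}"
        then have s: "t < \<phi> s" by simp
        have "\<not> \<bar>s\<bar> \<le> \<tau>" using mono[of s \<tau>] \<open>\<tau> \<ge> 0\<close> s not by auto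
        then have "0 < \<bar>s\<bar> - \<tau>" by simp
        then obtain k where "inverse (real (Suc k)) < \<bar>s\<bar> - \<tau>" using reals_Archimedean by blast
        then show "s \<in> (\<Union>k::nat. {s. \<tau> + 1 / real (Suc k) < \<bar>s\<bar>})"
          by (auto simp: inverse_eq_divide intro!: exI[of _ k])
      next
        fix s assume "s \<in> (\<Union>k::nat. {s. \<tau> + 1 / real (Suc k) < \<bar>s\<bar>})"
        then obtain k :: nat where "\<tau> + 1 / real (Suc k) < \<bar>s\<bar>" by auto
        then have "\<tau> < \<bar>s\<bar>" by (rule less_trans[rotated]) simp
        then obtain r where "r \<in> ?P" "r < \<bar>s\<bar>" unfolding \<tau>_def using cInf_lessD[OF neP] by blast
        then show "s \<in> {s. t < \<phi> s}" using mono[of r s] by auto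
      qed
      have inc: "incseq (\<lambda>k. {s. \<tau> + 1 / real (Suc k) < \<bar>s\<bar>})"
      proof (rule incseq_SucI, rule subsetI)
        fix k s assume "s \<in> {s. \<tau> + 1 / real (Suc k) < \<bar>s\<bar>}"
        moreover have "1 / real (Suc (Suc k)) \<le> 1 / real (Suc k)" by (simp add: frac_le)
        ultimately show "s \<in> {s. \<tau> + 1 / real (Suc (Suc k)) < \<bar>s\<bar>}" by auto
      qed
      have "emeasure B {s. t < \<phi> s} = (SUP k. emeasure B {s. \<tau> + 1 / real (Suc k) < \<bar>s\<bar>})"
        unfolding eq using inc by (intro SUP_emeasure_incseq[symmetric]) auto
      also have "\<dots> \<le> (SUP k. emeasure A {s. \<tau> + 1 / real (Suc k) < \<bar>s\<bar>})"
        using \<open>\<tau> \<ge> 0\<close> by (intro SUP_mono' tail add_nonneg_pos) auto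
      also have "\<dots> = emeasure A {s. t < \<phi> s}"
        unfolding eq using inc by (intro SUP_emeasure_incseq) auto
      finally show ?thesis .
    qed
  qed
  then show ?thesis
    unfolding layer[OF assms(1,3)] layer[OF assms(2,4)] by (intro nn_integral_mono mult_right_mono) auto
qed

text \<open>Symmetry of \<open>A\<close> allows replacing \<open>s\<close> by \<open>-s\<close>;
  adding both forms yields a kernel that is monotone in \<open>\<bar>s\<bar>\<close>.\<close>

lemma symmetric_moment:
  fixes A :: "real measure"
  assumes [measurable_cong]: "sets A = sets borel" and sym: "distr A borel uminus = A"
  shows "2 * (\<integral>\<^sup>+s. ennreal (\<bar>s - t\<bar> powr n) \<partial>A) = (\<integral>\<^sup>+s. ennreal (sym_powr n s t) \<partial>A)"
proof -
  have "(\<integral>\<^sup>+s. ennreal (\<bar>s - t\<bar> powr n) \<partial>A) = (\<integral>\<^sup>+s. ennreal (\<bar>s - t\<bar> powr n) \<partial>distr A borel uminus)"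
    by (simp add: sym)
  also have "\<dots> = (\<integral>\<^sup>+s. ennreal (\<bar>- s - t\<bar> powr n) \<partial>A)" by (subst nn_integral_distr) auto
  also have "\<dots> = (\<integral>\<^sup>+s. ennreal (\<bar>s + t\<bar> powr n) \<partial>A)"
    by (intro nn_integral_cong arg_cong[where f="\<lambda>z. ennreal (z powr n)"]) linarith
  finally have "2 * (\<integral>\<^sup>+s. ennreal (\<bar>s - t\<bar> powr n) \<partial>A)
      = (\<integral>\<^sup>+s. ennreal (\<bar>s - t\<bar> powr n) \<partial>A) + (\<integral>\<^sup>+s. ennreal (\<bar>s + t\<bar> powr n) \<partial>A)"
    by (simp add: mult_2)
  also have "\<dots> = (\<integral>\<^sup>+s. ennreal (\<bar>s - t\<bar> powr n) + ennreal (\<bar>s + t\<bar> powr n) \<partial>A)"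
    by (intro nn_integral_add[symmetric]) measurable
  finally show ?thesis by (simp add: sym_powr_def ennreal_plus)
qed

text \<open>After symmetrization the kernel is even in each variable and monotone in its absolute
  value, so the two laws are exchanged one at a time, with Fubini in between.\<close>

lemma real_moment_mono:
  fixes A A' B B' :: "real measure"
  assumes p: "prob_space A" "prob_space A'" "prob_space B" "prob_space B'"
    and [measurable_cong]: "sets A = sets borel" "sets A' = sets borel" "sets B = sets borel" "sets B' = sets borel"
    and sym: "distr A borel uminus = A" "distr B borel uminus = B"
    and tail: "\<And>\<tau>. \<tau> > 0 \<Longrightarrow> emeasure B {s. \<tau> < \<bar>s\<bar>} \<le> emeasure A {s. \<tau> < \<bar>s\<bar>}"
    and tail': "\<And>\<tau>. \<tau> > 0 \<Longrightarrow> emeasure B' {s. \<tau> < \<bar>s\<bar>} \<le> emeasure A' {s. \<tau> < \<bar>s\<bar>}"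
    and n: "n \<ge> 1"
  shows "(\<integral>\<^sup>+t. \<integral>\<^sup>+s. ennreal (\<bar>s - t\<bar> powr n) \<partial>B \<partial>B') \<le> (\<integral>\<^sup>+t. \<integral>\<^sup>+s. ennreal (\<bar>s - t\<bar> powr n) \<partial>A \<partial>A')"
proof -
  interpret A: prob_space A by fact
  interpret A': prob_space A' by fact
  interpret B: prob_space B by fact
  interpret B': prob_space B' by fact
  have [measurable]: "(\<lambda>x. sym_powr n (f x) (h x)) \<in> borel_measurable M"
    if [measurable]: "f \<in> borel_measurable M" "h \<in> borel_measurable M" for f h :: "'c \<Rightarrow> real" and M
    unfolding sym_powr_def by measurable
  have two: "2 * (\<integral>\<^sup>+t. \<integral>\<^sup>+s. ennreal (\<bar>s - t\<bar> powr n) \<partial>C \<partial>C') = (\<integral>\<^sup>+t. \<integral>\<^sup>+s. ennreal (sym_powr n s t) \<partial>C \<partial>C')"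
    if C: "prob_space C" and [measurable_cong]: "sets C = sets borel" "sets C' = sets borel"
      and s: "distr C borel uminus = C" for C C'
  proof -
    interpret C: prob_space C by fact
    have "2 * (\<integral>\<^sup>+t. \<integral>\<^sup>+s. ennreal (\<bar>s - t\<bar> powr n) \<partial>C \<partial>C') = (\<integral>\<^sup>+t. 2 * (\<integral>\<^sup>+s. ennreal (\<bar>s - t\<bar> powr n) \<partial>C) \<partial>C')"
      by (rule nn_integral_cmult[symmetric]) measurable
    then show ?thesis by (simp add: symmetric_moment[OF that(2) s])
  qed
  have "2 * (\<integral>\<^sup>+t. \<integral>\<^sup>+s. ennreal (\<bar>s - t\<bar> powr n) \<partial>B \<partial>B') = (\<integral>\<^sup>+t. \<integral>\<^sup>+s. ennreal (sym_powr n s t) \<partial>B \<partial>B')"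
    by (rule two) (use assms in auto)
  also have "\<dots> \<le> (\<integral>\<^sup>+t. \<integral>\<^sup>+s. ennreal (sym_powr n s t) \<partial>A \<partial>B')"
    by (intro nn_integral_mono nn_integral_mono_tails assms sym_powr_continuous sym_powr_nonneg sym_powr_mono)
  also have "\<dots> = (\<integral>\<^sup>+s. \<integral>\<^sup>+t. ennreal (sym_powr n s t) \<partial>B' \<partial>A)"
  proof -
    interpret pair_sigma_finite A B' ..
    show ?thesis by (rule Fubini') measurable
  qed
  also have "\<dots> \<le> (\<integral>\<^sup>+s. \<integral>\<^sup>+t. ennreal (sym_powr n s t) \<partial>A' \<partial>A)"
  proof (intro nn_integral_mono nn_integral_mono_tails assms sym_powr_nonneg)
    show "continuous_on UNIV (sym_powr n s)" for s
      using sym_powr_continuous[OF n, of s] by (simp add: sym_powr_commute[of n _ s])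
    show "sym_powr n s t \<le> sym_powr n s t'" if "\<bar>t\<bar> \<le> \<bar>t'\<bar>" for s t t'
      using sym_powr_mono[OF n that, of s] by (simp add: sym_powr_commute[of n _ s])
  qed
  also have "\<dots> = (\<integral>\<^sup>+t. \<integral>\<^sup>+s. ennreal (sym_powr n s t) \<partial>A \<partial>A')"
  proof -
    interpret pair_sigma_finite A A' ..
    show ?thesis by (rule Fubini'[symmetric]) measurable
  qed
  also have "\<dots> = 2 * (\<integral>\<^sup>+t. \<integral>\<^sup>+s. ennreal (\<bar>s - t\<bar> powr n) \<partial>A \<partial>A')"
    by (rule two[symmetric]) (use assms in auto)
  finally show ?thesis
    by (simp add: ennreal_mult_le_mult_iff)
qed

subsection \<open>Averaging over directions\<close>

lemma nn_integral_periodic_shift: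
  fixes f :: "real \<Rightarrow> ennreal"
  assumes [measurable]: "f \<in> borel_measurable borel" and per: "\<And>x. f (x + p) = f x"
    and a: "0 \<le> a" "a \<le> p"
  shows "(\<integral>\<^sup>+x. f (x - a) * indicator {0..<p} x \<partial>lborel) = (\<integral>\<^sup>+x. f x * indicator {0..<p} x \<partial>lborel)"
proof -
  have "(\<integral>\<^sup>+x. f (x - a) * indicator {0..<p} x \<partial>lborel) = (\<integral>\<^sup>+x. f x * indicator {0..<p} (a + x) \<partial>lborel)"
    by (subst nn_integral_real_affine[where c = 1 and t = a]) auto
  also have "\<dots> = (\<integral>\<^sup>+x. f x * indicator {-a..<0} x + f x * indicator {0..<p - a} x \<partial>lborel)"
    using a by (intro nn_integral_cong) (auto split: split_indicator)
  also have "\<dots> = (\<integral>\<^sup>+x. f x * indicator {-a..<0} x \<partial>lborel) + (\<integral>\<^sup>+x. f x * indicator {0..<p - a} x \<partial>lborel)"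
    by (intro nn_integral_add) auto
  also have "(\<integral>\<^sup>+x. f x * indicator {-a..<0} x \<partial>lborel) = (\<integral>\<^sup>+x. f (x - p) * indicator {-a..<0} (x - p) \<partial>lborel)"
    by (subst nn_integral_real_affine[where c = 1 and t = "-p"]) auto
  also have "\<dots> = (\<integral>\<^sup>+x. f x * indicator {p - a..<p} x \<partial>lborel)"
    using per[of "_ - p"] by (intro nn_integral_cong) (auto split: split_indicator)
  also have "\<dots> + (\<integral>\<^sup>+x. f x * indicator {0..<p - a} x \<partial>lborel)
      = (\<integral>\<^sup>+x. f x * indicator {p - a..<p} x + f x * indicator {0..<p - a} x \<partial>lborel)"
    by (intro nn_integral_add[symmetric]) auto
  also have "\<dots> = (\<integral>\<^sup>+x. f x * indicator {0..<p} x \<partial>lborel)"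
    using a by (intro nn_integral_cong) (auto split: split_indicator)
  finally show ?thesis .
qed

definition dir :: "real \<Rightarrow> real^2" where
  "dir \<theta> = cos \<theta> *\<^sub>R axis 1 1 + sin \<theta> *\<^sub>R axis 2 1"

lemma dir_inner: "dir \<theta> \<bullet> w = cos \<theta> * w$1 + sin \<theta> * w$2"
  by (simp add: dir_def inner_add_left inner_axis' )

lemma norm_dir: "norm (dir \<theta>) = 1"
proof -
  have "dir \<theta> \<bullet> dir \<theta> = 1"
    unfolding dir_inner by (simp add: dir_def axis_def flip: power2_eq_square)
  then show ?thesis by (simp add: norm_eq_1)
qed

lemma dir_measurable [measurable]: "dir \<in> borel_measurable borel"
  unfolding dir_def by measurable

text \<open>The normalizing constant of the average over directions; it is positive and finite and
  can therefore be cancelled.\<close>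

definition cos_moment :: "real \<Rightarrow> ennreal" where
  "cos_moment n = (\<integral>\<^sup>+\<theta>. ennreal (\<bar>cos \<theta>\<bar> powr n) * indicator {0..<2 * pi} \<theta> \<partial>lborel)"

lemma cos_moment_nonzero: "n \<ge> 0 \<Longrightarrow> cos_moment n \<noteq> 0"
proof -
  assume n: "n \<ge> 0"
  have "0 < ennreal ((1/2) powr n)" by simp
  \<comment> \<open>On \<open>{0..1}\<close> the cosine is at least \<open>1/2\<close>, because
    \<open>1 < pi / 3\<close>.\<close>
  also have "\<dots> = (\<integral>\<^sup>+\<theta>. ennreal ((1/2) powr n) * indicator {0..1} (\<theta>::real) \<partial>lborel)"
    by (subst nn_integral_cmult_indicator) auto
  also have "\<dots> \<le> cos_moment n"
    unfolding cos_moment_def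
  proof (intro nn_integral_mono)
    fix \<theta> :: real
    have "(1/2) powr n \<le> \<bar>cos \<theta>\<bar> powr n" if "\<theta> \<in> {0..1}"
    proof -
      have "cos (pi / 3) \<le> cos \<theta>" using that pi_gt3 by (intro cos_monotone_0_pi_le) auto
      then show ?thesis using n by (intro powr_mono2) (auto simp: cos_60)
    qed
    moreover have "\<theta> \<in> {0..<2 * pi}" if "\<theta> \<in> {0..1}" using that pi_gt3 by auto
    ultimately show "ennreal ((1/2) powr n) * indicator {0..1} \<theta> \<le> ennreal (\<bar>cos \<theta>\<bar> powr n) * indicator {0..<2 * pi} \<theta>"
      by (auto split: split_indicator intro: ennreal_leI)
  qed
  finally show ?thesis by simp
qed

lemma cos_moment_finite: "n \<ge> 0 \<Longrightarrow> cos_moment n < \<top>"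
proof -
  assume n: "n \<ge> 0"
  have "cos_moment n \<le> (\<integral>\<^sup>+\<theta>. 1 * indicator {0..<2 * pi} \<theta> \<partial>lborel)"
    unfolding cos_moment_def
  proof (intro nn_integral_mono mult_right_mono)
    fix \<theta> :: real
    show "ennreal (\<bar>cos \<theta>\<bar> powr n) \<le> 1"
      using powr_mono2[of n "\<bar>cos \<theta>\<bar>" 1] n by (simp add: ennreal_le_1)
  qed simp
  also have "\<dots> = ennreal (2 * pi)" by (subst nn_integral_cmult_indicator) auto
  also have "\<dots> < \<top>" by simp
  finally show ?thesis .
qed

text \<open>If \<open>w\<close> has polar angle \<open>\<alpha>\<close>, the inner product is
  \<open>norm w * cos (\<theta> - \<alpha>)\<close>, and the phase disappears over a full
  period.\<close>

lemma directional_average: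
  assumes n: "n \<ge> 1"
  shows "(\<integral>\<^sup>+\<theta>. ennreal (\<bar>dir \<theta> \<bullet> w\<bar> powr n) * indicator {0..<2 * pi} \<theta> \<partial>lborel)
    = ennreal (norm w powr n) * cos_moment n"
proof (cases "w = 0")
  case False
  define r where "r = norm w"
  have r: "r > 0" using False by (simp add: r_def)
  have "(w$1)\<^sup>2 + (w$2)\<^sup>2 = r\<^sup>2"
    using power2_norm_eq_inner[of w] by (simp add: r_def inner_real2 power2_eq_square)
  then have "(w$1 / r)\<^sup>2 + (w$2 / r)\<^sup>2 = 1"
    using r by (simp add: power_divide add_divide_distrib[symmetric])
  then obtain \<alpha> where \<alpha>: "0 \<le> \<alpha>" "\<alpha> < 2 * pi" "w$1 / r = cos \<alpha>" "w$2 / r = sin \<alpha>"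
    by (rule sincos_total_2pi)
  then have w: "w$1 = r * cos \<alpha>" "w$2 = r * sin \<alpha>" using r by (auto simp: field_simps)
  have "\<bar>dir \<theta> \<bullet> w\<bar> powr n = r powr n * \<bar>cos (\<theta> - \<alpha>)\<bar> powr n" for \<theta>
  proof -
    have "dir \<theta> \<bullet> w = r * cos (\<theta> - \<alpha>)" unfolding dir_inner w by (simp add: cos_diff algebra_simps)
    then show ?thesis using r by (simp add: abs_mult powr_mult)
  qed
  then have "(\<integral>\<^sup>+\<theta>. ennreal (\<bar>dir \<theta> \<bullet> w\<bar> powr n) * indicator {0..<2 * pi} \<theta> \<partial>lborel)
      = (\<integral>\<^sup>+\<theta>. ennreal (r powr n) * (ennreal (\<bar>cos (\<theta> - \<alpha>)\<bar> powr n) * indicator {0..<2 * pi} \<theta>) \<partial>lborel)"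
    by (simp add: ennreal_mult mult.assoc)
  also have "\<dots> = ennreal (r powr n) * (\<integral>\<^sup>+\<theta>. ennreal (\<bar>cos (\<theta> - \<alpha>)\<bar> powr n) * indicator {0..<2 * pi} \<theta> \<partial>lborel)"
    by (rule nn_integral_cmult) measurable
  also have "(\<integral>\<^sup>+\<theta>. ennreal (\<bar>cos (\<theta> - \<alpha>)\<bar> powr n) * indicator {0..<2 * pi} \<theta> \<partial>lborel) = cos_moment n"
    unfolding cos_moment_def using \<alpha>
    by (intro nn_integral_periodic_shift[where f = "\<lambda>x. ennreal (\<bar>cos x\<bar> powr n)"]) auto
  finally show ?thesis by (simp add: r_def)
qed (use n in simp)

text \<open>The point \<open>c\<close> cancels in the difference. It is inserted because the
  projections of laws symmetric about \<open>c\<close> then become symmetric about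
  \<open>0\<close>.\<close>

lemma moment_directional:
  fixes P P' :: "(real^2) measure"
  assumes "prob_space P" "prob_space P'" and [measurable_cong]: "sets P = sets borel" "sets P' = sets borel"
    and n: "n \<ge> 1"
  shows "cos_moment n * (\<integral>\<^sup>+q. \<integral>\<^sup>+p. ennreal (dist p q powr n) \<partial>P \<partial>P')
    = (\<integral>\<^sup>+\<theta>. (\<integral>\<^sup>+q. \<integral>\<^sup>+p. ennreal (\<bar>dir \<theta> \<bullet> (p - c) - dir \<theta> \<bullet> (q - c)\<bar> powr n) \<partial>P \<partial>P') * indicator {0..<2 * pi} \<theta> \<partial>lborel)"
proof -
  interpret P: prob_space P by fact
  interpret P': prob_space P' by fact
  interpret LP: pair_sigma_finite lborel P ..
  interpret LP': pair_sigma_finite lborel P' ..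
  let ?F = "\<lambda>\<theta> p q. ennreal (\<bar>dir \<theta> \<bullet> (p - c) - dir \<theta> \<bullet> (q - c)\<bar> powr n) * indicator {0..<2 * pi} \<theta>"
  have "cos_moment n * (\<integral>\<^sup>+q. \<integral>\<^sup>+p. ennreal (dist p q powr n) \<partial>P \<partial>P')
      = (\<integral>\<^sup>+q. cos_moment n * (\<integral>\<^sup>+p. ennreal (dist p q powr n) \<partial>P) \<partial>P')"
    by (rule nn_integral_cmult[symmetric]) measurable
  also have "\<dots> = (\<integral>\<^sup>+q. \<integral>\<^sup>+p. cos_moment n * ennreal (dist p q powr n) \<partial>P \<partial>P')"
    by (intro nn_integral_cong nn_integral_cmult[symmetric]) measurable
  also have "\<dots> = (\<integral>\<^sup>+q. \<integral>\<^sup>+p. \<integral>\<^sup>+\<theta>. ?F \<theta> p q \<partial>lborel \<partial>P \<partial>P')"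
    using directional_average[OF n, symmetric] by (simp add: dist_norm mult.commute flip: inner_diff_right)
  also have "\<dots> = (\<integral>\<^sup>+q. \<integral>\<^sup>+\<theta>. \<integral>\<^sup>+p. ?F \<theta> p q \<partial>P \<partial>lborel \<partial>P')"
    by (intro nn_integral_cong LP.Fubini') measurable
  also have "\<dots> = (\<integral>\<^sup>+\<theta>. \<integral>\<^sup>+q. \<integral>\<^sup>+p. ?F \<theta> p q \<partial>P \<partial>P' \<partial>lborel)"
    by (rule LP'.Fubini') measurable
  also have "\<dots> = (\<integral>\<^sup>+\<theta>. (\<integral>\<^sup>+q. \<integral>\<^sup>+p. ennreal (\<bar>dir \<theta> \<bullet> (p - c) - dir \<theta> \<bullet> (q - c)\<bar> powr n) \<partial>P \<partial>P') * indicator {0..<2 * pi} \<theta> \<partial>lborel)"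
    by (intro nn_integral_cong) (auto simp: nn_integral_multc)
  finally show ?thesis .
qed

lemma planar_moment_mono:
  fixes P P' Q Q' :: "(real^2) measure"
  assumes p: "prob_space P" "prob_space P'" "prob_space Q" "prob_space Q'"
    and s[measurable_cong]: "sets P = sets borel" "sets P' = sets borel" "sets Q = sets borel" "sets Q' = sets borel"
    and sym: "distr P borel (\<lambda>p. 2 *\<^sub>R c - p) = P" "distr Q borel (\<lambda>p. 2 *\<^sub>R c - p) = Q"
    and tail: "\<And>u \<tau>. norm u = 1 \<Longrightarrow> \<tau> > 0 \<Longrightarrow> emeasure Q {p. \<tau> < \<bar>u \<bullet> (p - c)\<bar>} \<le> emeasure P {p. \<tau> < \<bar>u \<bullet> (p - c)\<bar>}"
    and tail': "\<And>u \<tau>. norm u = 1 \<Longrightarrow> \<tau> > 0 \<Longrightarrow> emeasure Q' {p. \<tau> < \<bar>u \<bullet> (p - c)\<bar>} \<le> emeasure P' {p. \<tau> < \<bar>u \<bullet> (p - c)\<bar>}"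
    and n: "n \<ge> 1"
  shows "(\<integral>\<^sup>+q. \<integral>\<^sup>+p. ennreal (dist p q powr n) \<partial>Q \<partial>Q') \<le> (\<integral>\<^sup>+q. \<integral>\<^sup>+p. ennreal (dist p q powr n) \<partial>P \<partial>P')"
proof -
  define x where "x \<theta> p = dir \<theta> \<bullet> (p - c)" for \<theta> p
  have [measurable]: "x \<theta> \<in> borel_measurable borel" for \<theta> unfolding x_def by measurable
  have tl: "emeasure (distr R borel (x \<theta>)) {s. \<tau> < \<bar>s\<bar>} = emeasure R {p. \<tau> < \<bar>dir \<theta> \<bullet> (p - c)\<bar>}"
    if [measurable_cong]: "sets R = sets borel" for R \<theta> \<tau>
  proof -
    have "space R = UNIV" using sets_eq_imp_space_eq[OF that] by simp
    then show ?thesis by (subst emeasure_distr) (auto simp: x_def vimage_def)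
  qed
  have sm: "distr (distr R borel (x \<theta>)) borel uminus = distr R borel (x \<theta>)"
    if [measurable_cong]: "sets R = sets borel" and R: "distr R borel (\<lambda>p. 2 *\<^sub>R c - p) = R" for R \<theta>
  proof -
    have "distr R borel (x \<theta>) = distr (distr R borel (\<lambda>p. 2 *\<^sub>R c - p)) borel (x \<theta>)" by (simp add: R)
    also have "\<dots> = distr R borel (x \<theta> \<circ> (\<lambda>p. 2 *\<^sub>R c - p))" by (rule distr_distr) measurable
    also have "x \<theta> \<circ> (\<lambda>p. 2 *\<^sub>R c - p) = uminus \<circ> x \<theta>"
      by (auto simp: x_def inner_diff_right scaleR_2 inner_add_right)
    also have "distr R borel (uminus \<circ> x \<theta>) = distr (distr R borel (x \<theta>)) borel uminus"
    proof (rule distr_distr[symmetric])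
      show "(uminus :: real \<Rightarrow> real) \<in> borel_measurable borel" by simp
      show "x \<theta> \<in> borel_measurable R" by measurable
    qed
    finally show ?thesis by (rule HOL.sym)
  qed
  have law: "(\<integral>\<^sup>+q. \<integral>\<^sup>+p. ennreal (\<bar>dir \<theta> \<bullet> (p - c) - dir \<theta> \<bullet> (q - c)\<bar> powr n) \<partial>R \<partial>R')
      = (\<integral>\<^sup>+t. \<integral>\<^sup>+s. ennreal (\<bar>s - t\<bar> powr n) \<partial>distr R borel (x \<theta>) \<partial>distr R' borel (x \<theta>))"
    if "prob_space R" and [measurable_cong]: "sets R = sets borel" "sets R' = sets borel" for R R' \<theta>
  proof -
    interpret R: prob_space R by fact
    interpret Rd: prob_space "distr R borel (x \<theta>)" by (rule R.prob_space_distr) measurable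
    have "(\<integral>\<^sup>+t. \<integral>\<^sup>+s. ennreal (\<bar>s - t\<bar> powr n) \<partial>distr R borel (x \<theta>) \<partial>distr R' borel (x \<theta>))
      = (\<integral>\<^sup>+q. \<integral>\<^sup>+s. ennreal (\<bar>s - x \<theta> q\<bar> powr n) \<partial>distr R borel (x \<theta>) \<partial>R')"
      by (rule nn_integral_distr) measurable
    also have "\<dots> = (\<integral>\<^sup>+q. \<integral>\<^sup>+p. ennreal (\<bar>x \<theta> p - x \<theta> q\<bar> powr n) \<partial>R \<partial>R')"
      by (intro nn_integral_cong nn_integral_distr) measurable
    finally show ?thesis by (simp add: x_def)
  qed
  have pd: "prob_space (distr R borel (x \<theta>))" if "prob_space R" "sets R = sets borel" for R \<theta>
    by (rule prob_space.prob_space_distr[OF that(1)]) (simp cong: measurable_cong_sets add: that(2))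
  have "(\<integral>\<^sup>+q. \<integral>\<^sup>+p. ennreal (\<bar>dir \<theta> \<bullet> (p - c) - dir \<theta> \<bullet> (q - c)\<bar> powr n) \<partial>Q \<partial>Q')
      \<le> (\<integral>\<^sup>+q. \<integral>\<^sup>+p. ennreal (\<bar>dir \<theta> \<bullet> (p - c) - dir \<theta> \<bullet> (q - c)\<bar> powr n) \<partial>P \<partial>P')" for \<theta>
    unfolding law[OF p(3) s(3,4)] law[OF p(1) s(1,2)]
    by (rule real_moment_mono) (use n norm_dir in \<open>auto simp: tl s sym intro!: pd p sm tail tail'\<close>)
  then have "cos_moment n * (\<integral>\<^sup>+q. \<integral>\<^sup>+p. ennreal (dist p q powr n) \<partial>Q \<partial>Q')
      \<le> cos_moment n * (\<integral>\<^sup>+q. \<integral>\<^sup>+p. ennreal (dist p q powr n) \<partial>P \<partial>P')"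
    unfolding moment_directional[OF p(1,2) s(1,2) n, of c] moment_directional[OF p(3,4) s(3,4) n, of c]
    by (intro nn_integral_mono mult_right_mono) auto
  then show ?thesis
    using cos_moment_nonzero[of n] cos_moment_finite[of n] n by (subst (asm) ennreal_mult_le_mult_iff) auto
qed

section \<open>Uniform laws on the body and on its boundary, and the inequality\<close>

lemma uniform_wrt_arc_length_emeasure:
  assumes "uniform_wrt_arc_length P C"
  obtains g L where "arc_length_parametrization g L C"
    "\<And>E. E \<in> sets borel \<Longrightarrow> emeasure P E = arc_measure g L E / ennreal L"
proof -
  obtain g L where g: "arc_length_parametrization g L C"
    and P: "P = uniform_measure (distr (restrict_space lborel {0..L}) borel g) C"
    using assms by (auto simp: uniform_wrt_arc_length_def)
  let ?\<mu> = "distr (restrict_space lborel {0..L}) borel g"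
  have im: "g ` {0..L} = C" and L: "0 < L" using g by (auto simp: arc_length_parametrization_def)
  have \<mu>: "emeasure ?\<mu> E = arc_measure g L E" if "E \<in> sets borel" for E
  proof -
    have "emeasure ?\<mu> E = emeasure (restrict_space lborel {0..L}) {s \<in> {0..L}. g s \<in> E}"
      using that arc_length_parametrization_measurable[OF g]
      by (subst emeasure_distr) (auto simp: space_restrict_space vimage_def Int_def conj_commute)
    also have "\<dots> = arc_measure g L E"
      unfolding arc_measure_def by (rule emeasure_restrict_space) auto
    finally show ?thesis .
  qed
  have C: "C \<in> sets borel"
    using arc_length_parametrization_compact[OF g] by (simp add: borel_closed compact_imp_closed)
  have "emeasure P E = arc_measure g L E / ennreal L" if E: "E \<in> sets borel" for E
  proof -
    have "emeasure P E = arc_measure g L (C \<inter> E) / arc_measure g L C"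
      unfolding P using C E by (subst emeasure_uniform_measure) (auto simp: \<mu>)
    also have "arc_measure g L (C \<inter> E) = arc_measure g L E"
      unfolding arc_measure_def using im by (intro arg_cong[where f="emeasure lborel"]) auto
    also have "arc_measure g L C = emeasure lborel {0..L}"
      unfolding arc_measure_def using im by (intro arg_cong[where f="emeasure lborel"]) auto
    finally show ?thesis using L by simp
  qed
  then show ?thesis using that g by blast
qed

lemma (in prob_space) indep_dist_moment:
  fixes V W :: "'a \<Rightarrow> 'c::{second_countable_topology, metric_space}"
  assumes "indep_var borel V borel W"
  shows "(\<integral>\<^sup>+\<omega>. ennreal (dist (V \<omega>) (W \<omega>) powr n) \<partial>M)
    = (\<integral>\<^sup>+q. \<integral>\<^sup>+p. ennreal (dist p q powr n) \<partial>distr M borel V \<partial>distr M borel W)"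
proof -
  have VW: "V \<in> M \<rightarrow>\<^sub>M borel" "W \<in> M \<rightarrow>\<^sub>M borel"
    and eq: "distr M borel V \<Otimes>\<^sub>M distr M borel W = distr M (borel \<Otimes>\<^sub>M borel) (\<lambda>\<omega>. (V \<omega>, W \<omega>))"
    using assms by (auto simp: indep_var_distribution_eq)
  note [measurable] = VW
  interpret V: prob_space "distr M borel V" by (rule prob_space_distr) fact
  interpret W: prob_space "distr M borel W" by (rule prob_space_distr) fact
  interpret pair_sigma_finite "distr M borel V" "distr M borel W" ..
  let ?f = "\<lambda>(p :: 'c, q :: 'c). ennreal (dist p q powr n)"
  have f: "?f \<in> borel_measurable (borel \<Otimes>\<^sub>M borel)" by measurable
  have "(\<integral>\<^sup>+\<omega>. ennreal (dist (V \<omega>) (W \<omega>) powr n) \<partial>M) = (\<integral>\<^sup>+\<omega>. ?f (V \<omega>, W \<omega>) \<partial>M)" by simp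
  also have "\<dots> = integral\<^sup>N (distr M (borel \<Otimes>\<^sub>M borel) (\<lambda>\<omega>. (V \<omega>, W \<omega>))) ?f"
    by (rule nn_integral_distr[symmetric]) (use f in measurable)
  also have "\<dots> = (\<integral>\<^sup>+q. \<integral>\<^sup>+p. ?f (p, q) \<partial>distr M borel V \<partial>distr M borel W)"
    unfolding eq[symmetric] by (rule nn_integral_snd[symmetric]) (use f in measurable)
  finally show ?thesis by simp
qed

text \<open>The comparison of strips, divided by total length and area. It holds for whichever
  parametrization underlies \<open>P\<close>, so it serves \<open>Y\<close> and \<open>Y'\<close>
  even if their laws are given by different ones.\<close>

lemma uniform_body_tail_le:
  assumes K: "convex_body K" and c: "\<And>p. p \<in> K \<Longrightarrow> 2 *\<^sub>R c - p \<in> K"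
    and P: "uniform_wrt_arc_length P (frontier K)" and u: "norm u = 1" and "\<tau> > 0"
  shows "emeasure (uniform_measure lborel K) {p. \<tau> < \<bar>u \<bullet> (p - c)\<bar>} \<le> emeasure P {p. \<tau> < \<bar>u \<bullet> (p - c)\<bar>}"
proof -
  let ?S = "{p. \<tau> < \<bar>u \<bullet> (p - c)\<bar>}"
  have S: "?S \<in> sets borel" by (intro borel_open open_Collect_less continuous_intros)
  obtain g L where g: "arc_length_parametrization g L (frontier K)"
    and law: "\<And>E. E \<in> sets borel \<Longrightarrow> emeasure P E = arc_measure g L E / ennreal L"
    using uniform_wrt_arc_length_emeasure[OF P] by metis
  have L: "0 < L" using g by (simp add: arc_length_parametrization_def)
  have comp: "compact K" and int: "interior K \<noteq> {}" using K by (auto simp: convex_body_def)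
  have Kb: "K \<in> sets borel" using comp by (simp add: borel_closed compact_imp_closed)
  have fin: "emeasure lborel K < \<infinity>" by (rule emeasure_compact_finite[OF comp])
  have "emeasure lborel K \<noteq> 0"
  proof
    assume "emeasure lborel K = 0"
    then have "K \<in> null_sets lebesgue" using Kb by (intro null_sets_completionI) auto
    then have "negligible (interior K)"
      using negligible_iff_null_sets negligible_subset interior_subset by metis
    then show False using int open_not_negligible by blast
  qed
  then have mK: "0 < measure lborel K"
    using fin emeasure_eq_ennreal_measure[of lborel K] by (auto simp: zero_less_measure_iff less_top)
  have finS: "emeasure lborel (K \<inter> ?S) < \<infinity>"
    using emeasure_mono[of "K \<inter> ?S" K lborel] Kb fin by (auto intro: le_less_trans)
  define a where "a = enn2real (arc_measure g L ?S)"
  have a: "arc_measure g L ?S = ennreal a"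
    unfolding a_def using arc_measure_le_length[of g L ?S] by (intro ennreal_enn2real[symmetric]) (auto intro: le_less_trans)
  have "L * measure lborel (K \<inter> ?S) \<le> a * measure lborel K"
    unfolding a_def by (rule body_strip_dominance[OF K c u g \<open>\<tau> > 0\<close>])
  then have le: "measure lborel (K \<inter> ?S) / measure lborel K \<le> a / L"
    using mK L by (simp add: field_simps)
  have "emeasure (uniform_measure lborel K) ?S = emeasure lborel (K \<inter> ?S) / emeasure lborel K"
    using Kb S by (subst emeasure_uniform_measure) auto
  also have "\<dots> = ennreal (measure lborel (K \<inter> ?S) / measure lborel K)"
    using fin finS mK by (simp add: emeasure_eq_ennreal_measure divide_ennreal less_top)
  also have "\<dots> \<le> ennreal (a / L)" using le by (rule ennreal_leI)
  also have "\<dots> = emeasure P ?S" unfolding law[OF S] a using L by (simp add: divide_ennreal a_def)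
  finally show ?thesis .
qed

lemma uniform_body_symmetric:
  assumes "K \<in> sets borel" and c: "\<And>p. p \<in> K \<Longrightarrow> 2 *\<^sub>R c - p \<in> K"
  shows "distr (uniform_measure lborel K) borel (\<lambda>p. 2 *\<^sub>R c - p) = uniform_measure lborel K"
proof (rule measure_eqI)
  fix E assume "E \<in> sets (distr (uniform_measure lborel K) borel (\<lambda>p. 2 *\<^sub>R c - p))"
  then have E: "E \<in> sets borel" by simp
  let ?r = "\<lambda>p. 2 *\<^sub>R c - p"
  have r: "?r \<in> borel_measurable borel" by measurable
  have rE: "?r -` E \<in> sets borel" using measurable_sets[OF r E] by simp
  have "emeasure lborel (K \<inter> ?r -` E) = emeasure lborel (?r -` (K \<inter> E))"
    using c by (intro arg_cong[where f="emeasure lborel"]) (force dest: c)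
  also have "\<dots> = emeasure (distr lborel borel ?r) (K \<inter> E)"
    using E assms(1) by (subst emeasure_distr) auto
  also have "\<dots> = emeasure lborel (K \<inter> E)" by (simp add: lborel_distr_reflect)
  finally have "emeasure lborel (K \<inter> ?r -` E) = emeasure lborel (K \<inter> E)" .
  then show "emeasure (distr (uniform_measure lborel K) borel ?r) E = emeasure (uniform_measure lborel K) E"
    using E rE assms(1) r by (subst emeasure_distr) auto
qed simp

lemma uniform_arc_symmetric:
  assumes P: "uniform_wrt_arc_length P C" and s[measurable_cong]: "sets P = sets borel"
    and c: "\<And>p. p \<in> C \<Longrightarrow> 2 *\<^sub>R c - p \<in> C"
  shows "distr P borel (\<lambda>p. 2 *\<^sub>R c - p) = P"
proof (rule measure_eqI)
  obtain g L where g: "arc_length_parametrization g L C"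
    and law: "\<And>E. E \<in> sets borel \<Longrightarrow> emeasure P E = arc_measure g L E / ennreal L"
    using uniform_wrt_arc_length_emeasure[OF P] by metis
  fix E assume "E \<in> sets (distr P borel (\<lambda>p. 2 *\<^sub>R c - p))"
  then have E: "E \<in> sets borel" by simp
  let ?r = "\<lambda>p. 2 *\<^sub>R c - p"
  have r: "?r \<in> borel_measurable borel" by measurable
  have rE: "?r -` E \<in> sets borel" using measurable_sets[OF r E] by simp
  have sp: "space P = UNIV" using sets_eq_imp_space_eq[OF s] by simp
  have "emeasure (distr P borel ?r) E = emeasure P (?r -` E)"
    using E sp by (subst emeasure_distr) auto
  also have "\<dots> = arc_measure g L {p. ?r p \<in> E} / ennreal L" using law[OF rE] by (simp add: vimage_def)
  also have "\<dots> = emeasure P E" using arc_measure_reflect[OF g c E] law[OF E] by simp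
  finally show "emeasure (distr P borel ?r) E = emeasure P E" .
qed (simp add: s)

text \<open>Distances on a compact support are bounded. Finiteness of the larger moment is what
  permits the passage from nonnegative integrals to expectations, as \<open>enn2real\<close> maps
  infinity to \<open>0\<close>.\<close>

lemma moment_finite:
  fixes P P' :: "(real^2) measure"
  assumes "prob_space P" "prob_space P'" and [measurable_cong]: "sets P = sets borel" "sets P' = sets borel"
    and C: "compact C" "AE p in P. p \<in> C" "AE p in P'. p \<in> C" and n: "n \<ge> 0"
  shows "(\<integral>\<^sup>+q. \<integral>\<^sup>+p. ennreal (dist p q powr n) \<partial>P \<partial>P') < \<top>"
proof -
  interpret P: prob_space P by fact
  interpret P': prob_space P' by fact
  obtain D where D: "\<And>p q. p \<in> C \<Longrightarrow> q \<in> C \<Longrightarrow> dist p q \<le> D"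
    using compact_imp_bounded[OF C(1)] by (metis bounded_two_points)
  have "(\<integral>\<^sup>+q. \<integral>\<^sup>+p. ennreal (dist p q powr n) \<partial>P \<partial>P') \<le> (\<integral>\<^sup>+q. ennreal (D powr n) \<partial>P')"
  proof (rule nn_integral_mono_AE)
    show "AE q in P'. (\<integral>\<^sup>+p. ennreal (dist p q powr n) \<partial>P) \<le> ennreal (D powr n)"
      using C(3)
    proof eventually_elim
      case (elim q)
      have "(\<integral>\<^sup>+p. ennreal (dist p q powr n) \<partial>P) \<le> (\<integral>\<^sup>+p. ennreal (D powr n) \<partial>P)"
      proof (rule nn_integral_mono_AE)
        show "AE p in P. ennreal (dist p q powr n) \<le> ennreal (D powr n)"
          using C(2) by eventually_elim (auto intro!: ennreal_leI powr_mono2 n D elim)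
      qed
      then show ?case by (simp add: P.emeasure_space_1)
    qed
  qed
  also have "\<dots> < \<top>" by (simp add: P'.emeasure_space_1)
  finally show ?thesis .
qed

lemma uniform_arc_AE:
  assumes "uniform_wrt_arc_length P C" and [measurable_cong]: "sets P = sets borel" and "closed C"
  shows "AE p in P. p \<in> C"
proof -
  obtain g L where g: "arc_length_parametrization g L C"
    and law: "\<And>E. E \<in> sets borel \<Longrightarrow> emeasure P E = arc_measure g L E / ennreal L"
    using uniform_wrt_arc_length_emeasure[OF assms(1)] by metis
  have "{s \<in> {0..L}. g s \<in> - C} = {}" using g by (auto simp: arc_length_parametrization_def)
  then have "arc_measure g L (- C) = 0" by (simp only: arc_measure_def emeasure_empty)
  then have "emeasure P (- C) = 0"
    using \<open>closed C\<close> law[of "- C"] by (simp add: borel_open open_Compl)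
  then show ?thesis using \<open>closed C\<close> assms(2) by (intro AE_I[of _ _ "- C"]) (auto simp: borel_open open_Compl)
qed

theorem corollary2:
  fixes K :: "(real^2) set"
    and M :: "'a measure" and X X' :: "'a \<Rightarrow> real^2"
    and N :: "'b measure" and Y Y' :: "'b \<Rightarrow> real^2"
    and n :: real
  assumes "convex_body K" and "centrally_symmetric K"
    and "prob_space M"
    and "prob_space.indep_var M borel X borel X'"
    and "distr M borel X = uniform_measure lborel K"
    and "distr M borel X' = uniform_measure lborel K"
    and "prob_space N"
    and "prob_space.indep_var N borel Y borel Y'"
    and "uniform_wrt_arc_length (distr N borel Y) (frontier K)"
    and "uniform_wrt_arc_length (distr N borel Y') (frontier K)"
    and "n \<ge> 1"
  shows "prob_space.expectation N (\<lambda>\<omega>. dist (Y \<omega>) (Y' \<omega>) powr n)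
       \<ge> prob_space.expectation M (\<lambda>\<omega>. dist (X \<omega>) (X' \<omega>) powr n)"
proof -
  interpret M: prob_space M by fact
  interpret N: prob_space N by fact
  obtain c where c: "\<And>p. p \<in> K \<Longrightarrow> 2 *\<^sub>R c - p \<in> K"
    using assms(2) by (auto simp: centrally_symmetric_def)
  have comp: "compact K" using assms(1) by (simp add: convex_body_def)
  have Kb: "K \<in> sets borel" using comp by (simp add: borel_closed compact_imp_closed)
  have cF: "2 *\<^sub>R c - p \<in> frontier K" if "p \<in> frontier K" for p
  proof -
    have conv: "convex K" using assms(1) by (simp add: convex_body_def)
    have fK: "frontier K = K - interior K" using comp by (simp add: frontier_def compact_imp_closed)
    \<comment> \<open>From an interior point of a convex set some positive step in every direction
      stays in the set; a step along \<open>x\<close> at \<open>p\<close> mirrors one along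
      \<open>-x\<close> at the reflected point.\<close>
    have "p \<in> interior K" if i: "2 *\<^sub>R c - p \<in> interior K"
      unfolding convex_interior_iff[OF conv]
    proof
      fix x
      obtain e where e: "e > 0" "2 *\<^sub>R c - p + e *\<^sub>R (- x) \<in> K"
        using i convex_interior_iff[OF conv] by blast
      then show "\<exists>e>0. p + e *\<^sub>R x \<in> K" using c[OF e(2)] by (auto simp: algebra_simps)
    qed
    then show ?thesis using that c unfolding fK by blast
  qed
  have rv: "X \<in> M \<rightarrow>\<^sub>M borel" "X' \<in> M \<rightarrow>\<^sub>M borel" "Y \<in> N \<rightarrow>\<^sub>M borel" "Y' \<in> N \<rightarrow>\<^sub>M borel"
    using M.indep_var_rv1[OF assms(4)] M.indep_var_rv2[OF assms(4)] N.indep_var_rv1[OF assms(8)] N.indep_var_rv2[OF assms(8)]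
    by auto
  note [measurable] = rv
  have pX: "prob_space (distr M borel X)" "prob_space (distr M borel X')"
    and pY: "prob_space (distr N borel Y)" "prob_space (distr N borel Y')"
    using rv by (auto intro: M.prob_space_distr N.prob_space_distr)
  have "(\<integral>\<^sup>+q. \<integral>\<^sup>+p. ennreal (dist p q powr n) \<partial>distr M borel X \<partial>distr M borel X')
      \<le> (\<integral>\<^sup>+q. \<integral>\<^sup>+p. ennreal (dist p q powr n) \<partial>distr N borel Y \<partial>distr N borel Y')"
  proof (rule planar_moment_mono[where c = c])
    show "distr (distr N borel Y) borel (\<lambda>p. 2 *\<^sub>R c - p) = distr N borel Y"
      by (rule uniform_arc_symmetric[OF assms(9) _ cF]) simp
    show "distr (distr M borel X) borel (\<lambda>p. 2 *\<^sub>R c - p) = distr M borel X"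
      unfolding assms(5) by (rule uniform_body_symmetric[OF Kb c])
    fix u :: "real^2" and \<tau> :: real assume u: "norm u = 1" "\<tau> > 0"
    show "emeasure (distr M borel X) {p. \<tau> < \<bar>u \<bullet> (p - c)\<bar>} \<le> emeasure (distr N borel Y) {p. \<tau> < \<bar>u \<bullet> (p - c)\<bar>}"
      unfolding assms(5) by (rule uniform_body_tail_le[OF assms(1) c assms(9) u])
    show "emeasure (distr M borel X') {p. \<tau> < \<bar>u \<bullet> (p - c)\<bar>} \<le> emeasure (distr N borel Y') {p. \<tau> < \<bar>u \<bullet> (p - c)\<bar>}"
      unfolding assms(6) by (rule uniform_body_tail_le[OF assms(1) c assms(10) u])
  qed (use pX pY assms(11) in auto)
  then have le: "(\<integral>\<^sup>+\<omega>. ennreal (dist (X \<omega>) (X' \<omega>) powr n) \<partial>M) \<le> (\<integral>\<^sup>+\<omega>. ennreal (dist (Y \<omega>) (Y' \<omega>) powr n) \<partial>N)"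
    using M.indep_dist_moment[OF assms(4)] N.indep_dist_moment[OF assms(8)] by simp
  have "(\<integral>\<^sup>+\<omega>. ennreal (dist (Y \<omega>) (Y' \<omega>) powr n) \<partial>N) < \<top>"
    unfolding N.indep_dist_moment[OF assms(8)]
    using assms(11) pY compact_frontier[OF comp]
    by (intro moment_finite[where C = "frontier K"] uniform_arc_AE assms(9,10)) auto
  then have "enn2real (\<integral>\<^sup>+\<omega>. ennreal (dist (X \<omega>) (X' \<omega>) powr n) \<partial>M) \<le> enn2real (\<integral>\<^sup>+\<omega>. ennreal (dist (Y \<omega>) (Y' \<omega>) powr n) \<partial>N)"
    using le by (intro enn2real_mono)
  moreover have "integral\<^sup>L M (\<lambda>\<omega>. dist (X \<omega>) (X' \<omega>) powr n) = enn2real (\<integral>\<^sup>+\<omega>. ennreal (dist (X \<omega>) (X' \<omega>) powr n) \<partial>M)"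
    by (rule integral_eq_nn_integral) auto
  moreover have "integral\<^sup>L N (\<lambda>\<omega>. dist (Y \<omega>) (Y' \<omega>) powr n) = enn2real (\<integral>\<^sup>+\<omega>. ennreal (dist (Y \<omega>) (Y' \<omega>) powr n) \<partial>N)"
    by (rule integral_eq_nn_integral) auto
  ultimately show ?thesis by simp
qed

end
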